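(* Let $(t^{(n)})_n$ be a sequence of cycle types, $t^{(n)}$ being of size $n$, such that $t_1^{(n)}=np_1+o(\sqrt n)$ and $2t_2^{(n)}=np_2+o(n)$ as $n\to\infty$, for some $p_1,p_2\in[0,1]$. For each $n$, let $\tau_n$ be a uniformly random $t^{(n)}$-cyclic permutation. Then for any integer $r\ge1$, we have the following (joint) convergence in distribution: $$\left(\frac{X_\pi(\tau_n)-\binom nr\mu_\pi^{p_1}}{n^{r-1/2}}\right)_{\pi\in\mathfrak{S}_r}\underset{n\to\infty}{\longrightarrow}\mathcal{N}(0,\Sigma^{p_1,p_2}),$$ where for any $\pi,\rho\in\mathfrak{S}_r$, if $U,V,W$ are i.i.d. uniform random variables on $[0,1]$: $$\begin{aligned}((r-1)!)^2\,\Sigma^{p_1,p_2}_{\pi,\rho}={}&p_1\,\mathrm{Cov}[\psi_\pi^{p_1}(U,U),\psi_\rho^{p_1}(U,U)]+(1-p_1)\,\mathrm{Cov}[\psi_\pi^{p_1}(U,V),\psi_\rho^{p_1}(U,V)]\\&+p_2\,\mathrm{Cov}[\psi_\pi^{p_1}(U,V),\psi_\rho^{p_1}(V,U)]+2(1-p_1-p_2)\,\mathrm{Cov}[\psi_\pi^{p_1}(U,V),\psi_\rho^{p_1}(V,W)].\end{aligned}$$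
   Context: $[n]=\{1,\dots,n\}$ and $\mathfrak{S}_r$ is the set of permutations of $[r]$. A cycle type of size $n$ is a sequence $t=(t_1,\dots,t_n)$ of nonnegative integers with $\sum_{p=1}^n p\,t_p=n$; a permutation of $[n]$ is $t$-cyclic if it has exactly $t_p$ cycles of length $p$ for every $p$ (fixed points are $1$-cycles). For $\tau\in\mathfrak{S}_n$ and $\pi\in\mathfrak{S}_r$, $X_\pi(\tau)$ is the number of subsets $\{i_1<\dots<i_r\}$ of $[n]$ such that for all $j,k\in[r]$, $\pi(j)>\pi(k)\iff\tau(i_j)>\tau(i_k)$. For a set of $r$ points in the plane with pairwise distinct x-coordinates and pairwise distinct y-coordinates, $\mathrm{Perm}$ of this set is the permutation $\tau\in\mathfrak{S}_r$ such that $\tau(i)=j$ when the $i$-th point from the left is the $j$-th point from the bottom. Fix $r\ge1$ and $p_1\in[0,1]$, and let $\hat Z_1,\dots,\hat Z_r$ be i.i.d. with law $p_1\mathrm{Leb}_\Delta+(1-p_1)\mathrm{Leb}_{[0,1]^2}$, where $\mathrm{Leb}_\Delta$ is the uniform probability measure on the diagonal of $[0,1]^2$ (the law of $(U,U)$ for $U$ uniform on $[0,1]$) and $\mathrm{Leb}_{[0,1]^2}$ is Lebesgue measure on $[0,1]^2$. For $z\in[0,1]^2$ set $\psi_\pi^{p_1}(z):=\mathbf{P}(\mathrm{Perm}(\{\hat Z_1,\dots,\hat Z_{r-1},z\})=\pi)$, and $\mu_\pi^{p_1}:=\mathbf{P}(\mathrm{Perm}(\{\hat Z_1,\dots,\hat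 Z_r\})=\pi)=\mathbb{E}[\psi_\pi^{p_1}(\hat Z_r)]$.
   Formalization: The printed matrix Σ is in general not symmetric (its last covariance is not symmetric in π and ρ), so N(0,Σ) is understood as the centered Gaussian law with characteristic function exp(-aᵀΣa/2), i.e. with covariance matrix the symmetric part (Σ+Σᵀ)/2. *)

theory Defs
  imports
    "HOL-Probability.Probability"
    "HOL-Combinatorics.Permutations"
    "HOL-Combinatorics.Orbits"
    "HOL-Library.Landau_Symbols"
begin

text \<open>
  The set \<open>[n]\<close> is \<open>{1..n}\<close>, and a permutation of \<open>[n]\<close> is a function on the naturals that
  \<^const>\<open>permutes\<close> \<open>{1..n}\<close> (hence is the identity elsewhere).
\<close>

definition Sym :: "nat \<Rightarrow> (nat \<Rightarrow> nat) set" where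
  "Sym r = {\<pi>. \<pi> permutes {1..r}}"

definition is_cycle_type :: "nat \<Rightarrow> (nat \<Rightarrow> nat) \<Rightarrow> bool" where
  "is_cycle_type n t \<longleftrightarrow> (\<Sum>p = 1..n. p * t p) = n"

definition num_cycles :: "nat \<Rightarrow> (nat \<Rightarrow> nat) \<Rightarrow> nat \<Rightarrow> nat" where
  "num_cycles n \<tau> p = card {C \<in> orbit \<tau> ` {1..n}. card C = p}"

definition cyclic_perms :: "nat \<Rightarrow> (nat \<Rightarrow> nat) \<Rightarrow> (nat \<Rightarrow> nat) set" where
  "cyclic_perms n t = {\<tau> \<in> Sym n. \<forall>p\<in>{1..n}. num_cycles n \<tau> p = t p}"

definition nth_least :: "nat set \<Rightarrow> nat \<Rightarrow> nat" where
  "nth_least I j = sorted_list_of_set I ! (j - 1)"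

definition pattern_count :: "nat \<Rightarrow> nat \<Rightarrow> (nat \<Rightarrow> nat) \<Rightarrow> (nat \<Rightarrow> nat) \<Rightarrow> nat" where
  "pattern_count n r \<pi> \<tau> =
     card {I. I \<subseteq> {1..n} \<and> card I = r \<and>
       (\<forall>j\<in>{1..r}. \<forall>k\<in>{1..r}.
          \<pi> j > \<pi> k \<longleftrightarrow> \<tau> (nth_least I j) > \<tau> (nth_least I k))}"

text \<open>
  \<open>is_Perm r P \<pi>\<close>: the set \<open>P\<close> consists of \<open>r\<close> points with pairwise distinct x-coordinates and
  pairwise distinct y-coordinates, and \<open>Perm(P) = \<pi>\<close>. A point \<open>z \<in> P\<close> is the \<open>i\<close>-th from the
  left for \<open>i = card {w \<in> P. fst w \<le> fst z}\<close>, and likewise from the bottom with \<open>snd\<close>.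
\<close>

definition is_Perm :: "nat \<Rightarrow> (real \<times> real) set \<Rightarrow> (nat \<Rightarrow> nat) \<Rightarrow> bool" where
  "is_Perm r P \<pi> \<longleftrightarrow>
     finite P \<and> card P = r \<and> inj_on fst P \<and> inj_on snd P \<and> \<pi> \<in> Sym r \<and>
     (\<forall>z\<in>P. \<pi> (card {w \<in> P. fst w \<le> fst z}) = card {w \<in> P. snd w \<le> snd z})"

definition unif01 :: "real measure" where
  "unif01 = uniform_measure lborel {0..1}"

definition unif_diag :: "(real \<times> real) measure" where
  "unif_diag = distr unif01 borel (\<lambda>u. (u, u))"

definition unif_square :: "(real \<times> real) measure" where
  "unif_square = uniform_measure lborel ({0..1} \<times> {0..1})"

text \<open>The mixture \<open>p Leb\<^sub>\<Delta> + (1 - p) Leb\<close>, as the law of a point drawn after tossing a \<open>p\<close>-coin.\<close>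

definition point_law :: "real \<Rightarrow> (real \<times> real) measure" where
  "point_law p =
     measure_pmf (bernoulli_pmf p) \<bind> (\<lambda>b. if b then unif_diag else unif_square)"

definition \<psi> :: "nat \<Rightarrow> real \<Rightarrow> (nat \<Rightarrow> nat) \<Rightarrow> real \<times> real \<Rightarrow> real" where
  "\<psi> r p \<pi> z =
     (let Q = PiM {1..<r} (\<lambda>_. point_law p)
      in measure Q {Z \<in> space Q. is_Perm r (insert z (Z ` {1..<r})) \<pi>})"

definition \<mu> :: "nat \<Rightarrow> real \<Rightarrow> (nat \<Rightarrow> nat) \<Rightarrow> real" where
  "\<mu> r p \<pi> =
     (let Q = PiM {1..r} (\<lambda>_. point_law p)
      in measure Q {Z \<in> space Q. is_Perm r (Z ` {1..r}) \<pi>})"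

definition covariance :: "'a measure \<Rightarrow> ('a \<Rightarrow> real) \<Rightarrow> ('a \<Rightarrow> real) \<Rightarrow> real" where
  "covariance M X Y =
     (LINT x|M. (X x - (LINT x|M. X x)) * (Y x - (LINT x|M. Y x)))"

definition unif_triple :: "(real \<times> real \<times> real) measure" where
  "unif_triple = unif01 \<Otimes>\<^sub>M unif01 \<Otimes>\<^sub>M unif01"

definition cov_mat :: "nat \<Rightarrow> real \<Rightarrow> real \<Rightarrow> (nat \<Rightarrow> nat) \<Rightarrow> (nat \<Rightarrow> nat) \<Rightarrow> real" where
  "cov_mat r p1 p2 \<pi> \<rho> =
     (p1 * covariance unif_triple
              (\<lambda>(U, V, W). \<psi> r p1 \<pi> (U, U)) (\<lambda>(U, V, W). \<psi> r p1 \<rho> (U, U))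
      + (1 - p1) * covariance unif_triple
              (\<lambda>(U, V, W). \<psi> r p1 \<pi> (U, V)) (\<lambda>(U, V, W). \<psi> r p1 \<rho> (U, V))
      + p2 * covariance unif_triple
              (\<lambda>(U, V, W). \<psi> r p1 \<pi> (U, V)) (\<lambda>(U, V, W). \<psi> r p1 \<rho> (V, U))
      + 2 * (1 - p1 - p2) * covariance unif_triple
              (\<lambda>(U, V, W). \<psi> r p1 \<pi> (U, V)) (\<lambda>(U, V, W). \<psi> r p1 \<rho> (V, W)))
     / (fact (r - 1))\<^sup>2"

text \<open>
  The law \<open>N(0, \<Sigma>)\<close> on the space of vectors indexed by \<open>I\<close>, characterised by its characteristic
  function; this includes degenerate \<open>\<Sigma>\<close>. Only the quadratic form \<open>a \<mapsto> a\<^sup>T \<Sigma> a\<close> enters, so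
  for a matrix that is not symmetric the covariance matrix is its symmetric part. This matters:
  the last covariance in \<open>cov_mat\<close> is in general not symmetric in \<open>\<pi>\<close> and \<open>\<rho>\<close>.
\<close>

definition is_centered_gaussian :: "'i set \<Rightarrow> ('i \<Rightarrow> 'i \<Rightarrow> real) \<Rightarrow> ('i \<Rightarrow> real) measure \<Rightarrow> bool"
  where
  "is_centered_gaussian I \<Sigma> N \<longleftrightarrow>
     prob_space N \<and> sets N = sets (PiM I (\<lambda>_. borel)) \<and>
     (\<forall>a :: 'i \<Rightarrow> real.
        (CLINT x|N. iexp (\<Sum>i\<in>I. a i * x i)) =
        complex_of_real (exp (- (\<Sum>i\<in>I. \<Sum>j\<in>I. a i * \<Sigma> i j * a j) / 2)))"

definition converges_weakly :: "'a topology \<Rightarrow> (nat \<Rightarrow> 'a measure) \<Rightarrow> 'a measure \<Rightarrow> bool" where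
  "converges_weakly T M N \<longleftrightarrow>
     (\<forall>f. continuous_map T euclideanreal f \<and> bounded (f ` topspace T) \<longrightarrow>
        (\<lambda>n. LINT x|M n. f x) \<longlonglongrightarrow> (LINT x|N. f x))"

definition rescaled_counts_law ::
  "nat \<Rightarrow> real \<Rightarrow> nat \<Rightarrow> (nat \<Rightarrow> nat) \<Rightarrow> ((nat \<Rightarrow> nat) \<Rightarrow> real) measure" where
  "rescaled_counts_law r p n t =
     distr (measure_pmf (pmf_of_set (cyclic_perms n t))) (PiM (Sym r) (\<lambda>_. borel))
       (\<lambda>\<tau>. \<lambda>\<pi>\<in>Sym r.
          (real (pattern_count n r \<pi> \<tau>) - real (n choose r) * \<mu> r p \<pi>)
            / real n powr (real r - 1 / 2))"

end

theory Submission
  imports Defs "HOL-Combinatorics.Cycles"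
begin

text \<open>
  Conjugating a fixed \<open>\<sigma>\<close> of cycle type \<open>t\<close> by the ranking permutation of i.i.d. uniform labels
  \<open>u 1, \<dots>, u n\<close> gives a uniform \<open>t\<close>-cyclic permutation, and the pattern counts of this conjugate are
  sums, over \<open>r\<close>-tuples of indices \<open>k\<close>, of functions of the points \<open>(u k, u (\<sigma> k))\<close>. Two tuples whose
  indices are not linked by \<open>\<sigma>\<close> contribute independently, so Stein's method for locally dependent
  variables (in the form of a differential equation for the characteristic function) bounds the
  distance to a Gaussian in terms of \<open>n\<close> alone. The mean and the variance depend on \<open>\<sigma>\<close>, up to negligible
  terms, only through the numbers of fixed points and of \<open>2\<close>-cycles: in a pair of tuples sharing a single
  link, the linked indices \<open>k, l\<close> satisfy \<open>l = k\<close>, \<open>l = \<sigma> k\<close> or \<open>k = \<sigma> l\<close>, and the other indices average out to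
  the law \<open>point_law\<close>. Convergence of the characteristic functions and of second moments gives
  weak convergence.
\<close>

section \<open>Independent uniform coordinates\<close>

text \<open>The entries of a uniform t-cyclic permutation are globally dependent; conjugation moves
  all randomness into independent labels and leaves \<open>\<sigma>\<close> as a parameter. The
  price is that every bound must be uniform over the class, which works because the class fixes both
  fractions entering the bounds. The exponent r - 1/2 balances the estimates: n^r summands of size
  n^(1/2 - r), each with O(n^(r-1)) dependent partners, give an error (number times squared degree
  times cubed size) of order n^(-1/2). In the variance, pairs of tuples with one link number about
  n^(2r-1), those with a second or an internal link only O(n^(2r-2)). The rate o(sqrt n) for the
  fixed points is dictated by the mean: replacing their fraction q by p_1 moves it by at most a
  constant times n^r |q - p_1|, that is |n q - n p_1| / sqrt n after rescaling. Joint convergence is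
  reduced to real-valued sums by taking a linear combination of all patterns as the kernel. The
  Gaussian law is built from the quadratic form of the covariances, which is nonnegative as a limit
  of variances.\<close>

lemma prob_space_unif01: "prob_space unif01"
  unfolding unif01_def by (rule prob_space_uniform_measure) auto

lemma sets_unif01 [measurable_cong, simp]: "sets unif01 = sets borel"
  by (simp add: unif01_def)

lemma space_unif01 [simp]: "space unif01 = UNIV"
  by (simp add: unif01_def)

text \<open>Labels are indexed by all naturals and not by [n]: one space serves every n, and a spare
  coordinate is always at hand for an auxiliary uniform variable.\<close>

definition unif_seq :: "(nat \<Rightarrow> real) measure" where
  "unif_seq = PiM UNIV (\<lambda>_. unif01)"

lemma prob_space_unif_seq: "prob_space unif_seq"
  unfolding unif_seq_def by (intro prob_space_PiM prob_space_unif01)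

lemma sets_unif_seq [measurable_cong]: "sets unif_seq = sets (PiM UNIV (\<lambda>_. borel))"
  unfolding unif_seq_def by (intro sets_PiM_cong) auto

lemma space_unif_seq [simp]: "space unif_seq = UNIV"
  by (simp add: unif_seq_def space_PiM)

definition mix :: "nat set \<Rightarrow> (nat \<Rightarrow> real) \<Rightarrow> (nat \<Rightarrow> real) \<Rightarrow> nat \<Rightarrow> real" where
  "mix S u v k = (if k \<in> S then u k else v k)"

lemma measurable_mix [measurable]:
  "(\<lambda>x. mix S (fst x) (snd x)) \<in> measurable (unif_seq \<Otimes>\<^sub>M unif_seq) unif_seq"
proof -
  have "(\<lambda>x. mix S (fst x) (snd x) k) \<in> borel_measurable (unif_seq \<Otimes>\<^sub>M unif_seq)" for k
    by (cases "k \<in> S") (simp_all add: mix_def)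
  then have "(\<lambda>x. mix S (fst x) (snd x)) \<in> measurable (unif_seq \<Otimes>\<^sub>M unif_seq) (PiM UNIV (\<lambda>_. borel))"
    by (intro measurable_PiM_single') auto
  then show ?thesis
    by (simp cong: measurable_cong_sets add: sets_unif_seq)
qed

text \<open>Cylinder probabilities are products over coordinates, and the factors split into those
  inside \<open>S\<close>, read from the first copy, and those outside, read from the second.
  Independence of functions of disjoint coordinate sets is derived from this splicing.\<close>

lemma distr_mix:
  "distr (unif_seq \<Otimes>\<^sub>M unif_seq) unif_seq (\<lambda>x. mix S (fst x) (snd x)) = unif_seq"
proof -
  interpret U1: prob_space unif01 by (rule prob_space_unif01)
  interpret U: product_prob_space "\<lambda>_. unif01" "UNIV :: nat set" by unfold_locales
  interpret P: prob_space unif_seq by (rule prob_space_unif_seq)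
  have "distr (unif_seq \<Otimes>\<^sub>M unif_seq) unif_seq (\<lambda>x. mix S (fst x) (snd x)) = PiM UNIV (\<lambda>_. unif01)"
  proof (rule U.PiM_eq)
    show "sets (distr (unif_seq \<Otimes>\<^sub>M unif_seq) unif_seq (\<lambda>x. mix S (fst x) (snd x)))
       = sets (PiM UNIV (\<lambda>_. unif01))"
      by (simp add: unif_seq_def)
    fix J :: "nat set" and F assume J: "finite J" "\<And>j. j \<in> J \<Longrightarrow> F j \<in> sets unif01"
    let ?E = "\<lambda>J. {u \<in> space (PiM UNIV (\<lambda>_. unif01)). \<forall>j\<in>J. u j \<in> F j}"
    have emb: "prod_emb UNIV (\<lambda>_. unif01) J' (PiE J' F) = ?E J'" if "J' \<subseteq> J" for J'
      unfolding prod_emb_def using that by (auto simp: space_PiM Pi_iff)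
    have m: "emeasure unif_seq (?E J') = (\<Prod>j\<in>J'. emeasure unif01 (F j))" if "J' \<subseteq> J" for J'
      unfolding unif_seq_def using J that
      by (intro U.emeasure_PiM_Collect) (auto intro: finite_subset)
    have s: "?E J' \<in> sets unif_seq" if "J' \<subseteq> J" for J'
      using J that emb[OF that] unfolding unif_seq_def
      by (subst emb[OF that, symmetric]) (intro sets_PiM_I, auto intro: finite_subset)
    have "emeasure (distr (unif_seq \<Otimes>\<^sub>M unif_seq) unif_seq (\<lambda>x. mix S (fst x) (snd x))) (?E J)
       = emeasure (unif_seq \<Otimes>\<^sub>M unif_seq) ((\<lambda>x. mix S (fst x) (snd x)) -` ?E J \<inter> space (unif_seq \<Otimes>\<^sub>M unif_seq))"
      using s[of J] by (intro emeasure_distr) auto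
    also have "(\<lambda>x. mix S (fst x) (snd x)) -` ?E J \<inter> space (unif_seq \<Otimes>\<^sub>M unif_seq)
        = ?E (J \<inter> S) \<times> ?E (J - S)"
      by (auto simp: mix_def space_PiM space_pair_measure split: if_splits)
    also have "emeasure (unif_seq \<Otimes>\<^sub>M unif_seq) \<dots> = emeasure unif_seq (?E (J \<inter> S)) * emeasure unif_seq (?E (J - S))"
      by (intro P.emeasure_pair_measure_Times s) auto
    also have "\<dots> = (\<Prod>j\<in>J \<inter> S. emeasure unif01 (F j)) * (\<Prod>j\<in>J - S. emeasure unif01 (F j))"
      by (subst (1 2) m) auto
    also have "\<dots> = (\<Prod>j\<in>J. emeasure unif01 (F j))"
      using J(1) by (metis prod.Int_Diff)
    finally show "emeasure (distr (unif_seq \<Otimes>\<^sub>M unif_seq) unif_seq (\<lambda>x. mix S (fst x) (snd x)))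
       (prod_emb UNIV (\<lambda>_. unif01) J (Pi\<^sub>E J F)) = (\<Prod>j\<in>J. emeasure unif01 (F j))"
      by (simp add: emb)
  qed
  then show ?thesis by (simp add: unif_seq_def)
qed

text \<open>Pointwise dependence on coordinates takes the place of measurability with respect to a
  sub-sigma-algebra; it is easy to check for kernels of finitely many labels, and disjoint sets
  yield independence.\<close>

definition depends_on :: "((nat \<Rightarrow> 'a) \<Rightarrow> 'b) \<Rightarrow> nat set \<Rightarrow> bool" where
  "depends_on f S \<longleftrightarrow> (\<forall>u v. (\<forall>k\<in>S. u k = v k) \<longrightarrow> f u = f v)"

lemma depends_on_mix: "depends_on f S \<Longrightarrow> f (mix S u v) = f u"
  unfolding depends_on_def by (metis mix_def)

lemma depends_on_mix': "depends_on f T \<Longrightarrow> S \<inter> T = {} \<Longrightarrow> f (mix S u v) = f v"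
  unfolding depends_on_def by (metis disjoint_iff mix_def)

text \<open>Replacing \<open>u\<close> by a splice of two independent copies along \<open>S\<close>
  leaves the law unchanged; at the spliced point the first argument of \<open>H\<close> sees only
  one copy and the second only the other. Unlike plain independence this also covers functions
  \<open>H\<close> that are not products.\<close>

lemma integral_freeze:
  fixes H :: "(nat \<Rightarrow> real) \<Rightarrow> (nat \<Rightarrow> real) \<Rightarrow> 'b::{banach, second_countable_topology}"
  assumes [measurable]: "(\<lambda>x. H (fst x) (snd x)) \<in> borel_measurable (unif_seq \<Otimes>\<^sub>M unif_seq)"
    and bound: "\<And>u v. norm (H u v) \<le> K"
    and S: "\<And>v. depends_on (\<lambda>u. H u v) S" and T: "\<And>u. depends_on (H u) T" and "S \<inter> T = {}"
  shows "(LINT u|unif_seq. H u u) = (LINT u|unif_seq. LINT v|unif_seq. H u v)"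
proof -
  interpret P: prob_space unif_seq by (rule prob_space_unif_seq)
  interpret PP: pair_prob_space unif_seq unif_seq ..
  have [measurable]: "(\<lambda>u. H u u) \<in> borel_measurable unif_seq"
    using measurable_compose[OF _ assms(1), of "\<lambda>u. (u, u)"] by simp
  have "(LINT u|unif_seq. H u u) = (LINT u|distr (unif_seq \<Otimes>\<^sub>M unif_seq) unif_seq (\<lambda>x. mix S (fst x) (snd x)). H u u)"
    by (simp add: distr_mix)
  also have "\<dots> = (LINT x|(unif_seq \<Otimes>\<^sub>M unif_seq). H (mix S (fst x) (snd x)) (mix S (fst x) (snd x)))"
    by (intro integral_distr) auto
  also have "\<dots> = (LINT x|(unif_seq \<Otimes>\<^sub>M unif_seq). H (fst x) (snd x))"
    using depends_on_mix[OF S] depends_on_mix'[OF T \<open>S \<inter> T = {}\<close>] by simp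
  also have "\<dots> = (LINT u|unif_seq. LINT v|unif_seq. H u v)"
  proof -
    have "integrable (unif_seq \<Otimes>\<^sub>M unif_seq) (case_prod H)"
      using bound by (intro PP.integrable_const_bound[of _ K]) (auto simp: case_prod_beta)
    from PP.integral_fst[OF this] show ?thesis by (simp add: case_prod_beta')
  qed
  finally show ?thesis .
qed

lemma integral_indep:
  fixes f g :: "(nat \<Rightarrow> real) \<Rightarrow> 'b::{real_normed_field, banach, second_countable_topology}"
  assumes [measurable]: "f \<in> borel_measurable unif_seq" "g \<in> borel_measurable unif_seq"
    and "\<And>u. norm (f u) \<le> K" "\<And>u. norm (g u) \<le> L"
    and "depends_on f S" "depends_on g T" "S \<inter> T = {}"
  shows "(LINT u|unif_seq. f u * g u) = (LINT u|unif_seq. f u) * (LINT u|unif_seq. g u)"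
proof -
  have "(LINT u|unif_seq. f u * g u) = (LINT u|unif_seq. LINT v|unif_seq. f u * g v)"
  proof (rule integral_freeze[where K = "K * L" and S = S and T = T])
    show "norm (f u * g v) \<le> K * L" for u v
      using assms(3)[of u] assms(4)[of v] norm_ge_zero[of "f u"] norm_ge_zero[of "g v"]
      unfolding norm_mult by (intro mult_mono) linarith+
    show "(\<lambda>x. f (fst x) * g (snd x)) \<in> borel_measurable (unif_seq \<Otimes>\<^sub>M unif_seq)"
      by measurable
    show "depends_on (\<lambda>u. f u * g v) S" "depends_on (\<lambda>v. f u * g v) T" for u v
      using assms(5,6) unfolding depends_on_def by metis+
  qed (fact assms)
  then show ?thesis by simp
qed

section \<open>Permutations of a given cycle type\<close>

lemma exists_cyclic_perm:
  assumes "finite B" "B \<noteq> {}"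
  obtains g where "g permutes B" "cyclic_on g B"
proof -
  obtain cs where cs: "set cs = B" "distinct cs" using finite_distinct_list[OF assms(1)] by blast
  let ?g = "cycle_of_list cs"
  have ne: "cs \<noteq> []" using cs(1) assms(2) by auto
  have rot: "(?g ^^ m) (cs ! 0) = cs ! (m mod length cs)" for m
  proof -
    have "(?g ^^ m) (cs ! 0) = map (?g ^^ m) cs ! 0" using ne by simp
    also have "\<dots> = cs ! (m mod length cs)"
      using ne by (subst cyclic_rotation[OF cs(2)]) (simp add: nth_rotate)
    finally show ?thesis .
  qed
  have "orbit ?g (cs ! 0) = B"
  proof
    show "orbit ?g (cs ! 0) \<subseteq> B"
      using ne cs(1) by (auto simp: orbit_altdef rot)
    show "B \<subseteq> orbit ?g (cs ! 0)"
    proof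
      fix x assume "x \<in> B"
      then obtain k where k: "k < length cs" "x = cs ! k" using cs(1) by (auto simp: in_set_conv_nth)
      \<comment> \<open>\<open>orbit\<close> contains only positive powers, so a full turn
        \<open>length cs\<close> is added to cover \<open>k = 0\<close>.\<close>
      then have "x = (?g ^^ (k + length cs)) (cs ! 0)" "0 < k + length cs" using rot ne by auto
      then show "x \<in> orbit ?g (cs ! 0)" unfolding orbit_altdef by blast
    qed
  qed
  moreover have "cs ! 0 \<in> B" using ne cs(1) by auto
  ultimately show thesis
    using that[of ?g] cycle_permutes[of cs] cs(1) by (auto intro: cyclic_on_singleI)
qed

lemma perm_orbit_self: "f permutes S \<Longrightarrow> finite S \<Longrightarrow> x \<in> orbit f x"
  by (intro permutation_self_in_orbit) (auto simp: permutation_permutes)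

text \<open>Induction on the number of cycles: one cycle is placed on an arbitrary block of
  \<open>p\<close> elements and composed with a permutation of the remaining points.
  \<open>A\<close> is an arbitrary finite set because any block may be removed, and \<open>N\<close>
  is kept apart from \<open>card A\<close>, which shrinks in the induction.\<close>

lemma exists_perm_cycle_type:
  fixes A :: "nat set"
  assumes "finite A" "(\<Sum>p = 1..N. p * t p) = card A"
  shows "\<exists>f. f permutes A \<and> (\<forall>p\<in>{1..N}. card {C \<in> orbit f ` A. card C = p} = t p)"
  using assms
proof (induction "\<Sum>p = 1..N. t p" arbitrary: A t)
  case 0
  then have "A = {}" by simp
  then show ?case using 0 by (intro exI[of _ id]) auto
next
  case (Suc m)
  then have "(\<Sum>p = 1..N. t p) \<noteq> 0" by linarith
  have "\<exists>p\<in>{1..N}. t p \<noteq> 0" 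
  proof (rule ccontr)
    assume "\<not> (\<exists>p\<in>{1..N}. t p \<noteq> 0)"
    then have "(\<Sum>p = 1..N. t p) = 0" by (intro sum.neutral) auto
    with \<open>(\<Sum>p = 1..N. t p) \<noteq> 0\<close> show False by simp
  qed
  then obtain p where p: "p \<in> {1..N}" "0 < t p" by auto
  have sum_t: "(\<Sum>q = 1..N. c q * t q) = c p * t p + (\<Sum>q\<in>{1..N} - {p}. c q * t q)" for c and t :: "nat \<Rightarrow> nat"
    using p by (intro sum.remove) auto
  let ?t = "t(p := t p - 1)"
  have split: "(\<Sum>q = 1..N. c q * t q) = c p + (\<Sum>q = 1..N. c q * ?t q)" for c
  proof -
    have "(\<Sum>q\<in>{1..N} - {p}. c q * ?t q) = (\<Sum>q\<in>{1..N} - {p}. c q * t q)" by (intro sum.cong) auto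
    moreover have "c p * t p = c p + c p * (t p - 1)" using p(2) by (cases "t p") auto
    ultimately show ?thesis using sum_t[of c t] sum_t[of c ?t] by simp
  qed
  have "p \<le> card A" using split[of "\<lambda>q. q"] Suc.prems by simp
  then obtain B where B: "B \<subseteq> A" "card B = p" by (metis obtain_subset_with_card_n)
  have fB: "finite B" "B \<noteq> {}" using B p Suc.prems(1) by (auto intro: finite_subset)
  have "(\<Sum>q = 1..N. q * ?t q) = card (A - B)"
    using split[of "\<lambda>q. q"] Suc.prems B fB by (simp add: card_Diff_subset)
  moreover have "m = (\<Sum>q = 1..N. ?t q)" using split[of "\<lambda>_. 1"] Suc.hyps(2) by simp
  ultimately obtain f where f: "f permutes A - B" "\<And>q. q \<in> {1..N} \<Longrightarrow> card {C \<in> orbit f ` (A - B). card C = q} = ?t q"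
    using Suc.hyps(1)[of ?t "A - B"] Suc.prems(1) by auto
  obtain g where g: "g permutes B" "cyclic_on g B" using exists_cyclic_perm[OF fB] .
  let ?h = "f \<circ> g"
  have h: "?h permutes A"
    using f(1) g(1) B(1) by (intro permutes_compose permutes_subset[of g B A] permutes_subset[of f "A - B" A]) auto
  have oB: "orbit ?h x = B" if "x \<in> B" for x
    using permutes_comp_preserves_cyclic2[OF f(1) g(2), of B] that by (intro orbit_cyclic_eq3) auto
  have oA: "orbit ?h x = orbit f x" if "x \<in> A - B" for x
  proof -
    have s: "orbit f x \<subseteq> A - B" using permutes_orbit_subset[OF f(1) that] .
    have "cyclic_on ?h (orbit f x)"
      using f(1) g(1) s Suc.prems(1) by (intro permutes_comp_preserves_cyclic1[of g B f _ "A - B"] cyclic_on_orbit[of f "A - B"]) auto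
    then show ?thesis using perm_orbit_self[OF f(1)] Suc.prems(1) by (intro orbit_cyclic_eq3) auto
  qed
  have "orbit ?h ` A = orbit ?h ` B \<union> orbit ?h ` (A - B)" using B(1) by blast
  also have "orbit ?h ` B = {B}" using oB fB(2) by (auto simp: image_def)
  also have "orbit ?h ` (A - B) = orbit f ` (A - B)" using oA by (intro image_cong) auto
  finally have orbs: "orbit ?h ` A = insert B (orbit f ` (A - B))" unfolding insert_is_Un[symmetric] .
  \<comment> \<open>Orbits of \<open>f\<close> stay inside \<open>A - B\<close>, so the new block is
    an orbit not counted before.\<close>
  have notin: "B \<notin> orbit f ` (A - B)"
    using permutes_orbit_subset[OF f(1)] fB(2) by blast
  have "card {C \<in> orbit ?h ` A. card C = q} = t q" if q: "q \<in> {1..N}" for q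
  proof (cases "q = p")
    case True
    then have "{C \<in> orbit ?h ` A. card C = q} = insert B {C \<in> orbit f ` (A - B). card C = q}"
      using B(2) unfolding orbs by auto
    then have "card {C \<in> orbit ?h ` A. card C = q} = Suc (card {C \<in> orbit f ` (A - B). card C = q})"
      using notin Suc.prems(1) by simp
    also have "\<dots> = t q" using f(2)[OF q] True p(2) by simp
    finally show ?thesis .
  next
    case False
    then have "{C \<in> orbit ?h ` A. card C = q} = {C \<in> orbit f ` (A - B). card C = q}"
      using B(2) unfolding orbs by auto
    then show ?thesis using f(2)[OF q] False by simp
  qed
  then show ?case using h by blast
qed

lemma Sym_finite [simp]: "finite (Sym r)"
  unfolding Sym_def by (rule finite_permutations) simp

lemma cyclic_perms_sub: "cyclic_perms n t \<subseteq> Sym n"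
  by (auto simp: cyclic_perms_def)

lemma finite_cyclic_perms [simp]: "finite (cyclic_perms n t)"
  by (rule finite_subset[OF cyclic_perms_sub Sym_finite])

lemma cyclic_perms_nonempty:
  assumes "is_cycle_type n t" shows "cyclic_perms n t \<noteq> {}"
proof -
  have "\<exists>f. f permutes {1..n} \<and> (\<forall>p\<in>{1..n}. card {C \<in> orbit f ` {1..n}. card C = p} = t p)"
    using assms by (intro exists_perm_cycle_type) (simp_all add: is_cycle_type_def)
  then show ?thesis unfolding cyclic_perms_def Sym_def num_cycles_def by blast
qed

section \<open>Conjugation invariance of cycle types\<close>

lemma orbit_conj:
  assumes "bij s"
  shows "orbit (s \<circ> \<tau> \<circ> inv s) (s x) = s ` orbit \<tau> x"
proof -
  have "((s \<circ> \<tau> \<circ> inv s) ^^ m) (s x) = s ((\<tau> ^^ m) x)" for m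
    using assms by (induction m) (auto simp: bij_is_inj)
  then show ?thesis by (auto simp: orbit_altdef)
qed

lemma num_cycles_conj:
  assumes "s \<in> Sym n"
  shows "num_cycles n (s \<circ> \<tau> \<circ> inv s) p = num_cycles n \<tau> p"
proof -
  have s: "s permutes {1..n}" using assms by (simp add: Sym_def)
  have inj: "inj s" using permutes_inj[OF s] .
  have "orbit (s \<circ> \<tau> \<circ> inv s) ` {1..n} = orbit (s \<circ> \<tau> \<circ> inv s) ` (s ` {1..n})"
    using permutes_image[OF s] by simp
  also have "\<dots> = (`) s ` (orbit \<tau> ` {1..n})"
    using orbit_conj[OF permutes_bij[OF s]] by (simp add: image_image)
  finally have "{C \<in> orbit (s \<circ> \<tau> \<circ> inv s) ` {1..n}. card C = p} = (`) s ` {C \<in> orbit \<tau> ` {1..n}. card C = p}"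
    using inj by (auto simp: card_image inj_on_subset)
  then show ?thesis
    unfolding num_cycles_def using inj by (simp add: card_image inj_on_def inj_image_eq_iff)
qed

lemma conj_cyclic_perms:
  assumes s: "s \<in> Sym n" and \<tau>: "\<tau> \<in> cyclic_perms n t"
  shows "s \<circ> \<tau> \<circ> inv s \<in> cyclic_perms n t"
proof -
  have "s \<circ> \<tau> \<circ> inv s permutes {1..n}"
    using assms by (intro permutes_compose permutes_inv) (auto simp: cyclic_perms_def Sym_def)
  then show ?thesis using \<tau> num_cycles_conj[OF s] by (simp add: cyclic_perms_def Sym_def)
qed

lemma bij_betw_conj_cyclic_perms:
  assumes s: "s \<in> Sym n"
  shows "bij_betw (\<lambda>\<tau>. s \<circ> \<tau> \<circ> inv s) (cyclic_perms n t) (cyclic_perms n t)"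
proof (rule bij_betwI[of _ _ _ "\<lambda>\<tau>. inv s \<circ> \<tau> \<circ> s"])
  have p: "s permutes {1..n}" and i: "inv s \<in> Sym n" using s permutes_inv by (auto simp: Sym_def)
  show "(\<lambda>\<tau>. s \<circ> \<tau> \<circ> inv s) \<in> cyclic_perms n t \<rightarrow> cyclic_perms n t"
    using conj_cyclic_perms[OF s] by blast
  show "(\<lambda>\<tau>. inv s \<circ> \<tau> \<circ> s) \<in> cyclic_perms n t \<rightarrow> cyclic_perms n t"
    using conj_cyclic_perms[OF i] permutes_inv_inv[OF p] by auto
  show "inv s \<circ> (s \<circ> \<tau> \<circ> inv s) \<circ> s = \<tau>" "s \<circ> (inv s \<circ> \<tau> \<circ> s) \<circ> inv s = \<tau>" for \<tau>
    by (auto simp: fun_eq_iff permutes_inverses[OF p])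
qed

text \<open>For a fixed label sequence this lets the average over the class be taken over conjugates
  by the ranking permutation, although that permutation depends on the labels.\<close>

lemma sum_cyclic_perms_conj:
  "s \<in> Sym n \<Longrightarrow> (\<Sum>\<tau>\<in>cyclic_perms n t. h (s \<circ> \<tau> \<circ> inv s)) = (\<Sum>\<tau>\<in>cyclic_perms n t. h \<tau>)"
  by (rule sum.reindex_bij_betw[OF bij_betw_conj_cyclic_perms])

section \<open>Fixed points and 2-cycles as point counts\<close>

lemma card_fixed_points:
  assumes "\<tau> \<in> Sym n"
  shows "card {k \<in> {1..n}. \<tau> k = k} = num_cycles n \<tau> 1"
proof -
  have p: "\<tau> permutes {1..n}" using assms by (simp add: Sym_def)
  have "{C \<in> orbit \<tau> ` {1..n}. card C = 1} = (\<lambda>k. {k}) ` {k \<in> {1..n}. \<tau> k = k}"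
  proof (intro set_eqI iffI)
    fix C assume "C \<in> {C \<in> orbit \<tau> ` {1..n}. card C = 1}"
    then obtain k x where k: "k \<in> {1..n}" "C = orbit \<tau> k" "C = {x}" by (auto simp: card_1_singleton_iff)
    then have "x = k" using perm_orbit_self[OF p, of k] by (metis finite_atLeastAtMost singletonD)
    then have "C = {k}" using k by simp
    then show "C \<in> (\<lambda>k. {k}) ` {k \<in> {1..n}. \<tau> k = k}" using k orbit_eq_singleton_iff[of \<tau> k] by auto
  next
    fix C assume "C \<in> (\<lambda>k. {k}) ` {k \<in> {1..n}. \<tau> k = k}"
    then obtain k where k: "k \<in> {1..n}" "\<tau> k = k" "C = {k}" by auto
    then have "C = orbit \<tau> k" using orbit_eq_singleton_iff[of \<tau> k] by simp
    then show "C \<in> {C \<in> orbit \<tau> ` {1..n}. card C = 1}"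
      using k(1) k(3) by (metis (mono_tags, lifting) card_1_singleton_iff imageI mem_Collect_eq One_nat_def)
  qed
  then show ?thesis unfolding num_cycles_def by (simp add: card_image)
qed

lemma card_orbit_eq_2_iff:
  assumes p: "\<tau> permutes S" "finite S"
  shows "card (orbit \<tau> k) = 2 \<longleftrightarrow> \<tau> k \<noteq> k \<and> \<tau> (\<tau> k) = k"
proof
  assume c: "card (orbit \<tau> k) = 2"
  have "\<tau> k \<noteq> k" using c orbit_eq_singleton_iff[of \<tau> k] by auto
  moreover have "\<tau> (\<tau> k) \<noteq> \<tau> k" using \<open>\<tau> k \<noteq> k\<close> permutes_inj[OF p(1)] by (auto dest: injD)
  moreover have "k \<in> orbit \<tau> k" "\<tau> k \<in> orbit \<tau> k" "\<tau> (\<tau> k) \<in> orbit \<tau> k"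
    using perm_orbit_self[OF p] by (auto intro: orbit.intros)
  moreover obtain a b where "orbit \<tau> k = {a, b}" using c by (auto simp: card_2_iff)
  ultimately show "\<tau> k \<noteq> k \<and> \<tau> (\<tau> k) = k" by auto
next
  assume a: "\<tau> k \<noteq> k \<and> \<tau> (\<tau> k) = k"
  have "y \<in> {k, \<tau> k}" if "y \<in> orbit \<tau> k" for y
    using that by induct (use a in auto)
  then have "orbit \<tau> k = {k, \<tau> k}" using perm_orbit_self[OF p, of k] by (auto intro: orbit.intros)
  moreover have "k \<noteq> \<tau> k" using a by metis
  ultimately show "card (orbit \<tau> k) = 2" by simp
qed

text \<open>The orbits of size 2 are pairwise disjoint. Counting points, two for each 2-cycle, is
  the normalisation in which \<open>2 * t n 2\<close> is compared with
  \<open>n * p2\<close>.\<close>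

lemma card_two_cycle_points:
  assumes "\<tau> \<in> Sym n"
  shows "card {k \<in> {1..n}. \<tau> k \<noteq> k \<and> \<tau> (\<tau> k) = k} = 2 * num_cycles n \<tau> 2"
proof -
  have p: "\<tau> permutes {1..n}" using assms by (simp add: Sym_def)
  let ?O = "{C \<in> orbit \<tau> ` {1..n}. card C = 2}"
  have cyc: "orbit \<tau> j = orbit \<tau> k" if "j \<in> orbit \<tau> k" for j k
    using cyclic_on_orbit[OF p, of k] that by (intro orbit_cyclic_eq3) auto
  have "{k \<in> {1..n}. \<tau> k \<noteq> k \<and> \<tau> (\<tau> k) = k} = \<Union> ?O"
  proof (intro set_eqI iffI)
    fix k assume "k \<in> {k \<in> {1..n}. \<tau> k \<noteq> k \<and> \<tau> (\<tau> k) = k}"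
    then show "k \<in> \<Union> ?O"
      using card_orbit_eq_2_iff[OF p, of k] perm_orbit_self[OF p, of k] by auto
  next
    fix k assume "k \<in> \<Union> ?O"
    then obtain j where j: "j \<in> {1..n}" "k \<in> orbit \<tau> j" "card (orbit \<tau> j) = 2" by auto
    then show "k \<in> {k \<in> {1..n}. \<tau> k \<noteq> k \<and> \<tau> (\<tau> k) = k}"
      using permutes_orbit_subset[OF p j(1)] cyc[OF j(2)] card_orbit_eq_2_iff[OF p, of k] by auto
  qed
  also have "card (\<Union> ?O) = sum card ?O"
  proof (rule card_Union_disjoint)
    show "pairwise disjnt ?O"
    proof (clarsimp simp: pairwise_def disjnt_iff)
      fix j k x assume "orbit \<tau> j \<noteq> orbit \<tau> k" "x \<in> orbit \<tau> j" "x \<in> orbit \<tau> k"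
      then show False using cyc[of x j] cyc[of x k] by simp
    qed
    show "finite C" if "C \<in> ?O" for C using that by (auto intro: card_ge_0_finite)
  qed
  also have "\<dots> = 2 * card ?O" by simp
  finally show ?thesis by (simp add: num_cycles_def)
qed

section \<open>Pattern counts as sums over tuples of graph points\<close>

lemma nth_least_strict_mono:
  assumes "finite I" "j \<in> {1..card I}" "k \<in> {1..card I}" "j < k"
  shows "nth_least I j < nth_least I k"
  unfolding nth_least_def using assms
  by (intro sorted_wrt_nth_less[OF strict_sorted_list_of_set]) auto

lemma nth_least_less_iff:
  assumes "finite I" "j \<in> {1..card I}" "k \<in> {1..card I}"
  shows "nth_least I j < nth_least I k \<longleftrightarrow> j < k"
  using nth_least_strict_mono[OF assms(1), of j k] nth_least_strict_mono[OF assms(1), of k j] assms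
  by (cases j k rule: linorder_cases) auto

lemma bij_betw_nth_least:
  assumes "finite I" shows "bij_betw (nth_least I) {1..card I} I"
proof -
  have "bij_betw (\<lambda>j. j - 1) {1..card I} {..<card I}"
    by (rule bij_betw_byWitness[where f' = Suc]) auto
  moreover have "bij_betw ((!) (sorted_list_of_set I)) {..<card I} I"
    using bij_betw_nth[of "sorted_list_of_set I" "{..<card I}" I] assms by simp
  ultimately have "bij_betw ((!) (sorted_list_of_set I) \<circ> (\<lambda>j. j - 1)) {1..card I} I"
    by (rule bij_betw_trans)
  then show ?thesis by (simp add: nth_least_def[abs_def] o_def)
qed

lemma card_le_nth_least:
  assumes I: "finite I" and j: "j \<in> {1..card I}"
  shows "card {m \<in> I. m \<le> nth_least I j} = j"
proof -
  have b: "bij_betw (nth_least I) {1..card I} I" by (rule bij_betw_nth_least[OF I])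
  have "{m \<in> I. m \<le> nth_least I j} = nth_least I ` {1..j}"
  proof (intro set_eqI iffI)
    fix m assume m: "m \<in> {m \<in> I. m \<le> nth_least I j}"
    then have "m \<in> nth_least I ` {1..card I}" using b by (simp add: bij_betw_def)
    then obtain k where k: "k \<in> {1..card I}" "m = nth_least I k" by blast
    then have "k \<le> j" using m nth_least_less_iff[OF I j k(1)] by auto
    then show "m \<in> nth_least I ` {1..j}" using k by auto
  next
    fix m assume "m \<in> nth_least I ` {1..j}"
    then obtain k where k: "k \<in> {1..j}" "m = nth_least I k" by auto
    then have k': "k \<in> {1..card I}" using j by auto
    then have "m \<in> I" using b k by (auto simp: bij_betw_def)
    moreover have "m \<le> nth_least I j" using nth_least_less_iff[OF I j k'] k by (auto simp: not_less[symmetric])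
    ultimately show "m \<in> {m \<in> I. m \<le> nth_least I j}" by simp
  qed
  moreover have "inj_on (nth_least I) {1..j}" using b j by (auto simp: bij_betw_def intro: inj_on_subset)
  ultimately show ?thesis by (simp add: card_image)
qed

text \<open>Inside [r] a permutation value is its own rank: exactly \<open>\<pi> j\<close> indices
  have a value at most \<open>\<pi> j\<close>. This mediates between \<open>is_Perm\<close>, phrased
  with ranks, and \<open>pattern_count\<close>, phrased with comparisons.\<close>

lemma permutes_eq_rank_iff:
  fixes x :: "nat \<Rightarrow> nat"
  assumes \<pi>: "\<pi> permutes {1..r}" and x: "inj_on x {1..r}"
  shows "(\<forall>j\<in>{1..r}. \<pi> j = card {l \<in> {1..r}. x l \<le> x j}) \<longleftrightarrow> (\<forall>j\<in>{1..r}. \<forall>k\<in>{1..r}. \<pi> j > \<pi> k \<longleftrightarrow> x j > x k)"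
proof
  assume R: "\<forall>j\<in>{1..r}. \<forall>k\<in>{1..r}. \<pi> j > \<pi> k \<longleftrightarrow> x j > x k"
  show "\<forall>j\<in>{1..r}. \<pi> j = card {l \<in> {1..r}. x l \<le> x j}"
  proof
  fix j assume j: "j \<in> {1..r}"
  have "{l \<in> {1..r}. x l \<le> x j} = {l \<in> {1..r}. \<pi> l \<le> \<pi> j}"
    using R j by (auto simp: not_less[symmetric])
  moreover have "\<pi> ` {l \<in> {1..r}. \<pi> l \<le> \<pi> j} = {1..\<pi> j}"
  proof (intro set_eqI iffI)
    fix m assume m: "m \<in> {1..\<pi> j}"
    moreover have "\<pi> j \<in> {1..r}" using permutes_in_image[OF \<pi>, of j] j by simp
    ultimately have "m \<in> {1..r}" by auto
    then obtain l where "l \<in> {1..r}" "m = \<pi> l" using permutes_image[OF \<pi>] by (metis imageE)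
    then show "m \<in> \<pi> ` {l \<in> {1..r}. \<pi> l \<le> \<pi> j}" using m by auto
  next
    fix m assume "m \<in> \<pi> ` {l \<in> {1..r}. \<pi> l \<le> \<pi> j}"
    then show "m \<in> {1..\<pi> j}" using permutes_in_image[OF \<pi>] by auto
  qed
  moreover have "card (\<pi> ` {l \<in> {1..r}. \<pi> l \<le> \<pi> j}) = card {l \<in> {1..r}. \<pi> l \<le> \<pi> j}"
    by (rule card_image) (rule permutes_inj_on[OF \<pi>])
  ultimately show "\<pi> j = card {l \<in> {1..r}. x l \<le> x j}" by simp
  qed
next
  assume L: "\<forall>j\<in>{1..r}. \<pi> j = card {l \<in> {1..r}. x l \<le> x j}"
  have mono: "\<pi> k < \<pi> j" if "j \<in> {1..r}" "k \<in> {1..r}" "x k < x j" for j k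
  proof -
    have "j \<in> {l \<in> {1..r}. x l \<le> x j} - {l \<in> {1..r}. x l \<le> x k}" "{l \<in> {1..r}. x l \<le> x k} \<subseteq> {l \<in> {1..r}. x l \<le> x j}"
      using that by auto
    then have "{l \<in> {1..r}. x l \<le> x k} \<subset> {l \<in> {1..r}. x l \<le> x j}" by blast
    then show ?thesis using L that(1,2) by (simp add: psubset_card_mono)
  qed
  show "\<forall>j\<in>{1..r}. \<forall>k\<in>{1..r}. \<pi> j > \<pi> k \<longleftrightarrow> x j > x k"
  proof (intro ballI)
  fix j k assume jk: "j \<in> {1..r}" "k \<in> {1..r}"
  show "\<pi> j > \<pi> k \<longleftrightarrow> x j > x k"
    using mono[OF jk] mono[OF jk(2,1)] x jk
    by (cases "x j" "x k" rule: linorder_cases) (auto dest: inj_onD)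
  qed
qed

section \<open>The ranking permutation and the conjugate it defines\<close>

definition rank_perm :: "nat \<Rightarrow> (nat \<Rightarrow> real) \<Rightarrow> nat \<Rightarrow> nat" where
  "rank_perm n u k = (if k \<in> {1..n} then card {j \<in> {1..n}. u j \<le> u k} else k)"

lemma rank_perm_less_iff:
  assumes "inj_on u {1..n}" "j \<in> {1..n}" "k \<in> {1..n}"
  shows "rank_perm n u j < rank_perm n u k \<longleftrightarrow> u j < u k"
proof -
  have mono: "rank_perm n u k < rank_perm n u j" if "j \<in> {1..n}" "k \<in> {1..n}" "u k < u j" for j k
  proof -
    have "j \<in> {l \<in> {1..n}. u l \<le> u j} - {l \<in> {1..n}. u l \<le> u k}" "{l \<in> {1..n}. u l \<le> u k} \<subseteq> {l \<in> {1..n}. u l \<le> u j}"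
      using that by auto
    then have "{l \<in> {1..n}. u l \<le> u k} \<subset> {l \<in> {1..n}. u l \<le> u j}" by blast
    then have "card {l \<in> {1..n}. u l \<le> u k} < card {l \<in> {1..n}. u l \<le> u j}" by (intro psubset_card_mono) auto
    then show ?thesis using that(1,2) by (simp add: rank_perm_def)
  qed
  show ?thesis
    using mono[OF assms(2,3)] mono[OF assms(3,2)] assms
    by (cases "u j" "u k" rule: linorder_cases) (auto dest: inj_onD)
qed

lemma rank_perm_Sym:
  assumes "inj_on u {1..n}" shows "rank_perm n u \<in> Sym n"
proof -
  have inj: "inj_on (rank_perm n u) {1..n}"
  proof (rule inj_onI)
    fix j k assume jk: "j \<in> {1..n}" "k \<in> {1..n}" "rank_perm n u j = rank_perm n u k"
    then have "u j = u k"
      using rank_perm_less_iff[OF assms, of j k] rank_perm_less_iff[OF assms, of k j] by linarith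
    then show "j = k" using assms jk by (auto dest: inj_onD)
  qed
  have sub: "rank_perm n u ` {1..n} \<subseteq> {1..n}"
  proof clarify
    fix k assume k: "k \<in> {1..n}"
    have "card {j \<in> {1..n}. u j \<le> u k} \<le> card {1..n}" by (rule card_mono) auto
    moreover have "card {j \<in> {1..n}. u j \<le> u k} > 0" using k by (subst card_gt_0_iff) auto
    ultimately show "rank_perm n u k \<in> {1..n}" using k by (simp add: rank_perm_def)
  qed
  have "bij_betw (rank_perm n u) {1..n} {1..n}"
    unfolding bij_betw_def using inj endo_inj_surj[OF _ sub inj] by simp
  then show ?thesis
    unfolding Sym_def mem_Collect_eq by (rule bij_imp_permutes) (simp add: rank_perm_def del: atLeastAtMost_iff)
qed

definition graph_pt :: "(nat \<Rightarrow> nat) \<Rightarrow> (nat \<Rightarrow> real) \<Rightarrow> nat \<Rightarrow> real \<times> real" where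
  "graph_pt \<sigma> u k = (u k, u (\<sigma> k))"

text \<open>The ranking \<open>s\<close> is increasing in the labels and \<open>\<tau>\<close> maps
  \<open>s k\<close> to \<open>s (\<sigma> k)\<close>. Hence the point
  \<open>(u k, u (\<sigma> k))\<close> lies relative to the others as
  \<open>(s k, \<tau> (s k))\<close> does, and \<open>K\<close> becomes the set \<open>I\<close> of
  positions in the graph of \<open>\<tau>\<close>.\<close>

lemma is_Perm_graph_iff:
  assumes u: "inj_on u {1..n}" and \<sigma>: "\<sigma> \<in> Sym n" and \<pi>: "\<pi> \<in> Sym r"
    and K: "K \<subseteq> {1..n}" "card K = r"
  defines "s \<equiv> rank_perm n u"
  defines "I \<equiv> s ` K" and "\<tau> \<equiv> s \<circ> \<sigma> \<circ> inv s"
  shows "is_Perm r (graph_pt \<sigma> u ` K) \<pi> \<longleftrightarrow>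
    (\<forall>j\<in>{1..r}. \<forall>k\<in>{1..r}. \<pi> j > \<pi> k \<longleftrightarrow> \<tau> (nth_least I j) > \<tau> (nth_least I k))"
proof -
  have s: "s permutes {1..n}" using rank_perm_Sym[OF u] by (simp add: s_def Sym_def)
  have \<sigma>p: "\<sigma> permutes {1..n}" using \<sigma> by (simp add: Sym_def)
  have fK: "finite K" using K(1) finite_subset by blast
  have sK: "inj_on s K" using permutes_inj_on[OF s] .
  have cI: "card I = r" "finite I" using K(2) fK sK by (auto simp: I_def card_image)
  have \<tau>s: "\<tau> (s k) = s (\<sigma> k)" for k using permutes_inverses(2)[OF s] by (simp add: \<tau>_def)
  have le1: "u j \<le> u k \<longleftrightarrow> s j \<le> s k" if "j \<in> {1..n}" "k \<in> {1..n}" for j k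
    using rank_perm_less_iff[OF u that(2,1)] by (auto simp: s_def not_less[symmetric])
  have \<sigma>K: "\<sigma> k \<in> {1..n}" if "k \<in> K" for k using that K(1) permutes_in_image[OF \<sigma>p, of k] by blast
  have inju: "j = k" if "u j = u k" "j \<in> {1..n}" "k \<in> {1..n}" for j k using u that by (auto dest: inj_onD)
  have pt_inj: "inj_on (graph_pt \<sigma> u) K"
    using inju K(1) by (auto simp: inj_on_def graph_pt_def subset_iff)
  have fst_inj: "inj_on fst (graph_pt \<sigma> u ` K)"
    using inju K(1) by (auto simp: inj_on_def graph_pt_def subset_iff)
  have snd_inj: "inj_on snd (graph_pt \<sigma> u ` K)"
  proof -
    have "j = k" if "u (\<sigma> j) = u (\<sigma> k)" "j \<in> K" "k \<in> K" for j k
      using inju[OF that(1) \<sigma>K[OF that(2)] \<sigma>K[OF that(3)]] permutes_inj[OF \<sigma>p] by (auto dest: injD)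
    then show ?thesis by (auto simp: inj_on_def graph_pt_def)
  qed
  have c: "card (graph_pt \<sigma> u ` K) = r" using pt_inj K(2) by (simp add: card_image)
  have c1: "card {w \<in> graph_pt \<sigma> u ` K. fst w \<le> fst (graph_pt \<sigma> u k)} = card {m \<in> I. m \<le> s k}" if k: "k \<in> K" for k
  proof -
    have "{w \<in> graph_pt \<sigma> u ` K. fst w \<le> fst (graph_pt \<sigma> u k)} = graph_pt \<sigma> u ` {j \<in> K. s j \<le> s k}"
      using le1 k K(1) by (auto simp: graph_pt_def subset_iff)
    moreover have "{m \<in> I. m \<le> s k} = s ` {j \<in> K. s j \<le> s k}" by (auto simp: I_def)
    ultimately show ?thesis using pt_inj sK by (simp add: card_image inj_on_subset)
  qed
  have c2: "card {w \<in> graph_pt \<sigma> u ` K. snd w \<le> snd (graph_pt \<sigma> u k)} = card {m \<in> I. \<tau> m \<le> \<tau> (s k)}" if k: "k \<in> K" for k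
  proof -
    have "{w \<in> graph_pt \<sigma> u ` K. snd w \<le> snd (graph_pt \<sigma> u k)} = graph_pt \<sigma> u ` {j \<in> K. s (\<sigma> j) \<le> s (\<sigma> k)}"
      using le1[OF \<sigma>K \<sigma>K] k by (auto simp: graph_pt_def)
    moreover have "{m \<in> I. \<tau> m \<le> \<tau> (s k)} = s ` {j \<in> K. s (\<sigma> j) \<le> s (\<sigma> k)}" by (auto simp: I_def \<tau>s)
    ultimately show ?thesis using pt_inj sK by (simp add: card_image inj_on_subset)
  qed
  let ?x = "\<lambda>j. \<tau> (nth_least I j)"
  have b: "bij_betw (nth_least I) {1..r} I" using bij_betw_nth_least[OF cI(2)] cI(1) by simp
  have inj\<tau>: "inj \<tau>" unfolding \<tau>_def
    using permutes_inj[OF s] permutes_inj[OF \<sigma>p] permutes_inj[OF permutes_inv[OF s]] by (intro inj_compose) auto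
  have xinj: "inj_on ?x {1..r}"
    using comp_inj_on[OF bij_betw_imp_inj_on[OF b] inj_on_subset[OF inj\<tau> subset_UNIV]] by (simp add: o_def)
  have c3: "card {m \<in> I. \<tau> m \<le> \<tau> (nth_least I j)} = card {l \<in> {1..r}. ?x l \<le> ?x j}" for j
  proof -
    have "{m \<in> I. \<tau> m \<le> \<tau> (nth_least I j)} = nth_least I ` {l \<in> {1..r}. ?x l \<le> ?x j}"
    proof (intro set_eqI iffI)
      fix m assume m: "m \<in> {m \<in> I. \<tau> m \<le> \<tau> (nth_least I j)}"
      then have "m \<in> nth_least I ` {1..r}" using b by (simp add: bij_betw_def)
      then show "m \<in> nth_least I ` {l \<in> {1..r}. ?x l \<le> ?x j}" using m by blast
    next
      fix m assume "m \<in> nth_least I ` {l \<in> {1..r}. ?x l \<le> ?x j}"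
      then show "m \<in> {m \<in> I. \<tau> m \<le> \<tau> (nth_least I j)}" using b by (auto simp: bij_betw_def)
    qed
    moreover have "inj_on (nth_least I) {l \<in> {1..r}. ?x l \<le> ?x j}"
      using b by (auto simp: bij_betw_def intro: inj_on_subset)
    ultimately show ?thesis by (simp add: card_image)
  qed
  have ball_I: "(\<forall>m\<in>I. P m) \<longleftrightarrow> (\<forall>j\<in>{1..r}. P (nth_least I j))" for P
  proof -
    have eq: "nth_least I ` {1..r} = I" using b by (simp add: bij_betw_def)
    have "(\<forall>m\<in>nth_least I ` {1..r}. P m) \<longleftrightarrow> (\<forall>j\<in>{1..r}. P (nth_least I j))" by blast
    then show ?thesis unfolding eq .
  qed
  have "is_Perm r (graph_pt \<sigma> u ` K) \<pi> \<longleftrightarrow> (\<forall>k\<in>K. \<pi> (card {m \<in> I. m \<le> s k}) = card {m \<in> I. \<tau> m \<le> \<tau> (s k)})"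
    unfolding is_Perm_def using fK c fst_inj snd_inj \<pi> by (simp add: c1 c2)
  also have "\<dots> \<longleftrightarrow> (\<forall>m\<in>I. \<pi> (card {m' \<in> I. m' \<le> m}) = card {m' \<in> I. \<tau> m' \<le> \<tau> m})"
    by (simp add: I_def)
  also have "\<dots> \<longleftrightarrow> (\<forall>j\<in>{1..r}. \<pi> (card {m' \<in> I. m' \<le> nth_least I j}) = card {m' \<in> I. \<tau> m' \<le> \<tau> (nth_least I j)})"
    by (rule ball_I)
  also have "\<dots> \<longleftrightarrow> (\<forall>j\<in>{1..r}. \<pi> j = card {l \<in> {1..r}. ?x l \<le> ?x j})"
    unfolding c3 using card_le_nth_least[OF cI(2)] cI(1) by simp
  also have "\<dots> \<longleftrightarrow> (\<forall>j\<in>{1..r}. \<forall>k\<in>{1..r}. \<pi> j > \<pi> k \<longleftrightarrow> ?x j > ?x k)"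
    using \<pi> xinj by (intro permutes_eq_rank_iff) (auto simp: Sym_def)
  finally show ?thesis .
qed

text \<open>Taking images under \<open>s\<close> is a bijection from the index sets \<open>K\<close>
  to the position sets of occurrences.\<close>

lemma pattern_count_conj_rank:
  assumes u: "inj_on u {1..n}" and \<sigma>: "\<sigma> \<in> Sym n" and \<pi>: "\<pi> \<in> Sym r"
  defines "s \<equiv> rank_perm n u"
  shows "pattern_count n r \<pi> (s \<circ> \<sigma> \<circ> inv s) = card {K. K \<subseteq> {1..n} \<and> card K = r \<and> is_Perm r (graph_pt \<sigma> u ` K) \<pi>}"
proof -
  have s: "s permutes {1..n}" using rank_perm_Sym[OF u] by (simp add: s_def Sym_def)
  have inj: "inj s" using permutes_inj[OF s] .
  let ?Q = "\<lambda>I. \<forall>j\<in>{1..r}. \<forall>k\<in>{1..r}. \<pi> j > \<pi> k \<longleftrightarrow> (s \<circ> \<sigma> \<circ> inv s) (nth_least I j) > (s \<circ> \<sigma> \<circ> inv s) (nth_least I k)"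
  have "{I. I \<subseteq> {1..n} \<and> card I = r \<and> ?Q I} = (`) s ` {K. K \<subseteq> {1..n} \<and> card K = r \<and> is_Perm r (graph_pt \<sigma> u ` K) \<pi>}"
  proof (intro set_eqI iffI)
    fix I assume I: "I \<in> {I. I \<subseteq> {1..n} \<and> card I = r \<and> ?Q I}"
    define K where "K = inv s ` I"
    have IK: "I = s ` K" using permutes_inverses(1)[OF s] by (simp add: K_def image_image)
    have K: "K \<subseteq> {1..n}" using I permutes_in_image[OF permutes_inv[OF s]] by (auto simp: K_def)
    have cK: "card K = r" using I IK inj by (simp add: card_image inj_on_subset)
    have "is_Perm r (graph_pt \<sigma> u ` K) \<pi>"
      using is_Perm_graph_iff[OF u \<sigma> \<pi> K cK, folded s_def] I unfolding IK by blast
    then show "I \<in> (`) s ` {K. K \<subseteq> {1..n} \<and> card K = r \<and> is_Perm r (graph_pt \<sigma> u ` K) \<pi>}"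
      using K cK unfolding IK by blast
  next
    fix I assume "I \<in> (`) s ` {K. K \<subseteq> {1..n} \<and> card K = r \<and> is_Perm r (graph_pt \<sigma> u ` K) \<pi>}"
    then obtain K where K: "I = s ` K" "K \<subseteq> {1..n}" "card K = r" "is_Perm r (graph_pt \<sigma> u ` K) \<pi>" by blast
    have "I \<subseteq> {1..n}" using K(1,2) permutes_in_image[OF s] by auto
    moreover have "card I = r" using K(1,3) inj by (simp add: card_image inj_on_subset)
    moreover have "?Q I" using is_Perm_graph_iff[OF u \<sigma> \<pi> K(2,3), folded s_def] K(1,4) by simp
    ultimately show "I \<in> {I. I \<subseteq> {1..n} \<and> card I = r \<and> ?Q I}" by blast
  qed
  then show ?thesis
    unfolding pattern_count_def using inj by (simp add: card_image inj_on_def inj_image_eq_iff)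
qed

section \<open>From r-subsets to r-tuples\<close>

text \<open>Once one enumeration \<open>b\<close> is fixed, all others are \<open>b\<close> composed
  with a permutation of [r]; extensionality removes the freedom outside [r].\<close>

lemma card_bij_funs:
  assumes "finite K" "card K = r"
  shows "card {i \<in> extensional {1..r}. bij_betw i {1..r} K} = fact r"
proof -
  obtain b where b: "bij_betw b {1..r} K"
    using finite_same_card_bij[of "{1..r}" K] assms by auto
  have "bij_betw (\<lambda>p. restrict (b \<circ> p) {1..r}) {p. p permutes {1..r}} {i \<in> extensional {1..r}. bij_betw i {1..r} K}"
  proof (rule bij_betw_imageI)
    show "inj_on (\<lambda>p. restrict (b \<circ> p) {1..r}) {p. p permutes {1..r}}"
    proof (rule inj_onI)
      fix p q :: "nat \<Rightarrow> nat" assume pq: "p \<in> {p. p permutes {1..r}}" "q \<in> {p. p permutes {1..r}}"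
        and eq: "restrict (b \<circ> p) {1..r} = restrict (b \<circ> q) {1..r}"
      show "p = q"
      proof
      fix x show "p x = q x"
      proof (cases "x \<in> {1..r}")
        case True
        have "b (p x) = b (q x)" using fun_cong[OF eq, of x] True by simp
        moreover have "p x \<in> {1..r}" "q x \<in> {1..r}" using pq True permutes_in_image by fastforce+
        ultimately show ?thesis using b by (auto simp: bij_betw_def dest: inj_onD)
      next
        case False
        then show ?thesis using pq permutes_not_in by (metis mem_Collect_eq)
      qed
      qed
    qed
    show "(\<lambda>p. restrict (b \<circ> p) {1..r}) ` {p. p permutes {1..r}} = {i \<in> extensional {1..r}. bij_betw i {1..r} K}"
    proof (intro set_eqI iffI)
      fix i assume "i \<in> (\<lambda>p. restrict (b \<circ> p) {1..r}) ` {p. p permutes {1..r}}"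
      then obtain p where p: "p permutes {1..r}" "i = restrict (b \<circ> p) {1..r}" by blast
      have "bij_betw (b \<circ> p) {1..r} K" using bij_betw_trans[OF permutes_imp_bij[OF p(1)] b] .
      then have "bij_betw i {1..r} K" using p(2) by (subst bij_betw_cong[of _ _ "b \<circ> p"]) auto
      then show "i \<in> {i \<in> extensional {1..r}. bij_betw i {1..r} K}" using p(2) by simp
    next
      fix i assume i: "i \<in> {i \<in> extensional {1..r}. bij_betw i {1..r} K}"
      define p where "p x = (if x \<in> {1..r} then inv_into {1..r} b (i x) else x)" for x
      have "bij_betw (inv_into {1..r} b \<circ> i) {1..r} {1..r}"
        using i bij_betw_inv_into[OF b] by (auto intro: bij_betw_trans)
      then have "bij_betw p {1..r} {1..r}" by (subst bij_betw_cong[of _ _ "inv_into {1..r} b \<circ> i"]) (auto simp: p_def)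
      then have p: "p permutes {1..r}" by (rule bij_imp_permutes) (simp add: p_def del: atLeastAtMost_iff)
      have "i = restrict (b \<circ> p) {1..r}"
      proof
        fix x show "i x = restrict (b \<circ> p) {1..r} x"
        proof (cases "x \<in> {1..r}")
          case True
          then have "i x \<in> K" using i by (auto simp: bij_betw_def)
          then have "b (inv_into {1..r} b (i x)) = i x" using bij_betw_inv_into_right[OF b] by simp
          then show ?thesis using True by (simp add: p_def)
        next
          case False
          then have "i x = undefined" using i by (auto simp: extensional_def)
          then show ?thesis using False by (simp only: restrict_apply if_False)
        qed
      qed
      then show "i \<in> (\<lambda>p. restrict (b \<circ> p) {1..r}) ` {p. p permutes {1..r}}" using p by blast
    qed
  qed
  from bij_betw_same_card[OF this] show ?thesis
    using card_permutations[of "{1..r}" r] by simp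
qed

text \<open>All tuples are summed, not only the injective ones: a set of fewer than \<open>r\<close> points has no \<open>Perm\<close>.\<close>

lemma pattern_count_conj_rank_tuples:
  assumes u: "inj_on u {1..n}" and \<sigma>: "\<sigma> \<in> Sym n" and \<pi>: "\<pi> \<in> Sym r"
  defines "s \<equiv> rank_perm n u"
  shows "fact r * real (pattern_count n r \<pi> (s \<circ> \<sigma> \<circ> inv s))
    = (\<Sum>i\<in>PiE {1..r} (\<lambda>_. {1..n}). indicator {P. is_Perm r P \<pi>} ((\<lambda>a. graph_pt \<sigma> u (i a)) ` {1..r}))"
proof -
  let ?S = "{K. K \<subseteq> {1..n} \<and> card K = r \<and> is_Perm r (graph_pt \<sigma> u ` K) \<pi>}"
  let ?T = "{i \<in> PiE {1..r} (\<lambda>_. {1..n}). is_Perm r ((\<lambda>a. graph_pt \<sigma> u (i a)) ` {1..r}) \<pi>}"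
  let ?B = "\<lambda>K. {i \<in> extensional {1..r}. bij_betw i {1..r} K}"
  have pt: "inj_on (graph_pt \<sigma> u) {1..n}" by (rule inj_onI) (use u in \<open>auto simp: graph_pt_def dest: inj_onD\<close>)
  have T: "?T = (\<Union>K\<in>?S. ?B K)"
  proof (intro set_eqI iffI)
    fix i assume i: "i \<in> ?T"
    then have sub: "i ` {1..r} \<subseteq> {1..n}" by auto
    have im: "(\<lambda>a. graph_pt \<sigma> u (i a)) ` {1..r} = graph_pt \<sigma> u ` (i ` {1..r})" by (simp add: image_image)
    have P: "is_Perm r (graph_pt \<sigma> u ` (i ` {1..r})) \<pi>" using i im by simp
    then have "card (graph_pt \<sigma> u ` (i ` {1..r})) = r" by (simp add: is_Perm_def)
    then have c: "card (i ` {1..r}) = r" using card_image[OF inj_on_subset[OF pt sub]] by simp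
    then have "inj_on i {1..r}" by (intro eq_card_imp_inj_on) auto
    then have "i \<in> ?B (i ` {1..r})" using i by (auto simp: bij_betw_def PiE_def)
    moreover have "i ` {1..r} \<in> ?S" using sub c P by simp
    ultimately show "i \<in> (\<Union>K\<in>?S. ?B K)" by blast
  next
    fix i assume "i \<in> (\<Union>K\<in>?S. ?B K)"
    then obtain K where K: "K \<subseteq> {1..n}" "is_Perm r (graph_pt \<sigma> u ` K) \<pi>" "i \<in> extensional {1..r}" "i ` {1..r} = K"
      by (auto simp: bij_betw_def)
    have "(\<lambda>a. graph_pt \<sigma> u (i a)) ` {1..r} = graph_pt \<sigma> u ` K" using K(4) by (auto simp: image_image[symmetric])
    then show "i \<in> ?T" using K by (auto simp: PiE_iff)
  qed
  have fS: "finite ?S" by (rule finite_subset[of _ "Pow {1..n}"]) auto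
  have cB: "card (?B K) = fact r" if "K \<in> ?S" for K
    using that by (intro card_bij_funs) (auto intro: finite_subset)
  have "card ?T = (\<Sum>K\<in>?S. card (?B K))"
    unfolding T
  proof (rule card_UN_disjoint[OF fS])
    show "\<forall>K\<in>?S. finite (?B K)" using cB by (auto intro!: card_ge_0_finite)
    show "\<forall>K\<in>?S. \<forall>K'\<in>?S. K \<noteq> K' \<longrightarrow> ?B K \<inter> ?B K' = {}" by (auto simp: bij_betw_def)
  qed
  also have "\<dots> = fact r * card ?S" using cB by simp
  finally have "card ?T = fact r * card ?S" .
  moreover have "(\<Sum>i\<in>PiE {1..r} (\<lambda>_. {1..n}). indicator {P. is_Perm r P \<pi>} ((\<lambda>a. graph_pt \<sigma> u (i a)) ` {1..r})) = real (card ?T)"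
    by (simp add: indicator_def sum.If_cases finite_PiE Int_def)
  ultimately show ?thesis
    using pattern_count_conj_rank[OF u \<sigma> \<pi>] by (simp add: s_def)
qed

section \<open>Sums of locally dependent variables\<close>

lemma measure_unif_seq_UNIV [simp]: "measure unif_seq UNIV = 1"
  using prob_space.prob_space[OF prob_space_unif_seq] by simp

lemma cmod_iexp_diff_le: "cmod (iexp x - iexp y) \<le> \<bar>x - y\<bar>"
proof -
  have "iexp x - iexp y = iexp y * (iexp (x - y) - 1)"
    by (simp add: right_diff_distrib exp_add[symmetric] distrib_left[symmetric])
  then have "cmod (iexp x - iexp y) = cmod (iexp (x - y) - 1)"
    by (simp add: norm_mult)
  also have "\<dots> \<le> \<bar>x - y\<bar>"
    using iexp_approx1[of "x - y" 0] by simp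
  finally show ?thesis .
qed

lemma cmod_iexp_taylor2_le: "cmod (iexp x - 1 - \<i> * x) \<le> x\<^sup>2 / 2"
  using iexp_approx1[of x 1] by (simp add: algebra_simps power2_eq_square)

text \<open>Integrability is not assumed: a function that is not integrable has integral 0, and
  \<open>c\<close> is nonnegative because the space is nonempty.\<close>

lemma (in prob_space) norm_integral_le_const:
  fixes f :: "'a \<Rightarrow> 'b::{banach, second_countable_topology}"
  assumes "\<And>x. x \<in> space M \<Longrightarrow> norm (f x) \<le> c"
  shows "norm (integral\<^sup>L M f) \<le> c"
proof (cases "integrable M f")
  case True
  have "norm (integral\<^sup>L M f) \<le> (LINT x|M. norm (f x))" by (rule integral_norm_bound)
  also have "\<dots> \<le> (LINT x|M. c)" using assms True by (intro integral_mono) auto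
  finally show ?thesis by (simp add: prob_space)
next
  case False
  obtain x where "x \<in> space M" using not_empty by blast
  from assms[OF this] have "0 \<le> c" using norm_ge_zero order_trans by blast
  then show ?thesis using False by (simp add: not_integrable_integral_eq)
qed

lemma (in prob_space) norm_integral_diff_le:
  fixes f g :: "'a \<Rightarrow> 'b::{banach, second_countable_topology}"
  assumes "integrable M f" "integrable M g" "\<And>x. x \<in> space M \<Longrightarrow> norm (f x - g x) \<le> c"
  shows "norm (integral\<^sup>L M f - integral\<^sup>L M g) \<le> c"
  using norm_integral_le_const[of "\<lambda>x. f x - g x" c] assms by simp

lemma depends_on_sum:
  fixes f :: "'i \<Rightarrow> (nat \<Rightarrow> 'c) \<Rightarrow> 'd::comm_monoid_add"
  assumes "\<And>a. a \<in> A \<Longrightarrow> depends_on (f a) (S a)" "\<And>a. a \<in> A \<Longrightarrow> S a \<subseteq> T"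
  shows "depends_on (\<lambda>u. \<Sum>a\<in>A. f a u) T"
  unfolding depends_on_def
proof (intro allI impI sum.cong refl)
  fix u v :: "nat \<Rightarrow> 'c" and a assume "\<forall>k\<in>T. u k = v k" "a \<in> A"
  then show "f a u = f a v" using assms[of a] unfolding depends_on_def by blast
qed

lemma depends_on_compose: "depends_on f S \<Longrightarrow> depends_on (\<lambda>u. g (f u)) S"
  unfolding depends_on_def by metis

text \<open>The dependency graph is implicit: two variables are adjacent when their supports meet,
  so \<open>D\<close> bounds a closed neighbourhood, which contains the index itself whenever its
  support is nonempty. Supports rather than pairwise independence are recorded, because sums over
  complements of neighbourhoods must again be independent of a variable.\<close>

locale dependency_nbhd =
  fixes A :: "'i set" and Y :: "'i \<Rightarrow> (nat \<Rightarrow> real) \<Rightarrow> real" and supp :: "'i \<Rightarrow> nat set"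
    and B :: real and D :: nat
  assumes fin: "finite A"
    and meas [measurable]: "\<And>a. a \<in> A \<Longrightarrow> Y a \<in> borel_measurable unif_seq"
    and bound: "\<And>a u. a \<in> A \<Longrightarrow> \<bar>Y a u\<bar> \<le> B"
    and centred: "\<And>a. a \<in> A \<Longrightarrow> (LINT u|unif_seq. Y a u) = 0"
    and dep: "\<And>a. a \<in> A \<Longrightarrow> depends_on (Y a) (supp a)"
    and card_nbhd: "\<And>a. a \<in> A \<Longrightarrow> card {b \<in> A. supp a \<inter> supp b \<noteq> {}} \<le> D"
begin

interpretation P: prob_space unif_seq by (rule prob_space_unif_seq)

definition "nb a = {b \<in> A. supp a \<inter> supp b \<noteq> {}}"
definition "W u = (\<Sum>a\<in>A. Y a u)"
definition "var = (LINT u|unif_seq. (W u)\<^sup>2)"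
definition "ph s = (LINT u|unif_seq. iexp (s * W u))"

lemma nb_sub: "nb a \<subseteq> A" and fin_nb: "finite (nb a)"
  using fin by (auto simp: nb_def)

lemma card_nb: "a \<in> A \<Longrightarrow> card (nb a) \<le> D"
  using card_nbhd by (simp add: nb_def)

lemma meas_sum [measurable]: "C \<subseteq> A \<Longrightarrow> (\<lambda>u. \<Sum>b\<in>C. Y b u) \<in> borel_measurable unif_seq"
  by (rule borel_measurable_sum) auto

lemma meas_W [measurable]: "W \<in> borel_measurable unif_seq"
  unfolding W_def[abs_def] by simp

lemma abs_sum_le: "C \<subseteq> A \<Longrightarrow> \<bar>\<Sum>b\<in>C. Y b u\<bar> \<le> card C * B"
  using sum_bounded_above[of C "\<lambda>b. \<bar>Y b u\<bar>" B] bound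
  by (intro order_trans[OF sum_abs]) auto

lemma B_nonneg: "a \<in> A \<Longrightarrow> 0 \<le> B"
  using bound[of a] abs_ge_zero order_trans by blast

lemma sum_compl_depends:
  assumes "C \<subseteq> A"
  shows "depends_on (\<lambda>u. \<Sum>b\<in>A - C. Y b u) (\<Union>b\<in>A - C. supp b)"
  by (rule depends_on_sum) (auto intro: dep)

lemma W_split: "C \<subseteq> A \<Longrightarrow> W u = (\<Sum>b\<in>A - C. Y b u) + (\<Sum>b\<in>C. Y b u)"
  unfolding W_def using fin by (intro sum.subset_diff) auto

lemma cov_zero:
  assumes "a \<in> A" "b \<in> A" "b \<notin> nb a"
  shows "(LINT u|unif_seq. Y a u * Y b u) = 0"
proof -
  have "(LINT u|unif_seq. Y a u * Y b u) = (LINT u|unif_seq. Y a u) * (LINT u|unif_seq. Y b u)"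
    using assms by (intro integral_indep[of _ _ B B "supp a" "supp b"]) (auto intro: bound dep simp: nb_def)
  then show ?thesis using centred assms by simp
qed

lemma integrable_prod: "a \<in> A \<Longrightarrow> b \<in> A \<Longrightarrow> integrable unif_seq (\<lambda>u. Y a u * Y b u)"
  by (rule P.integrable_const_bound[of _ "B * B"])
     (auto simp: abs_mult intro!: mult_mono bound B_nonneg)

lemma var_eq: "var = (\<Sum>a\<in>A. \<Sum>b\<in>nb a. LINT u|unif_seq. Y a u * Y b u)"
proof -
  have "var = (LINT u|unif_seq. (\<Sum>a\<in>A. \<Sum>b\<in>A. Y a u * Y b u))"
    unfolding var_def W_def by (simp add: power2_eq_square sum_product)
  also have "\<dots> = (\<Sum>a\<in>A. \<Sum>b\<in>A. LINT u|unif_seq. Y a u * Y b u)"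
    by (subst Bochner_Integration.integral_sum)
       (auto intro!: sum.cong Bochner_Integration.integral_sum integrable_prod)
  also have "\<dots> = (\<Sum>a\<in>A. \<Sum>b\<in>nb a. LINT u|unif_seq. Y a u * Y b u)"
    using fin nb_sub by (intro sum.cong refl sum.mono_neutral_right) (auto simp: cov_zero)
  finally show ?thesis .
qed

lemma integrable_iexp_mult:
  assumes "f \<in> borel_measurable unif_seq" "\<And>u. \<bar>f u\<bar> \<le> c" "g \<in> borel_measurable unif_seq"
  shows "integrable unif_seq (\<lambda>u. complex_of_real (f u) * iexp (g u))"
  using assms by (intro P.integrable_const_bound[of _ c]) (auto simp: norm_mult)

text \<open>With the neighbourhood sum \<open>T\<close> taken out of \<open>W\<close>, the Taylor
  expansion of exp(i s T) has a vanishing zeroth term, a first term giving the covariances, and a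
  remainder. In the constant 7/2, the share 1/2 is the second order remainder and 3 comes from
  decoupling \<open>Y a * Y b\<close> from the exponential: 1 for deleting the neighbours of
  \<open>b\<close> as well, 2 for putting both neighbourhoods back.\<close>

lemma term_bound:
  assumes a: "a \<in> A" and s: "0 \<le> s"
  shows "cmod ((LINT u|unif_seq. Y a u * iexp (s * W u))
      - \<i> * s * (\<Sum>b\<in>nb a. LINT u|unif_seq. Y a u * Y b u) * ph s) \<le> 7 / 2 * s\<^sup>2 * D\<^sup>2 * B^3"
proof -
  define T where "T u = (\<Sum>b\<in>nb a. Y b u)" for u
  define R where "R u = (\<Sum>b\<in>A - nb a. Y b u)" for u
  have [measurable]: "T \<in> borel_measurable unif_seq" "R \<in> borel_measurable unif_seq"
    unfolding T_def[abs_def] R_def[abs_def] using nb_sub by auto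
  have [measurable]: "Y a \<in> borel_measurable unif_seq" using a by simp
  have B0: "0 \<le> B" using B_nonneg[OF a] .
  have WRT: "W u = R u + T u" for u
    unfolding R_def T_def by (rule W_split[OF nb_sub])
  have Tb: "\<bar>T u\<bar> \<le> D * B" for u
    unfolding T_def using card_nb[OF a] B0
    by (intro order_trans[OF abs_sum_le[OF nb_sub]] mult_right_mono) auto
  have YT: "\<bar>Y a u * T u\<bar> \<le> B * (D * B)" for u
    unfolding abs_mult using bound[OF a, of u] Tb[of u] B0 by (intro mult_mono) auto
  \<comment> \<open>No variable in \<open>R\<close> meets \<open>supp a\<close>, so the zeroth term
    factors and the centred factor kills it.\<close>
  have zero: "(LINT u|unif_seq. Y a u * iexp (s * R u)) = 0"
  proof -
    have "(LINT u|unif_seq. complex_of_real (Y a u) * iexp (s * R u)) = (LINT u|unif_seq. complex_of_real (Y a u)) * (LINT u|unif_seq. iexp (s * R u))"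
    proof (rule integral_indep[of _ _ B 1 "supp a" "\<Union>b\<in>A - nb a. supp b"])
      show "depends_on (\<lambda>u. complex_of_real (Y a u)) (supp a)"
        using depends_on_compose[OF dep[OF a]] .
      show "depends_on (\<lambda>u. iexp (s * R u)) (\<Union>b\<in>A - nb a. supp b)"
        using depends_on_compose[OF sum_compl_depends[OF nb_sub[of a]], where g = "\<lambda>r. iexp (s * r)"]
        by (simp add: R_def)
    qed (use bound[OF a] in \<open>auto simp: nb_def\<close>)
    then show ?thesis using centred[OF a] by (simp add: integral_complex_of_real)
  qed
  have iYR: "integrable unif_seq (\<lambda>u. complex_of_real (Y a u) * iexp (s * R u))"
    by (rule integrable_iexp_mult[OF _ bound[OF a]]) auto
  have iYT: "integrable unif_seq (\<lambda>u. complex_of_real (Y a u * T u) * iexp (s * R u))"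
    by (rule integrable_iexp_mult[OF _ YT]) auto
  have 1: "cmod ((LINT u|unif_seq. Y a u * iexp (s * W u)) - (LINT u|unif_seq. Y a u * iexp (s * R u) + \<i> * s * (Y a u * T u * iexp (s * R u))))
      \<le> B * ((s * (D * B))\<^sup>2 / 2)"
  proof (rule P.norm_integral_diff_le)
    show "integrable unif_seq (\<lambda>u. complex_of_real (Y a u) * iexp (s * W u))"
      using bound[OF a] by (intro integrable_iexp_mult) auto
    show "integrable unif_seq (\<lambda>u. complex_of_real (Y a u) * iexp (s * R u) + \<i> * s * (complex_of_real (Y a u * T u) * iexp (s * R u)))"
      by (intro Bochner_Integration.integrable_add integrable_mult_right iYR iYT)
    fix u
    have "Y a u * iexp (s * W u) - (Y a u * iexp (s * R u) + \<i> * s * (Y a u * T u * iexp (s * R u)))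
      = Y a u * (iexp (s * R u) * (iexp (s * T u) - 1 - \<i> * (s * T u)))"
      by (simp add: WRT algebra_simps exp_add)
    also have "cmod \<dots> \<le> B * ((s * T u)\<^sup>2 / 2)"
      unfolding norm_mult using bound[OF a, of u] cmod_iexp_taylor2_le[of "s * T u"] B0
      by (intro mult_mono) auto
    also have "\<dots> \<le> B * ((s * (D * B))\<^sup>2 / 2)"
      proof (intro mult_left_mono divide_right_mono)
      have "\<bar>s * T u\<bar> \<le> s * (D * B)"
        using Tb[of u] s by (simp add: abs_mult mult_left_mono)
      then show "(s * T u)\<^sup>2 \<le> (s * (D * B))\<^sup>2"
        by (metis abs_ge_zero power2_abs power_mono)
    qed (use B0 in auto)
    finally show "cmod (Y a u * iexp (s * W u) - (Y a u * iexp (s * R u) + \<i> * s * (Y a u * T u * iexp (s * R u)))) \<le> B * ((s * (D * B))\<^sup>2 / 2)" .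
  qed
  have 2: "(LINT u|unif_seq. Y a u * iexp (s * R u) + \<i> * s * (Y a u * T u * iexp (s * R u)))
      = \<i> * s * (\<Sum>b\<in>nb a. LINT u|unif_seq. Y a u * Y b u * iexp (s * R u))"
  proof -
    have i: "integrable unif_seq (\<lambda>u. complex_of_real (Y a u * Y b u) * iexp (s * R u))" if "b \<in> nb a" for b
    proof -
      have b: "b \<in> A" using that nb_sub by auto
      have YY: "\<bar>Y a u * Y b u\<bar> \<le> B * B" for u
        unfolding abs_mult using bound[OF a, of u] bound[OF b, of u] B0 by (intro mult_mono) auto
      show ?thesis using b by (intro integrable_iexp_mult[OF _ YY]) auto
    qed
    have "(LINT u|unif_seq. Y a u * iexp (s * R u) + \<i> * s * (Y a u * T u * iexp (s * R u)))
      = (LINT u|unif_seq. Y a u * iexp (s * R u)) + \<i> * s * (LINT u|unif_seq. Y a u * T u * iexp (s * R u))"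
      by (subst Bochner_Integration.integral_add[OF iYR integrable_mult_right[OF iYT]]) simp
    also have "(LINT u|unif_seq. Y a u * T u * iexp (s * R u)) = (LINT u|unif_seq. (\<Sum>b\<in>nb a. Y a u * Y b u * iexp (s * R u)))"
      by (simp add: T_def sum_distrib_left sum_distrib_right)
    also have "\<dots> = (\<Sum>b\<in>nb a. LINT u|unif_seq. Y a u * Y b u * iexp (s * R u))"
      by (rule Bochner_Integration.integral_sum) (rule i)
    finally show ?thesis by (simp only: zero add_0)
  qed
  have 3: "cmod ((LINT u|unif_seq. Y a u * Y b u * iexp (s * R u)) - (LINT u|unif_seq. Y a u * Y b u) * ph s) \<le> 3 * (s * D * B^3)"
    if "b \<in> nb a" for b
  proof -
    have b: "b \<in> A" using that nb_sub by auto
    have [measurable]: "Y b \<in> borel_measurable unif_seq" using b by simp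
    \<comment> \<open>\<open>R\<close> is free of the neighbours of \<open>a\<close> only; the
      product \<open>Y a * Y b\<close> is independent of the sum once those of \<open>b\<close> are
      gone too.\<close>
    define Q where "Q u = (\<Sum>c\<in>A - (nb a \<union> nb b). Y c u)" for u
    have sub: "nb a \<union> nb b \<subseteq> A" using nb_sub by auto
    have [measurable]: "Q \<in> borel_measurable unif_seq" unfolding Q_def[abs_def] by auto
    have YY: "\<bar>Y a u * Y b u\<bar> \<le> B * B" for u
      unfolding abs_mult using bound[OF a, of u] bound[OF b, of u] B0 by (intro mult_mono) auto
    have RQ: "\<bar>R u - Q u\<bar> \<le> D * B" for u
    proof -
      have "R u = Q u + (\<Sum>c\<in>nb b - nb a. Y c u)"
      proof -
        have "nb b - nb a \<subseteq> A - nb a" using nb_sub by blast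
        moreover have "A - nb a - (nb b - nb a) = A - (nb a \<union> nb b)" by blast
        ultimately show ?thesis
          unfolding R_def Q_def using fin by (metis finite_Diff sum.subset_diff)
      qed
      moreover have "card (nb b - nb a) \<le> D" using card_nb[OF b] fin_nb[of b] by (meson card_mono Diff_subset order_trans)
      moreover have "nb b - nb a \<subseteq> A" using nb_sub by blast
      ultimately show ?thesis using abs_sum_le[of "nb b - nb a" u] B0
        by (simp) (meson mult_right_mono of_nat_le_iff order_trans)
    qed
    have WQ: "\<bar>W u - Q u\<bar> \<le> 2 * (D * B)" for u
      using RQ[of u] Tb[of u] WRT[of u] by linarith
    have fac: "(LINT u|unif_seq. complex_of_real (Y a u * Y b u) * iexp (s * Q u)) = (LINT u|unif_seq. complex_of_real (Y a u * Y b u)) * (LINT u|unif_seq. iexp (s * Q u))"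
    proof (rule integral_indep[of _ _ "B * B" 1 "supp a \<union> supp b" "\<Union>c\<in>A - (nb a \<union> nb b). supp c"])
      show "depends_on (\<lambda>u. complex_of_real (Y a u * Y b u)) (supp a \<union> supp b)"
        using dep[OF a] dep[OF b] unfolding depends_on_def by (metis UnI1 UnI2)
      show "depends_on (\<lambda>u. iexp (s * Q u)) (\<Union>c\<in>A - (nb a \<union> nb b). supp c)"
        using depends_on_compose[OF sum_compl_depends[OF sub], where g = "\<lambda>r. iexp (s * r)"]
        by (simp add: Q_def)
      show "norm (complex_of_real (Y a u * Y b u)) \<le> B * B" for u
        using YY[of u] by (simp only: norm_of_real)
    qed (auto simp: nb_def)
    have x: "cmod ((LINT u|unif_seq. complex_of_real (Y a u * Y b u) * iexp (s * R u)) - (LINT u|unif_seq. complex_of_real (Y a u * Y b u) * iexp (s * Q u))) \<le> B * B * (s * (D * B))"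
    proof (rule P.norm_integral_diff_le)
      fix u
      have "cmod (complex_of_real (Y a u * Y b u) * iexp (s * R u) - complex_of_real (Y a u * Y b u) * iexp (s * Q u))
         = \<bar>Y a u * Y b u\<bar> * cmod (iexp (s * R u) - iexp (s * Q u))"
        by (metis norm_mult norm_of_real right_diff_distrib)
      also have "\<dots> \<le> B * B * (s * (D * B))"
      proof (intro mult_mono YY)
        have "cmod (iexp (s * R u) - iexp (s * Q u)) \<le> \<bar>s * R u - s * Q u\<bar>" by (rule cmod_iexp_diff_le)
        also have "\<dots> = s * \<bar>R u - Q u\<bar>" using s by (simp add: right_diff_distrib[symmetric] abs_mult)
        also have "\<dots> \<le> s * (D * B)" using s RQ by (intro mult_left_mono) auto
        finally show "cmod (iexp (s * R u) - iexp (s * Q u)) \<le> s * (D * B)" .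
      qed (use B0 in auto)
      finally show "cmod (complex_of_real (Y a u * Y b u) * iexp (s * R u) - complex_of_real (Y a u * Y b u) * iexp (s * Q u)) \<le> B * B * (s * (D * B))" .
    qed (rule integrable_iexp_mult[OF _ YY]; measurable)+
    have y: "cmod ((LINT u|unif_seq. iexp (s * Q u)) - ph s) \<le> s * (2 * (D * B))"
      unfolding ph_def
    proof (rule P.norm_integral_diff_le)
      fix u
      have "cmod (iexp (s * Q u) - iexp (s * W u)) \<le> \<bar>s * Q u - s * W u\<bar>" by (rule cmod_iexp_diff_le)
      also have "\<dots> = s * \<bar>W u - Q u\<bar>" using s by (simp add: right_diff_distrib[symmetric] abs_mult abs_minus_commute)
      also have "\<dots> \<le> s * (2 * (D * B))" using s WQ by (intro mult_left_mono) auto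
      finally show "cmod (iexp (s * Q u) - iexp (s * W u)) \<le> s * (2 * (D * B))" .
    qed (auto intro!: P.integrable_const_bound[of _ 1])
    have z: "cmod (LINT u|unif_seq. complex_of_real (Y a u * Y b u)) \<le> B * B"
      using YY by (intro P.norm_integral_le_const) (simp only: norm_of_real)
    have "cmod ((LINT u|unif_seq. complex_of_real (Y a u * Y b u) * iexp (s * R u)) - (LINT u|unif_seq. complex_of_real (Y a u * Y b u)) * ph s)
      \<le> B * B * (s * (D * B)) + B * B * (s * (2 * (D * B)))"
    proof -
      have "(LINT u|unif_seq. complex_of_real (Y a u * Y b u) * iexp (s * R u)) - (LINT u|unif_seq. complex_of_real (Y a u * Y b u)) * ph s
       = ((LINT u|unif_seq. complex_of_real (Y a u * Y b u) * iexp (s * R u)) - (LINT u|unif_seq. complex_of_real (Y a u * Y b u) * iexp (s * Q u)))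
        + (LINT u|unif_seq. complex_of_real (Y a u * Y b u)) * ((LINT u|unif_seq. iexp (s * Q u)) - ph s)"
        by (simp only: fac right_diff_distrib) simp
      also have "cmod \<dots> \<le> B * B * (s * (D * B)) + B * B * (s * (2 * (D * B)))"
        using y z B0 by (intro norm_triangle_mono x) (auto simp only: norm_mult intro!: mult_mono norm_ge_zero mult_nonneg_nonneg)
      finally show ?thesis .
    qed
    then show ?thesis by (simp add: power3_eq_cube algebra_simps integral_complex_of_real[symmetric])
  qed
  have "(LINT u|unif_seq. Y a u * iexp (s * W u)) - \<i> * s * (\<Sum>b\<in>nb a. LINT u|unif_seq. Y a u * Y b u) * ph s
    = ((LINT u|unif_seq. Y a u * iexp (s * W u)) - (LINT u|unif_seq. Y a u * iexp (s * R u) + \<i> * s * (Y a u * T u * iexp (s * R u))))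
     + \<i> * s * (\<Sum>b\<in>nb a. (LINT u|unif_seq. Y a u * Y b u * iexp (s * R u)) - (LINT u|unif_seq. Y a u * Y b u) * ph s)"
    unfolding 2 by (simp add: sum_subtractf algebra_simps sum_distrib_right sum_distrib_left)
  also have "cmod \<dots> \<le> B * ((s * (D * B))\<^sup>2 / 2) + s * (D * (3 * (s * D * B^3)))"
  proof (intro norm_triangle_mono 1)
    have "cmod (\<Sum>b\<in>nb a. (LINT u|unif_seq. Y a u * Y b u * iexp (s * R u)) - (LINT u|unif_seq. Y a u * Y b u) * ph s)
      \<le> card (nb a) * (3 * (s * D * B^3))"
      using 3 by (intro sum_norm_bound) auto
    also have "\<dots> \<le> D * (3 * (s * D * B^3))"
      using card_nb[OF a] s B0 by (intro mult_right_mono) auto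
    finally show "cmod (\<i> * s * (\<Sum>b\<in>nb a. (LINT u|unif_seq. Y a u * Y b u * iexp (s * R u)) - (LINT u|unif_seq. Y a u * Y b u) * ph s))
      \<le> s * (D * (3 * (s * D * B^3)))"
      using s by (simp add: norm_mult mult_left_mono)
  qed
  also have "\<dots> = 7 / 2 * s\<^sup>2 * D\<^sup>2 * B^3"
    by (simp add: power2_eq_square power3_eq_cube algebra_simps)
  finally show ?thesis .
qed

lemma abs_W_le: "\<bar>W u\<bar> \<le> card A * B"
  unfolding W_def by (rule abs_sum_le) simp

text \<open>Differentiation under the integral: \<open>W\<close> is bounded, so the second order
  Taylor bound is uniform in \<open>u\<close>, and the difference quotient is within a multiple of
  \<open>\<bar>t - s\<bar>\<close> of the claimed derivative.\<close>

lemma ph_deriv: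
  "(ph has_vector_derivative \<i> * (\<Sum>a\<in>A. LINT u|unif_seq. Y a u * iexp (s * W u))) (at s within X)"
proof -
  let ?d = "\<i> * (\<Sum>a\<in>A. LINT u|unif_seq. Y a u * iexp (s * W u))"
  define M where "M = card A * B"
  have iW: "integrable unif_seq (\<lambda>u. complex_of_real (W u) * iexp (s * W u))"
    by (rule integrable_iexp_mult[OF _ abs_W_le]) auto
  have d: "?d = (LINT u|unif_seq. \<i> * (complex_of_real (W u) * iexp (s * W u)))"
  proof -
    have "(\<Sum>a\<in>A. LINT u|unif_seq. Y a u * iexp (s * W u)) = (LINT u|unif_seq. (\<Sum>a\<in>A. Y a u * iexp (s * W u)))"
      using bound by (intro Bochner_Integration.integral_sum[symmetric] integrable_iexp_mult) auto
    also have "\<dots> = (LINT u|unif_seq. complex_of_real (W u) * iexp (s * W u))"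
      by (simp add: W_def sum_distrib_right)
    finally show ?thesis by simp
  qed
  have bd: "cmod (ph t - ph s - (t - s) *\<^sub>R ?d) \<le> (t - s)\<^sup>2 * (M\<^sup>2 / 2)" for t
  proof -
    have i1: "integrable unif_seq (\<lambda>u. iexp (t * W u))" for t
      by (rule P.integrable_const_bound[of _ 1]) auto
    have i2: "integrable unif_seq (\<lambda>u. iexp (s * W u) + (t - s) *\<^sub>R (\<i> * (complex_of_real (W u) * iexp (s * W u))))"
      by (intro Bochner_Integration.integrable_add i1 integrable_scaleR_right integrable_mult_right iW)
    have "ph t - ph s - (t - s) *\<^sub>R ?d = (LINT u|unif_seq. iexp (t * W u))
      - (LINT u|unif_seq. iexp (s * W u) + (t - s) *\<^sub>R (\<i> * (complex_of_real (W u) * iexp (s * W u))))"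
      unfolding d ph_def
      by (subst Bochner_Integration.integral_add[OF i1 integrable_scaleR_right[OF integrable_mult_right[OF iW]]])
         (simp only: integral_scaleR_right diff_diff_eq)
    also have "cmod \<dots> \<le> (t - s)\<^sup>2 * (M\<^sup>2 / 2)"
    proof (rule P.norm_integral_diff_le[OF i1 i2])
      fix u
      have "iexp (t * W u) - (iexp (s * W u) + (t - s) *\<^sub>R (\<i> * (complex_of_real (W u) * iexp (s * W u))))
        = iexp (s * W u) * (iexp ((t - s) * W u) - 1 - \<i> * ((t - s) * W u))"
        by (simp add: algebra_simps scaleR_conv_of_real exp_add[symmetric])
      also have "cmod \<dots> \<le> ((t - s) * W u)\<^sup>2 / 2"
        using cmod_iexp_taylor2_le[of "(t - s) * W u"] by (simp add: norm_mult)
      also have "\<dots> \<le> (t - s)\<^sup>2 * (M\<^sup>2 / 2)"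
      proof -
        have "(W u)\<^sup>2 \<le> M\<^sup>2"
          using abs_W_le[of u] unfolding M_def by (metis abs_ge_zero power2_abs power_mono)
        then show ?thesis by (simp add: power_mult_distrib mult_left_mono)
      qed
      finally show "cmod (iexp (t * W u) - (iexp (s * W u) + (t - s) *\<^sub>R (\<i> * (complex_of_real (W u) * iexp (s * W u))))) \<le> (t - s)\<^sup>2 * (M\<^sup>2 / 2)" .
    qed
    finally show ?thesis .
  qed
  show ?thesis
    unfolding has_vector_derivative_def
  proof (rule has_derivativeI_sandwich[of 1 _ _ _ _ "\<lambda>t. \<bar>t - s\<bar> * (M\<^sup>2 / 2)"])
    show "bounded_linear (\<lambda>x. x *\<^sub>R ?d)" by (rule bounded_linear_scaleR_left)
    have "((\<lambda>t. \<bar>t - s\<bar> * (M\<^sup>2 / 2)) \<longlongrightarrow> \<bar>s - s\<bar> * (M\<^sup>2 / 2)) (at s within X)"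
      by (intro tendsto_intros)
    then show "((\<lambda>t. \<bar>t - s\<bar> * (M\<^sup>2 / 2)) \<longlongrightarrow> 0) (at s within X)" by simp
    fix t assume "t \<noteq> s"
    moreover have "(t - s)\<^sup>2 = \<bar>t - s\<bar> * \<bar>t - s\<bar>" by (simp add: power2_eq_square)
    ultimately show "cmod (ph t - ph s - (t - s) *\<^sub>R ?d) / norm (t - s) \<le> \<bar>t - s\<bar> * (M\<^sup>2 / 2)"
      using bd[of t] by (simp only: divide_le_eq real_norm_def) (simp add: mult_ac)
  qed simp
qed

text \<open>By \<open>term_bound\<close> summed over all indices, \<open>ph\<close> satisfies the
  equation of a Gaussian characteristic function, with derivative \<open>- s * var * ph\<close>, up
  to an error of order s^2.\<close>

lemma stein_tikhomirov_ode:
  assumes "0 \<le> s"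
  shows "cmod (\<i> * (\<Sum>a\<in>A. LINT u|unif_seq. Y a u * iexp (s * W u)) + s * var * ph s)
    \<le> card A * (7 / 2 * s\<^sup>2 * D\<^sup>2 * B^3)"
proof -
  have "\<i> * (\<Sum>a\<in>A. LINT u|unif_seq. Y a u * iexp (s * W u)) + s * var * ph s
    = \<i> * (\<Sum>a\<in>A. (LINT u|unif_seq. Y a u * iexp (s * W u)) - \<i> * s * (\<Sum>b\<in>nb a. LINT u|unif_seq. Y a u * Y b u) * ph s)"
  proof -
    have "(\<Sum>a\<in>A. (LINT u|unif_seq. Y a u * iexp (s * W u)) - \<i> * s * (\<Sum>b\<in>nb a. LINT u|unif_seq. Y a u * Y b u) * ph s)
      = (\<Sum>a\<in>A. LINT u|unif_seq. Y a u * iexp (s * W u)) - \<i> * s * var * ph s"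
      unfolding var_eq of_real_sum sum_subtractf by (simp only: sum_distrib_left sum_distrib_right)
    then show ?thesis
      by (simp only: right_diff_distrib mult.assoc[symmetric] i_squared) (simp add: mult.assoc)
  qed
  also have "cmod \<dots> \<le> card A * (7 / 2 * s\<^sup>2 * D\<^sup>2 * B^3)"
    using sum_norm_bound[OF term_bound[OF _ assms], of A] by (simp add: norm_mult)
  finally show ?thesis .
qed

text \<open>The integrating factor exp(var s^2 / 2) turns the perturbed equation into a bound for
  the derivative of the product \<open>g\<close> on [0,1]. The factor exp(var / 2) picked up there
  cancels on dividing by it at the end, so the estimate is free of the variance and covers
  degenerate cases.\<close>

theorem stein_tikhomirov:
  "cmod ((LINT u|unif_seq. iexp (W u)) - exp (- var / 2)) \<le> 7 / 2 * card A * D\<^sup>2 * B^3"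
proof (cases "A = {}")
  case True
  have W0: "W = (\<lambda>_. 0)"
  proof
    show "W u = 0" for u unfolding W_def using True by simp
  qed
  then have v0: "var = 0" by (simp add: var_def)
  show ?thesis unfolding W0 v0 using True P.prob_space by simp
next
  case False
  then have B0: "0 \<le> B" using B_nonneg by auto
  have v0: "0 \<le> var" unfolding var_def by simp
  define K where "K = 7 / 2 * card A * D\<^sup>2 * B^3"
  have K0: "0 \<le> K" unfolding K_def using B0 by simp
  define g where "g s = ph s * of_real (exp (var * s\<^sup>2 / 2))" for s :: real
  let ?S = "\<lambda>s. \<i> * (\<Sum>a\<in>A. LINT u|unif_seq. Y a u * iexp (s * W u))"
  have deriv: "(g has_vector_derivative ((?S s + s * var * ph s) * of_real (exp (var * s\<^sup>2 / 2)))) (at s within {0..1})" for s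
  proof -
    have "((\<lambda>s. complex_of_real (exp (var * s\<^sup>2 / 2))) has_vector_derivative
        of_real (exp (var * s\<^sup>2 / 2) * (var * s))) (at s within {0..1})"
      by (intro has_vector_derivative_of_real)
         (auto intro!: derivative_eq_intros simp: has_real_derivative_iff_has_vector_derivative[symmetric])
    from has_vector_derivative_mult[OF ph_deriv this] show ?thesis
      unfolding g_def[abs_def] by (simp add: algebra_simps)
  qed
  have "norm (g 1 - g 0) \<le> K * exp (var / 2) * norm (1 - 0 :: real)"
  proof (rule differentiable_bound[where S = "{0..1}"])
    show "(g has_derivative (\<lambda>x. x *\<^sub>R ((?S s + s * var * ph s) * of_real (exp (var * s\<^sup>2 / 2))))) (at s within {0..1})" for s
      using deriv unfolding has_vector_derivative_def .
    fix s :: real assume s: "s \<in> {0..1}"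
    have "cmod (?S s + s * var * ph s) \<le> K * s\<^sup>2"
      using stein_tikhomirov_ode[of s] s by (simp add: K_def mult_ac)
    also have "\<dots> \<le> K" using s K0 by (intro mult_left_le) (auto simp: power_le_one)
    finally have 1: "cmod (?S s + s * var * ph s) \<le> K" .
    have 2: "exp (var * s\<^sup>2 / 2) \<le> exp (var / 2)"
      using s v0 by (auto intro!: mult_left_le simp: power_le_one)
    show "onorm (\<lambda>x. x *\<^sub>R ((?S s + s * var * ph s) * of_real (exp (var * s\<^sup>2 / 2)))) \<le> K * exp (var / 2)"
    proof (rule onorm_le)
      fix x :: real
      have "cmod ((?S s + s * var * ph s) * of_real (exp (var * s\<^sup>2 / 2))) \<le> K * exp (var / 2)"
        unfolding norm_mult using 1 2 K0 by (intro mult_mono) auto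
      then show "norm (x *\<^sub>R ((?S s + s * var * ph s) * of_real (exp (var * s\<^sup>2 / 2)))) \<le> K * exp (var / 2) * norm x"
        by (simp only: norm_scaleR mult.commute[of "\<bar>x\<bar>"] real_norm_def mult_right_mono abs_ge_zero)
    qed
  qed auto
  moreover have "g 0 = 1" by (simp add: g_def ph_def P.prob_space)
  moreover have "g 1 = (LINT u|unif_seq. iexp (W u)) * of_real (exp (var / 2))" by (simp add: g_def ph_def)
  ultimately have "cmod ((LINT u|unif_seq. iexp (W u)) * of_real (exp (var / 2)) - 1) \<le> K * exp (var / 2)" by simp
  moreover have "(LINT u|unif_seq. iexp (W u)) - of_real (exp (- var / 2))
    = ((LINT u|unif_seq. iexp (W u)) * of_real (exp (var / 2)) - 1) * of_real (exp (- var / 2))"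
    by (simp add: left_diff_distrib mult.assoc flip: of_real_mult exp_add)
  ultimately have "cmod ((LINT u|unif_seq. iexp (W u)) - of_real (exp (- var / 2))) \<le> (K * exp (var / 2)) * exp (- var / 2)"
    by (simp only: norm_mult norm_of_real abs_exp_cancel mult_right_mono exp_ge_zero)
  also have "\<dots> = K" by (simp add: mult.assoc flip: exp_add)
  finally show ?thesis unfolding K_def .
qed

end

section \<open>The point law\<close>

lemma prob_space_unif_diag: "prob_space unif_diag"
  unfolding unif_diag_def by (rule prob_space.prob_space_distr[OF prob_space_unif01]) auto

lemma prob_space_unif_square: "prob_space unif_square"
proof -
  have "emeasure lborel ({0..1} \<times> {0..1} :: (real \<times> real) set) = 1"
    by (subst lborel_prod[symmetric], subst lborel.emeasure_pair_measure_Times) auto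
  then show ?thesis unfolding unif_square_def by (intro prob_space_uniform_measure) auto
qed

lemma sets_unif_diag [simp, measurable_cong]: "sets unif_diag = sets borel"
  by (simp add: unif_diag_def)

lemma sets_unif_square [simp, measurable_cong]: "sets unif_square = sets borel"
  by (simp add: unif_square_def)

lemma unif_square_eq_pair: "unif_square = unif01 \<Otimes>\<^sub>M unif01"
proof (rule pair_measure_eqI[symmetric])
  interpret prob_space unif01 by (rule prob_space_unif01)
  show "sigma_finite_measure unif01" "sigma_finite_measure unif01" by unfold_locales
  show "sets (unif01 \<Otimes>\<^sub>M unif01) = sets unif_square"
    using sets_pair_measure_cong[OF sets_unif01 sets_unif01] by (simp only: borel_prod sets_unif_square)
  fix A B assume "A \<in> sets unif01" "B \<in> sets unif01"
  then have [measurable]: "A \<in> sets borel" "B \<in> sets borel" by auto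
  have 1: "emeasure unif01 A = emeasure lborel ({0..1} \<inter> A)" if "A \<in> sets borel" for A
    using that by (simp add: unif01_def emeasure_uniform_measure divide_ennreal_def)
  have "emeasure unif_square (A \<times> B) = emeasure lborel (({0..1} \<times> {0..1}) \<inter> A \<times> B) / emeasure lborel ({0..1} \<times> {0..1} :: (real \<times> real) set)"
    unfolding unif_square_def by (rule emeasure_uniform_measure) (auto simp: borel_Times)
  also have "({0..1} \<times> {0..1}) \<inter> A \<times> B = ({0..1} \<inter> A) \<times> ({0..1} \<inter> B)" by auto
  also have "emeasure lborel (({0..1} \<inter> A) \<times> ({0..1} \<inter> B)) = emeasure lborel ({0..1} \<inter> A) * emeasure lborel ({0..1} \<inter> B)"
    by (subst lborel_prod[symmetric], subst lborel.emeasure_pair_measure_Times) auto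
  also have "emeasure lborel ({0..1} \<times> {0..1} :: (real \<times> real) set) = 1"
    by (subst lborel_prod[symmetric], subst lborel.emeasure_pair_measure_Times) auto
  finally show "emeasure unif01 A * emeasure unif01 B = emeasure unif_square (A \<times> B)"
    by (simp add: 1 divide_ennreal_def)
qed

lemma kernel_measurable:
  "(\<lambda>b. if b then unif_diag else unif_square) \<in> measurable (measure_pmf (bernoulli_pmf p)) (subprob_algebra borel)"
  using prob_space_imp_subprob_space[OF prob_space_unif_diag] prob_space_imp_subprob_space[OF prob_space_unif_square]
  by (auto simp: space_subprob_algebra)

lemma sets_point_law [simp, measurable_cong]: "sets (point_law p) = sets borel"
  unfolding point_law_def by (rule sets_bind) auto

lemma prob_space_point_law: "prob_space (point_law p)"
  unfolding point_law_def
proof (rule prob_space.prob_space_bind[OF prob_space_measure_pmf _ kernel_measurable])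
  show "AE b in measure_pmf (bernoulli_pmf p). prob_space (if b then unif_diag else unif_square)"
    using prob_space_unif_diag prob_space_unif_square by simp
qed

lemma integral_point_law:
  fixes f :: "real \<times> real \<Rightarrow> real"
  assumes [measurable]: "f \<in> borel_measurable borel" and b: "\<And>z. \<bar>f z\<bar> \<le> K" and p: "p \<in> {0..1}"
  shows "(LINT z|point_law p. f z) = p * (LINT z|unif_diag. f z) + (1 - p) * (LINT z|unif_square. f z)"
proof -
  have "(LINT z|point_law p. f z) = (LINT c|measure_pmf (bernoulli_pmf p). LINT z|(if c then unif_diag else unif_square). f z)"
    unfolding point_law_def
  proof (rule integral_bind[where B' = 1, OF _ _ kernel_measurable])
    show "finite_measure (measure_pmf (bernoulli_pmf p))" by unfold_locales
    show "AE x in measure_pmf (bernoulli_pmf p). emeasure (if x then unif_diag else unif_square) (space (if x then unif_diag else unif_square)) \<le> ennreal 1"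
      using prob_space.emeasure_space_1[OF prob_space_unif_diag] prob_space.emeasure_space_1[OF prob_space_unif_square] by simp
  qed (use b in auto)
  also have "\<dots> = p * (LINT z|unif_diag. f z) + (1 - p) * (LINT z|unif_square. f z)"
    using p by (subst integral_bernoulli_pmf) auto
  finally show ?thesis .
qed

section \<open>Integrals against product measures\<close>

text \<open>The bound is required at every point, not merely on the space, so that it passes to
  partial evaluations such as \<open>z(x := y)\<close> without side conditions.\<close>

definition bdd_meas :: "'a measure \<Rightarrow> ('a \<Rightarrow> real) \<Rightarrow> real \<Rightarrow> bool" where
  "bdd_meas M f K \<longleftrightarrow> f \<in> borel_measurable M \<and> (\<forall>x. \<bar>f x\<bar> \<le> K)"

lemma (in prob_space) bdd_meas_integrable: "bdd_meas M f K \<Longrightarrow> integrable M f"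
  unfolding bdd_meas_def by (intro integrable_const_bound[of _ K]) auto

lemma integral_PiM_insert:
  fixes G :: "('i \<Rightarrow> 'a) \<Rightarrow> real"
  assumes nu: "\<And>i. prob_space (\<nu> i)" and J: "finite J" "x \<notin> J"
    and G: "G \<in> borel_measurable (PiM (insert x J) \<nu>)" "\<And>z. \<bar>G z\<bar> \<le> K"
  shows "(LINT z|PiM (insert x J) \<nu>. G z) = (LINT z|PiM J \<nu>. LINT y|\<nu> x. G (z(x := y)))"
proof -
  interpret product_prob_space \<nu> "insert x J" using nu by (intro product_prob_spaceI)
  show ?thesis
    using G J by (intro product_integral_insert P.integrable_const_bound[of _ K]) auto
qed

lemma borel_measurable_integral_upd:
  fixes G :: "('i \<Rightarrow> 'a) \<Rightarrow> real"
  assumes "prob_space M" "sets M = sets B" and G: "G \<in> borel_measurable (PiM (insert x J) (\<lambda>_. B))"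
  shows "(\<lambda>z. LINT y|M. G (z(x := y))) \<in> borel_measurable (PiM J (\<lambda>_. B))"
proof -
  interpret prob_space M by fact
  have "case_prod (\<lambda>z y. G (z(x := y))) \<in> borel_measurable (PiM J (\<lambda>_. B) \<Otimes>\<^sub>M B)"
    using measurable_comp[OF measurable_add_dim G] by (simp add: o_def case_prod_beta)
  then have "case_prod (\<lambda>z y. G (z(x := y))) \<in> borel_measurable (PiM J (\<lambda>_. B) \<Otimes>\<^sub>M M)"
    by (simp only: measurable_cong_sets[OF sets_pair_measure_cong[OF refl assms(2)] refl])
  then show ?thesis by (rule borel_measurable_lebesgue_integral)
qed

text \<open>Independent coordinates with laws \<open>\<nu> (i a)\<close>, averaged over all tuples \<open>i\<close>, become i.i.d. with the
  averaged law; this is where \<open>\<psi>\<close> and \<open>\<mu>\<close> come from.\<close>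

lemma sum_integral_PiM_tuples:
  fixes G :: "('i \<Rightarrow> 'a) \<Rightarrow> real" and A :: "'k set"
  assumes nu: "\<And>k. prob_space (\<nu> k)" "\<And>k. sets (\<nu> k) = sets B" and La: "prob_space \<Lambda>" "sets \<Lambda> = sets B"
    and A: "finite A"
    and avg: "\<And>g K. bdd_meas B g K \<Longrightarrow> (\<Sum>k\<in>A. LINT y|\<nu> k. g y) = real (card A) * (LINT y|\<Lambda>. g y)"
    and J: "finite J"
  shows "bdd_meas (PiM J (\<lambda>_. B)) G K \<Longrightarrow>
    (\<Sum>i\<in>PiE J (\<lambda>_. A). LINT z|PiM J (\<lambda>a. \<nu> (i a)). G z) = real (card A) ^ card J * (LINT z|PiM J (\<lambda>_. \<Lambda>). G z)"
  using J
proof (induction J arbitrary: G rule: finite_induct)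
  case empty
  then show ?case by (simp add: PiM_empty)
next
  case (insert x J)
  have G: "G \<in> borel_measurable (PiM (insert x J) (\<lambda>_. B))" "\<And>z. \<bar>G z\<bar> \<le> K"
    using insert.prems by (auto simp: bdd_meas_def)
  note [measurable_cong] = nu(2) La(2)
  have spB: "space B = space \<Lambda>" using sets_eq_imp_space_eq[OF La(2)] by simp
  have upd: "(\<lambda>y. G (z(x := y))) \<in> borel_measurable B" if "z \<in> space (PiM J (\<lambda>_. B))" for z
    using measurable_comp[OF measurable_component_update[OF that insert.hyps(2)] G(1)] by (simp add: o_def)
  have setsP: "sets (PiM L (\<lambda>a. \<nu> (i a))) = sets (PiM L (\<lambda>_. B))" for L i
    by (intro sets_PiM_cong) (auto simp: nu)
  have setsL: "sets (PiM L (\<lambda>_. \<Lambda>)) = sets (PiM L (\<lambda>_. B))" for L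
    by (intro sets_PiM_cong) (auto simp: La)
  define G' where "G' z = (LINT y|\<Lambda>. G (z(x := y)))" for z
  have Gk: "(\<lambda>z. LINT y|M. G (z(x := y))) \<in> borel_measurable (PiM J (\<lambda>_. B))" if "prob_space M" "sets M = sets B" for M
    using borel_measurable_integral_upd[OF that G(1)] .
  have G'b: "\<bar>G' z\<bar> \<le> K" for z
    using prob_space.norm_integral_le_const[OF La(1), of "\<lambda>y. G (z(x := y))" K] G(2) by (simp add: G'_def)
  have G'm: "bdd_meas (PiM J (\<lambda>_. B)) G' K"
    using Gk[OF La] G'b by (simp add: bdd_meas_def G'_def[abs_def])
  have "(\<Sum>i\<in>PiE (insert x J) (\<lambda>_. A). LINT z|PiM (insert x J) (\<lambda>a. \<nu> (i a)). G z)
     = (\<Sum>(k, i)\<in>A \<times> PiE J (\<lambda>_. A). LINT z|PiM (insert x J) (\<lambda>a. \<nu> ((i(x := k)) a)). G z)"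
    unfolding PiE_insert_eq using inj_combinator[OF insert.hyps(2)]
    by (subst sum.reindex) (auto simp: case_prod_beta)
  also have "\<dots> = (\<Sum>i\<in>PiE J (\<lambda>_. A). \<Sum>k\<in>A. LINT z|PiM (insert x J) (\<lambda>a. \<nu> ((i(x := k)) a)). G z)"
    by (simp add: sum.cartesian_product[symmetric]) (rule sum.swap)
  also have "\<dots> = (\<Sum>i\<in>PiE J (\<lambda>_. A). \<Sum>k\<in>A. LINT z|PiM J (\<lambda>a. \<nu> (i a)). LINT y|\<nu> k. G (z(x := y)))"
  proof (intro sum.cong refl)
    fix i k
    have "(LINT z|PiM (insert x J) (\<lambda>a. \<nu> ((i(x := k)) a)). G z)
      = (LINT z|PiM J (\<lambda>a. \<nu> ((i(x := k)) a)). LINT y|\<nu> ((i(x := k)) x). G (z(x := y)))"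
      using G insert.hyps nu(1) by (intro integral_PiM_insert[where K = K]) (auto simp: measurable_cong_sets[OF setsP refl])
    also have "PiM J (\<lambda>a. \<nu> ((i(x := k)) a)) = PiM J (\<lambda>a. \<nu> (i a))"
      using insert.hyps(2) by (intro PiM_cong) auto
    finally show "(LINT z|PiM (insert x J) (\<lambda>a. \<nu> ((i(x := k)) a)). G z) = (LINT z|PiM J (\<lambda>a. \<nu> (i a)). LINT y|\<nu> k. G (z(x := y)))"
      unfolding fun_upd_same .
  qed
  also have "\<dots> = (\<Sum>i\<in>PiE J (\<lambda>_. A). LINT z|PiM J (\<lambda>a. \<nu> (i a)). real (card A) * G' z)"
  proof (intro sum.cong refl)
    fix i
    interpret P: prob_space "PiM J (\<lambda>a. \<nu> (i a))" by (intro prob_space_PiM nu)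
    have "(\<Sum>k\<in>A. LINT z|PiM J (\<lambda>a. \<nu> (i a)). LINT y|\<nu> k. G (z(x := y))) = (LINT z|PiM J (\<lambda>a. \<nu> (i a)). (\<Sum>k\<in>A. LINT y|\<nu> k. G (z(x := y))))"
    proof (rule Bochner_Integration.integral_sum[symmetric])
      fix k
      have "\<bar>LINT y|\<nu> k. G (z(x := y))\<bar> \<le> K" for z
        using prob_space.norm_integral_le_const[OF nu(1)[of k], of "\<lambda>y. G (z(x := y))" K] G(2) by simp
      then show "integrable (PiM J (\<lambda>a. \<nu> (i a))) (\<lambda>z. LINT y|\<nu> k. G (z(x := y)))"
        using Gk[OF nu] by (intro P.integrable_const_bound[of _ K]) (auto simp: measurable_cong_sets[OF setsP refl])
    qed
    also have "\<dots> = (LINT z|PiM J (\<lambda>a. \<nu> (i a)). real (card A) * G' z)"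
    proof (rule Bochner_Integration.integral_cong[OF refl])
      fix z assume "z \<in> space (PiM J (\<lambda>a. \<nu> (i a)))"
      then have "z \<in> space (PiM J (\<lambda>_. B))" using sets_eq_imp_space_eq[OF setsP] by blast
      then show "(\<Sum>k\<in>A. LINT y|\<nu> k. G (z(x := y))) = real (card A) * G' z"
        unfolding G'_def using upd G(2) by (intro avg[of _ K]) (simp add: bdd_meas_def)
    qed
    finally show "(\<Sum>k\<in>A. LINT z|PiM J (\<lambda>a. \<nu> (i a)). LINT y|\<nu> k. G (z(x := y))) = (LINT z|PiM J (\<lambda>a. \<nu> (i a)). real (card A) * G' z)" .
  qed
  also have "\<dots> = real (card A) * (real (card A) ^ card J * (LINT z|PiM J (\<lambda>_. \<Lambda>). G' z))"
    using insert.IH[OF G'm] by (simp add: sum_distrib_left[symmetric])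
  also have "(LINT z|PiM J (\<lambda>_. \<Lambda>). G' z) = (LINT z|PiM (insert x J) (\<lambda>_. \<Lambda>). G z)"
    unfolding G'_def using G insert.hyps La(1)
    by (intro integral_PiM_insert[where K = K, symmetric]) (auto simp: measurable_cong_sets[OF setsL refl])
  finally show ?case using insert.hyps by (simp add: mult_ac)
qed

text \<open>The factors are exchanged one coordinate at a time, each exchange costing at most
  \<open>d\<close>; averaging out a coordinate leaves an integrand that is again bounded by
  \<open>K\<close>.\<close>

lemma integral_PiM_diff_le:
  fixes G :: "('i \<Rightarrow> 'a) \<Rightarrow> real" and d :: real
  assumes al: "prob_space \<alpha>" "sets \<alpha> = sets B" and be: "prob_space \<beta>" "sets \<beta> = sets B"
    and diff: "\<And>g. bdd_meas B g K \<Longrightarrow> \<bar>(LINT y|\<alpha>. g y) - (LINT y|\<beta>. g y)\<bar> \<le> d"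
    and J: "finite J"
  shows "bdd_meas (PiM J (\<lambda>_. B)) G K \<Longrightarrow>
    \<bar>(LINT z|PiM J (\<lambda>_. \<alpha>). G z) - (LINT z|PiM J (\<lambda>_. \<beta>). G z)\<bar> \<le> card J * d"
  using J
proof (induction J arbitrary: G rule: finite_induct)
  case empty
  then show ?case by (simp add: PiM_empty)
next
  case (insert x J)
  have G: "G \<in> borel_measurable (PiM (insert x J) (\<lambda>_. B))" "\<And>z. \<bar>G z\<bar> \<le> K"
    using insert.prems by (auto simp: bdd_meas_def)
  have upd: "(\<lambda>y. G (z(x := y))) \<in> borel_measurable B" if "z \<in> space (PiM J (\<lambda>_. B))" for z
    using measurable_comp[OF measurable_component_update[OF that insert.hyps(2)] G(1)] by (simp add: o_def)
  have setsP: "sets (PiM L (\<lambda>_. M)) = sets (PiM L (\<lambda>_. B))" if "sets M = sets B" for L and M :: "'a measure"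
    by (intro sets_PiM_cong) (auto simp: that)
  have Gk: "bdd_meas (PiM J (\<lambda>_. B)) (\<lambda>z. LINT y|M. G (z(x := y))) K" if "prob_space M" "sets M = sets B" for M
  proof -
    have "\<bar>LINT y|M. G (z(x := y))\<bar> \<le> K" for z
      using prob_space.norm_integral_le_const[OF that(1), of "\<lambda>y. G (z(x := y))" K] G(2) by simp
    then show ?thesis using borel_measurable_integral_upd[OF that G(1)] by (simp add: bdd_meas_def)
  qed
  have ins: "(LINT z|PiM (insert x J) (\<lambda>_. M). G z) = (LINT z|PiM J (\<lambda>_. M). LINT y|M. G (z(x := y)))"
    if "prob_space M" "sets M = sets B" for M
    using that G insert.hyps by (intro integral_PiM_insert[where K = K]) (auto simp: measurable_cong_sets[OF setsP[OF that(2)] refl])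
  interpret B: prob_space "PiM J (\<lambda>_. \<beta>)" by (intro prob_space_PiM be)
  have 1: "\<bar>(LINT z|PiM J (\<lambda>_. \<alpha>). LINT y|\<alpha>. G (z(x := y))) - (LINT z|PiM J (\<lambda>_. \<beta>). LINT y|\<alpha>. G (z(x := y)))\<bar> \<le> card J * d"
    by (rule insert.IH[OF Gk[OF al]])
  have 2: "\<bar>(LINT z|PiM J (\<lambda>_. \<beta>). LINT y|\<alpha>. G (z(x := y))) - (LINT z|PiM J (\<lambda>_. \<beta>). LINT y|\<beta>. G (z(x := y)))\<bar> \<le> d"
  proof -
    have i: "integrable (PiM J (\<lambda>_. \<beta>)) (\<lambda>z. LINT y|M. G (z(x := y)))" if "prob_space M" "sets M = sets B" for M
      using Gk[OF that] by (intro B.bdd_meas_integrable[of _ K]) (simp add: bdd_meas_def measurable_cong_sets[OF setsP[OF be(2)] refl])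
    have "norm ((LINT z|PiM J (\<lambda>_. \<beta>). LINT y|\<alpha>. G (z(x := y))) - (LINT z|PiM J (\<lambda>_. \<beta>). LINT y|\<beta>. G (z(x := y)))) \<le> d"
    proof (rule B.norm_integral_diff_le[OF i[OF al] i[OF be]])
      fix z assume "z \<in> space (PiM J (\<lambda>_. \<beta>))"
      then have "z \<in> space (PiM J (\<lambda>_. B))" using sets_eq_imp_space_eq[OF setsP[OF be(2)]] by blast
      then show "norm ((LINT y|\<alpha>. G (z(x := y))) - (LINT y|\<beta>. G (z(x := y)))) \<le> d"
        using diff[of "\<lambda>y. G (z(x := y))"] upd G(2) by (simp add: bdd_meas_def)
    qed
    then show ?thesis by simp
  qed
  show ?case using 1 2 insert.hyps unfolding ins[OF al] ins[OF be] by (simp add: algebra_simps)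
qed

text \<open>The integral of a bounded function against \<open>point_law\<close> is affine in the
  parameter, with slope at most 2K. This is how the actual fraction of fixed points is replaced by
  its limit.\<close>

lemma integral_PiM_point_law_lipschitz:
  fixes p q K :: real
  assumes "p \<in> {0..1}" "q \<in> {0..1}" "finite J" "bdd_meas (PiM J (\<lambda>_. borel)) G K"
  shows "\<bar>(LINT z|PiM J (\<lambda>_. point_law p). G z) - (LINT z|PiM J (\<lambda>_. point_law q). G z)\<bar> \<le> card J * (2 * K * \<bar>p - q\<bar>)"
proof -
  have "\<bar>(LINT y|point_law p. g y) - (LINT y|point_law q. g y)\<bar> \<le> 2 * K * \<bar>p - q\<bar>"
    if g: "bdd_meas borel g K" for g
  proof -
  from g have g': "g \<in> borel_measurable borel" "\<And>z. \<bar>g z\<bar> \<le> K" by (auto simp: bdd_meas_def)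
  have b: "\<bar>LINT z|unif_diag. g z\<bar> \<le> K" "\<bar>LINT z|unif_square. g z\<bar> \<le> K"
    using prob_space.norm_integral_le_const[OF prob_space_unif_diag, of g K]
      prob_space.norm_integral_le_const[OF prob_space_unif_square, of g K] g' by auto
  have "(LINT y|point_law p. g y) - (LINT y|point_law q. g y) = (p - q) * ((LINT z|unif_diag. g z) - (LINT z|unif_square. g z))"
    using integral_point_law[OF g' assms(1)] integral_point_law[OF g' assms(2)] by (simp add: algebra_simps)
  also have "\<bar>\<dots>\<bar> \<le> \<bar>p - q\<bar> * (2 * K)"
    unfolding abs_mult using b by (intro mult_left_mono) auto
  finally show ?thesis by (simp add: mult_ac)
  qed
  from integral_PiM_diff_le[OF prob_space_point_law sets_point_law prob_space_point_law sets_point_law this assms(3,4)]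
  show ?thesis .
qed

section \<open>Laws of the graph points\<close>

lemma graph_pt_measurable [measurable]: "(\<lambda>u. graph_pt \<sigma> u k) \<in> measurable unif_seq borel"
  unfolding graph_pt_def borel_prod[symmetric] by measurable

lemma depends_on_graph_pt: "depends_on (\<lambda>u. graph_pt \<sigma> u k) {k, \<sigma> k}"
  by (simp add: depends_on_def graph_pt_def)

lemma distr_unif_seq_component: "distr unif_seq unif01 (\<lambda>u. u k) = unif01"
  unfolding unif_seq_def using prob_space_unif01 by (intro distr_PiM_component) auto

lemma distr_pair_indep:
  assumes f [measurable]: "f \<in> measurable unif_seq M" and g [measurable]: "g \<in> measurable unif_seq N"
    and dep: "depends_on f S" "depends_on g T" "S \<inter> T = {}"
  shows "distr unif_seq (M \<Otimes>\<^sub>M N) (\<lambda>u. (f u, g u)) = distr unif_seq M f \<Otimes>\<^sub>M distr unif_seq N g"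
proof (rule pair_measure_eqI[symmetric])
  interpret P: prob_space unif_seq by (rule prob_space_unif_seq)
  interpret F: prob_space "distr unif_seq M f" by (rule P.prob_space_distr) fact
  interpret G: prob_space "distr unif_seq N g" by (rule P.prob_space_distr) fact
  show "sigma_finite_measure (distr unif_seq M f)" "sigma_finite_measure (distr unif_seq N g)" by unfold_locales
  show "sets (distr unif_seq M f \<Otimes>\<^sub>M distr unif_seq N g) = sets (distr unif_seq (M \<Otimes>\<^sub>M N) (\<lambda>u. (f u, g u)))"
    by (simp cong: sets_pair_measure_cong)
  fix A B assume "A \<in> sets (distr unif_seq M f)" "B \<in> sets (distr unif_seq N g)"
  then have [measurable]: "A \<in> sets M" "B \<in> sets N" by auto
  have "measure unif_seq ((\<lambda>u. (f u, g u)) -` (A \<times> B)) = (LINT u|unif_seq. indicator A (f u) * indicator B (g u))"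
  proof -
    have "(\<lambda>u. (f u, g u)) -` (A \<times> B) \<inter> space unif_seq \<in> sets unif_seq"
      by (rule measurable_sets[of _ _ "M \<Otimes>\<^sub>M N"]) auto
    then have "measure unif_seq ((\<lambda>u. (f u, g u)) -` (A \<times> B)) = (LINT u|unif_seq. indicator ((\<lambda>u. (f u, g u)) -` (A \<times> B)) u)"
      by simp
    also have "\<dots> = (LINT u|unif_seq. indicator A (f u) * indicator B (g u))"
      by (intro Bochner_Integration.integral_cong refl) (auto simp: indicator_def)
    finally show ?thesis .
  qed
  also have "\<dots> = (LINT u|unif_seq. indicator A (f u)) * (LINT u|unif_seq. indicator B (g u))"
    using dep by (intro integral_indep[of _ _ 1 1 S T]) (auto simp: indicator_def depends_on_def; metis)+
  also have "(LINT u|unif_seq. indicator A (f u)) = measure unif_seq (f -` A)"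
  proof -
    have "(LINT u|unif_seq. indicator A (f u)) = (LINT u|unif_seq. indicator (f -` A) u :: real)"
      by (intro Bochner_Integration.integral_cong refl) (auto simp: indicator_def)
    also have "\<dots> = measure unif_seq (f -` A)" using measurable_sets[OF f, of A] by simp
    finally show ?thesis .
  qed
  also have "(LINT u|unif_seq. indicator B (g u)) = measure unif_seq (g -` B)"
  proof -
    have "(LINT u|unif_seq. indicator B (g u)) = (LINT u|unif_seq. indicator (g -` B) u :: real)"
      by (intro Bochner_Integration.integral_cong refl) (auto simp: indicator_def)
    also have "\<dots> = measure unif_seq (g -` B)" using measurable_sets[OF g, of B] by simp
    finally show ?thesis .
  qed
  finally have "measure unif_seq ((\<lambda>u. (f u, g u)) -` (A \<times> B)) = measure unif_seq (f -` A) * measure unif_seq (g -` B)" .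
  then show "emeasure (distr unif_seq M f) A * emeasure (distr unif_seq N g) B = emeasure (distr unif_seq (M \<Otimes>\<^sub>M N) (\<lambda>u. (f u, g u))) (A \<times> B)"
    by (simp add: emeasure_distr P.emeasure_eq_measure ennreal_mult'')
qed

lemma distr_unif_seq_pair:
  assumes "k \<noteq> l"
  shows "distr unif_seq (unif01 \<Otimes>\<^sub>M unif01) (\<lambda>u. (u k, u l)) = unif01 \<Otimes>\<^sub>M unif01"
  using assms distr_pair_indep[of "\<lambda>u. u k" unif01 "\<lambda>u. u l" unif01 "{k}" "{l}"]
  by (simp add: distr_unif_seq_component depends_on_def)

lemma distr_unif_seq_triple:
  assumes "k \<noteq> l" "k \<noteq> m" "l \<noteq> m"
  shows "distr unif_seq unif_triple (\<lambda>u. (u k, u l, u m)) = unif_triple"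
  unfolding unif_triple_def
  using assms distr_pair_indep[of "\<lambda>u. u k" unif01 "\<lambda>u. (u l, u m)" "unif01 \<Otimes>\<^sub>M unif01" "{k}" "{l, m}"]
  by (simp add: distr_unif_seq_component distr_unif_seq_pair depends_on_def)

text \<open>The two possible laws of a graph point are the two components of
  \<open>point_law\<close>, which is why averages over [n] lead back to
  \<open>point_law\<close>.\<close>

definition pt_law :: "(nat \<Rightarrow> nat) \<Rightarrow> nat \<Rightarrow> (real \<times> real) measure" where
  "pt_law \<sigma> k = (if \<sigma> k = k then unif_diag else unif_square)"

lemma prob_space_pt_law: "prob_space (pt_law \<sigma> k)"
  using prob_space_unif_diag prob_space_unif_square by (simp add: pt_law_def)

lemma sets_pt_law [simp, measurable_cong]: "sets (pt_law \<sigma> k) = sets borel"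
  by (simp add: pt_law_def)

lemma space_pt_law [simp]: "space (pt_law \<sigma> k) = UNIV"
  using sets_eq_imp_space_eq[OF sets_pt_law] by simp

lemma distr_graph_pt: "distr unif_seq borel (\<lambda>u. graph_pt \<sigma> u k) = pt_law \<sigma> k"
proof (cases "\<sigma> k = k")
  case True
  have "unif_diag = distr (distr unif_seq unif01 (\<lambda>u. u k)) borel (\<lambda>u. (u, u))"
    by (simp add: distr_unif_seq_component unif_diag_def)
  also have "\<dots> = distr unif_seq borel (\<lambda>u. (u k, u k))"
    by (subst distr_distr) (auto simp: o_def)
  finally show ?thesis using True by (simp add: pt_law_def graph_pt_def)
next
  case False
  have "distr unif_seq borel (\<lambda>u. graph_pt \<sigma> u k) = distr unif_seq (unif01 \<Otimes>\<^sub>M unif01) (\<lambda>u. (u k, u (\<sigma> k)))"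
    unfolding graph_pt_def unif_square_eq_pair[symmetric] by (rule distr_cong) auto
  then show ?thesis using False distr_unif_seq_pair[of k "\<sigma> k"] by (simp add: pt_law_def unif_square_eq_pair)
qed

text \<open>The graph point of \<open>k\<close> reads only the labels of \<open>k\<close> and
  \<open>\<sigma> k\<close>, so with \<open>S\<close> disjoint from these it may be drawn
  afresh.\<close>

lemma integral_freeze_pt:
  fixes H :: "(nat \<Rightarrow> real) \<Rightarrow> real \<times> real \<Rightarrow> real"
  assumes H: "case_prod H \<in> borel_measurable (unif_seq \<Otimes>\<^sub>M borel)" and b: "\<And>u z. \<bar>H u z\<bar> \<le> K"
    and dep: "\<And>z. depends_on (\<lambda>u. H u z) S" and disj: "S \<inter> {k, \<sigma> k} = {}"
  shows "(LINT u|unif_seq. H u (graph_pt \<sigma> u k)) = (LINT u|unif_seq. LINT z|pt_law \<sigma> k. H u z)"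
proof -
  have "(LINT u|unif_seq. H u (graph_pt \<sigma> u k)) = (LINT u|unif_seq. LINT v|unif_seq. H u (graph_pt \<sigma> v k))"
  proof (rule integral_freeze[where K = K and S = S and T = "{k, \<sigma> k}"])
    have "(\<lambda>x. (fst x, graph_pt \<sigma> (snd x) k)) \<in> measurable (unif_seq \<Otimes>\<^sub>M unif_seq) (unif_seq \<Otimes>\<^sub>M borel)"
      by measurable
    from measurable_compose[OF this H] show "(\<lambda>x. H (fst x) (graph_pt \<sigma> (snd x) k)) \<in> borel_measurable (unif_seq \<Otimes>\<^sub>M unif_seq)"
      by simp
    show "depends_on (\<lambda>v. H u (graph_pt \<sigma> v k)) {k, \<sigma> k}" for u
      by (rule depends_on_compose[OF depends_on_graph_pt])
  qed (use b dep disj in auto)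
  also have "\<dots> = (LINT u|unif_seq. LINT z|pt_law \<sigma> k. H u z)"
  proof (rule Bochner_Integration.integral_cong[OF refl])
    fix u
    have "H u \<in> borel_measurable borel"
      using measurable_Pair2[OF H, of u] by simp
    then show "(LINT v|unif_seq. H u (graph_pt \<sigma> v k)) = (LINT z|pt_law \<sigma> k. H u z)"
      unfolding distr_graph_pt[symmetric] by (subst integral_distr) auto
  qed
  finally show ?thesis .
qed

text \<open>Graph points with pairwise disjoint label pairs are integrated out one at a time.
  \<open>H\<close> keeps its dependence on \<open>u\<close> through \<open>S\<close>, so that one
  point of the tuple, or a whole second tuple, can be held back.\<close>

lemma integral_freeze_pts:
  fixes H :: "(nat \<Rightarrow> real) \<Rightarrow> ('i \<Rightarrow> real \<times> real) \<Rightarrow> real"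
  assumes J: "finite J"
    and disj: "\<And>a b. a \<in> J \<Longrightarrow> b \<in> J \<Longrightarrow> a \<noteq> b \<Longrightarrow> {k a, \<sigma> (k a)} \<inter> {k b, \<sigma> (k b)} = {}"
    and disjS: "\<And>a. a \<in> J \<Longrightarrow> S \<inter> {k a, \<sigma> (k a)} = {}"
    and H: "case_prod H \<in> borel_measurable (unif_seq \<Otimes>\<^sub>M PiM J (\<lambda>_. borel))" and b: "\<And>u z. \<bar>H u z\<bar> \<le> K"
    and dep: "\<And>z. depends_on (\<lambda>u. H u z) S"
  shows "(LINT u|unif_seq. H u (\<lambda>a\<in>J. graph_pt \<sigma> u (k a))) = (LINT u|unif_seq. LINT z|PiM J (\<lambda>a. pt_law \<sigma> (k a)). H u z)"
  using J disj disjS H b dep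
proof (induction J arbitrary: H rule: finite_induct)
  case empty
  then show ?case by (simp add: PiM_empty restrict_def lebesgue_integral_count_space_finite)
next
  case (insert x J)
  note H = insert.prems(3) and b = insert.prems(4) and dep = insert.prems(5)
  have setsP: "sets (PiM L (\<lambda>a. pt_law \<sigma> (k a))) = sets (PiM L (\<lambda>_. borel))" for L
    by (intro sets_PiM_cong) auto
  have upd: "(\<lambda>u. \<lambda>a\<in>J. graph_pt \<sigma> u (k a)) \<in> measurable unif_seq (PiM J (\<lambda>_. borel))" by measurable
  have split: "(\<lambda>a\<in>insert x J. graph_pt \<sigma> u (k a)) = (\<lambda>a\<in>J. graph_pt \<sigma> u (k a))(x := graph_pt \<sigma> u (k x))" for u
    using insert.hyps(2) by (auto simp: fun_eq_iff)
  have "(LINT u|unif_seq. H u (\<lambda>a\<in>insert x J. graph_pt \<sigma> u (k a))) = (LINT u|unif_seq. (\<lambda>u y. H u ((\<lambda>a\<in>J. graph_pt \<sigma> u (k a))(x := y))) u (graph_pt \<sigma> u (k x)))"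
    unfolding split ..
  also have "\<dots> = (LINT u|unif_seq. LINT y|pt_law \<sigma> (k x). H u ((\<lambda>a\<in>J. graph_pt \<sigma> u (k a))(x := y)))"
  \<comment> \<open>While the point of \<open>x\<close> is integrated out, the remaining points
    still sit in \<open>u\<close>, so the protected coordinates are \<open>S\<close> together with
    all of theirs.\<close>
  proof (rule integral_freeze_pt[where K = K and S = "S \<union> (\<Union>a\<in>J. {k a, \<sigma> (k a)})"])
    have 1: "(\<lambda>w. (fst w, (\<lambda>(f, y). f(x := y)) (\<lambda>a\<in>J. graph_pt \<sigma> (fst w) (k a), snd w))) \<in> measurable (unif_seq \<Otimes>\<^sub>M borel) (unif_seq \<Otimes>\<^sub>M PiM (insert x J) (\<lambda>_. borel))"
      by (intro measurable_Pair measurable_compose[OF _ measurable_add_dim] measurable_fst measurable_snd measurable_compose[OF measurable_fst upd])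
    from measurable_compose[OF 1 H]
    show "(\<lambda>(u, y). H u ((\<lambda>a\<in>J. graph_pt \<sigma> u (k a))(x := y))) \<in> borel_measurable (unif_seq \<Otimes>\<^sub>M borel)"
      by (simp add: case_prod_beta)
    show "depends_on (\<lambda>u. H u ((\<lambda>a\<in>J. graph_pt \<sigma> u (k a))(x := y))) (S \<union> (\<Union>a\<in>J. {k a, \<sigma> (k a)}))" for y
      unfolding depends_on_def
    proof (intro allI impI)
      fix u v :: "nat \<Rightarrow> real" assume uv: "\<forall>k\<in>S \<union> (\<Union>a\<in>J. {k a, \<sigma> (k a)}). u k = v k"
      then have "(\<lambda>a\<in>J. graph_pt \<sigma> u (k a)) = (\<lambda>a\<in>J. graph_pt \<sigma> v (k a))"
        by (intro restrict_ext) (auto simp: graph_pt_def)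
      moreover have "H u z = H v z" for z using dep[of z] uv unfolding depends_on_def by blast
      ultimately show "H u ((\<lambda>a\<in>J. graph_pt \<sigma> u (k a))(x := y)) = H v ((\<lambda>a\<in>J. graph_pt \<sigma> v (k a))(x := y))" by simp
    qed
    show "(S \<union> (\<Union>a\<in>J. {k a, \<sigma> (k a)})) \<inter> {k x, \<sigma> (k x)} = {}"
      using insert.prems(1)[of _ x] insert.prems(2)[of x] insert.hyps(2) by blast
  qed (rule b)
  also have "\<dots> = (LINT u|unif_seq. LINT z|PiM J (\<lambda>a. pt_law \<sigma> (k a)). LINT y|pt_law \<sigma> (k x). H u (z(x := y)))"
  proof (rule insert.IH)
    interpret L: prob_space "pt_law \<sigma> (k x)" by (rule prob_space_pt_law)
    have 1: "(\<lambda>w. (fst (fst w), (\<lambda>(f, y). f(x := y)) (snd (fst w), snd w))) \<in> measurable ((unif_seq \<Otimes>\<^sub>M PiM J (\<lambda>_. borel)) \<Otimes>\<^sub>M pt_law \<sigma> (k x)) (unif_seq \<Otimes>\<^sub>M PiM (insert x J) (\<lambda>_. borel))"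
      by (intro measurable_Pair measurable_compose[OF _ measurable_add_dim]) measurable
    from measurable_compose[OF 1 H]
    have "case_prod (\<lambda>w y. H (fst w) ((snd w)(x := y))) \<in> borel_measurable ((unif_seq \<Otimes>\<^sub>M PiM J (\<lambda>_. borel)) \<Otimes>\<^sub>M pt_law \<sigma> (k x))"
      by (simp add: case_prod_beta)
    from L.borel_measurable_lebesgue_integral[OF this]
    show "(\<lambda>(u, z). LINT y|pt_law \<sigma> (k x). H u (z(x := y))) \<in> borel_measurable (unif_seq \<Otimes>\<^sub>M PiM J (\<lambda>_. borel))"
      by (simp add: case_prod_beta)
    show "\<bar>LINT y|pt_law \<sigma> (k x). H u (z(x := y))\<bar> \<le> K" for u z
      using L.norm_integral_le_const[of "\<lambda>y. H u (z(x := y))" K] b by simp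
    show "depends_on (\<lambda>u. LINT y|pt_law \<sigma> (k x). H u (z(x := y))) S" for z
      unfolding depends_on_def
    proof (intro allI impI)
      fix u v :: "nat \<Rightarrow> real" assume uv: "\<forall>k\<in>S. u k = v k"
      have "H u w = H v w" for w using dep[of w] uv unfolding depends_on_def by blast
      then show "(LINT y|pt_law \<sigma> (k x). H u (z(x := y))) = (LINT y|pt_law \<sigma> (k x). H v (z(x := y)))" by simp
    qed
  qed (use insert.prems(1,2) in auto)
  also have "\<dots> = (LINT u|unif_seq. LINT z|PiM (insert x J) (\<lambda>a. pt_law \<sigma> (k a)). H u z)"
  proof (rule Bochner_Integration.integral_cong[OF refl])
    fix u
    have "H u \<in> borel_measurable (PiM (insert x J) (\<lambda>_. borel))"
      using measurable_Pair2[OF H, of u] by simp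
    then show "(LINT z|PiM J (\<lambda>a. pt_law \<sigma> (k a)). LINT y|pt_law \<sigma> (k x). H u (z(x := y))) = (LINT z|PiM (insert x J) (\<lambda>a. pt_law \<sigma> (k a)). H u z)"
      using insert.hyps b prob_space_pt_law
      by (intro integral_PiM_insert[where K = K and \<nu> = "\<lambda>a. pt_law \<sigma> (k a)", symmetric]) (auto simp: measurable_cong_sets[OF setsP refl])
  qed
  finally show ?case .
qed

section \<open>Kernel sums over the graph of a permutation\<close>

text \<open>Here \<open>\<sigma>\<close> is deterministic and only the labels are random. Symmetry
  of \<open>G\<close> reflects that a pattern depends on the set of points and not on their order;
  it makes the projections on all arguments agree.\<close>

locale graph_kernel =
  fixes n r :: nat and \<sigma> :: "nat \<Rightarrow> nat" and G :: "(nat \<Rightarrow> real \<times> real) \<Rightarrow> real" and K :: real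
  assumes n: "0 < n" and r: "1 \<le> r" and \<sigma>: "\<sigma> permutes {1..n}"
    and G: "bdd_meas (PiM {1..r} (\<lambda>_. borel)) G K"
    and sym: "\<And>\<rho> z. \<rho> permutes {1..r} \<Longrightarrow> G (z \<circ> \<rho>) = G z"
begin

interpretation P: prob_space unif_seq by (rule prob_space_unif_seq)

definition "fixq = real (card {k \<in> {1..n}. \<sigma> k = k}) / real n"
definition "\<Lambda> = point_law fixq"
definition "T = PiE {1..r} (\<lambda>_. {1..n})"
definition "sp k = {k, \<sigma> k}"
definition "adj k l \<longleftrightarrow> sp k \<inter> sp l \<noteq> {}"
definition "X i u = G (\<lambda>a\<in>{1..r}. graph_pt \<sigma> u (i a))"
text \<open>For a tuple without internal links this is the conditional expectation of
  \<open>X i\<close> given its \<open>a\<close>-th point; the formula is used for all tuples so that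
  sums over \<open>T\<close> need no case distinction.\<close>

definition "h i a u = (LINT z|PiM ({1..r} - {a}) (\<lambda>c. pt_law \<sigma> (i c)). G (z(a := graph_pt \<sigma> u (i a))))"
text \<open>The first-order projection of \<open>G\<close> on argument \<open>a\<close>, the other
  points being i.i.d. with law \<open>\<Lambda>\<close>; for the pattern kernel it is a combination
  of the functions \<open>\<psi>\<close>.\<close>

definition "g a x = (LINT z|PiM ({1..r} - {a}) (\<lambda>_. \<Lambda>). G (z(a := x)))"
text \<open>Equal entries are linked, since \<open>adj k k\<close> holds, so this also catches the
  tuples that are not injective.\<close>

definition "intra i \<longleftrightarrow> (\<exists>a\<in>{1..r}. \<exists>b\<in>{1..r}. a \<noteq> b \<and> adj (i a) (i b))"

lemma G_meas [measurable]: "G \<in> borel_measurable (PiM {1..r} (\<lambda>_. borel))" and G_bound: "\<bar>G z\<bar> \<le> K"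
  using G by (auto simp: bdd_meas_def)

lemma K_nonneg: "0 \<le> K"
  using G_bound[of undefined] by linarith

lemma fixq: "fixq \<in> {0..1}"
proof -
  have "card {k \<in> {1..n}. \<sigma> k = k} \<le> card {1..n}" by (rule card_mono) auto
  then show ?thesis using n by (simp add: fixq_def)
qed

lemma adj_sym: "adj k l \<longleftrightarrow> adj l k"
  by (auto simp: adj_def)

lemma not_intraD: "\<not> intra i \<Longrightarrow> a \<in> {1..r} \<Longrightarrow> b \<in> {1..r} \<Longrightarrow> a \<noteq> b \<Longrightarrow> sp (i a) \<inter> sp (i b) = {}"
  unfolding intra_def adj_def by blast

lemma X_meas [measurable]: "X i \<in> borel_measurable unif_seq"
  unfolding X_def[abs_def] by measurable

lemma X_bound: "\<bar>X i u\<bar> \<le> K"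
  unfolding X_def by (rule G_bound)

lemma X_depends: "depends_on (X i) (\<Union>a\<in>{1..r}. sp (i a))"
  unfolding depends_on_def
proof (intro allI impI)
  fix u v :: "nat \<Rightarrow> real" assume uv: "\<forall>k\<in>\<Union>a\<in>{1..r}. sp (i a). u k = v k"
  then have "(\<lambda>a\<in>{1..r}. graph_pt \<sigma> u (i a)) = (\<lambda>a\<in>{1..r}. graph_pt \<sigma> v (i a))"
    by (intro restrict_ext) (auto simp: graph_pt_def sp_def)
  then show "X i u = X i v" by (simp add: X_def)
qed

lemma sets_PiM_pt_law: "sets (PiM L (\<lambda>c. pt_law \<sigma> (i c))) = sets (PiM L (\<lambda>_. borel))"
  by (intro sets_PiM_cong) auto

lemma upd_meas:
  assumes "a \<in> {1..r}"
  shows "(\<lambda>w. (snd w)(a := graph_pt \<sigma> (fst w) k)) \<in> measurable (unif_seq \<Otimes>\<^sub>M PiM ({1..r} - {a}) (\<lambda>_. borel)) (PiM {1..r} (\<lambda>_. borel))"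
proof -
  have "(\<lambda>w. (\<lambda>(f, y). f(a := y)) (snd w, graph_pt \<sigma> (fst w) k)) \<in> measurable (unif_seq \<Otimes>\<^sub>M PiM ({1..r} - {a}) (\<lambda>_. borel)) (PiM (insert a ({1..r} - {a})) (\<lambda>_. borel))"
    by (intro measurable_compose[OF _ measurable_add_dim]) measurable
  moreover have "insert a ({1..r} - {a}) = {1..r}" using assms by blast
  ultimately show ?thesis by simp
qed

lemma G_upd_meas:
  assumes "a \<in> {1..r}"
  shows "(\<lambda>(u, z). G (z(a := graph_pt \<sigma> u k))) \<in> borel_measurable (unif_seq \<Otimes>\<^sub>M PiM ({1..r} - {a}) (\<lambda>_. borel))"
  using measurable_compose[OF upd_meas[OF assms] G_meas] by (simp add: case_prod_beta)

lemma h_meas [measurable]: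
  assumes "a \<in> {1..r}" shows "h i a \<in> borel_measurable unif_seq"
proof -
  interpret Q: prob_space "PiM ({1..r} - {a}) (\<lambda>c. pt_law \<sigma> (i c))" by (intro prob_space_PiM prob_space_pt_law)
  have "(\<lambda>(u, z). G (z(a := graph_pt \<sigma> u (i a)))) \<in> borel_measurable (unif_seq \<Otimes>\<^sub>M PiM ({1..r} - {a}) (\<lambda>c. pt_law \<sigma> (i c)))"
    using G_upd_meas[OF assms] by (simp only: measurable_cong_sets[OF sets_pair_measure_cong[OF refl sets_PiM_pt_law] refl])
  from Q.borel_measurable_lebesgue_integral[OF this] show ?thesis unfolding h_def[abs_def] .
qed

lemma h_bound: "\<bar>h i a u\<bar> \<le> K"
proof -
  interpret Q: prob_space "PiM ({1..r} - {a}) (\<lambda>c. pt_law \<sigma> (i c))" by (intro prob_space_PiM prob_space_pt_law)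
  show ?thesis unfolding h_def
    using Q.norm_integral_le_const[of "\<lambda>z. G (z(a := graph_pt \<sigma> u (i a)))" K] G_bound by simp
qed

lemma h_depends: "depends_on (h i a) (sp (i a))"
  unfolding depends_on_def by (auto simp: h_def graph_pt_def sp_def)

text \<open>The entries of \<open>i\<close> read pairwise disjoint labels, and \<open>Q\<close>
  meets at most those of the \<open>a\<close>-th entry, so all other points can be averaged out with
  \<open>Q\<close> kept in place.\<close>

lemma freeze_others:
  assumes i: "\<not> intra i" and a: "a \<in> {1..r}"
    and Q [measurable]: "Q \<in> borel_measurable unif_seq" and Qb: "\<And>u. \<bar>Q u\<bar> \<le> L"
    and Qd: "depends_on Q S" and disj: "\<And>c. c \<in> {1..r} \<Longrightarrow> c \<noteq> a \<Longrightarrow> S \<inter> sp (i c) = {}"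
  shows "(LINT u|unif_seq. X i u * Q u) = (LINT u|unif_seq. h i a u * Q u)"
proof -
  let ?J = "{1..r} - {a}"
  let ?H = "\<lambda>u z. G (z(a := graph_pt \<sigma> u (i a))) * Q u"
  have split: "(\<lambda>c\<in>{1..r}. graph_pt \<sigma> u (i c)) = (\<lambda>c\<in>?J. graph_pt \<sigma> u (i c))(a := graph_pt \<sigma> u (i a))" for u
    using a by (auto simp: fun_eq_iff)
  have "(LINT u|unif_seq. X i u * Q u) = (LINT u|unif_seq. ?H u (\<lambda>c\<in>?J. graph_pt \<sigma> u (i c)))"
    unfolding X_def split ..
  also have "\<dots> = (LINT u|unif_seq. LINT z|PiM ?J (\<lambda>c. pt_law \<sigma> (i c)). ?H u z)"
  proof (rule integral_freeze_pts[where K = "K * L" and S = "sp (i a) \<union> S"])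
    show "{i c, \<sigma> (i c)} \<inter> {i d, \<sigma> (i d)} = {}" if "c \<in> ?J" "d \<in> ?J" "c \<noteq> d" for c d
      using not_intraD[OF i, of c d] that by (simp add: sp_def)
    show "(sp (i a) \<union> S) \<inter> {i c, \<sigma> (i c)} = {}" if "c \<in> ?J" for c
    proof -
      have "sp (i a) \<inter> sp (i c) = {}" using not_intraD[OF i, of a c] that a by auto
      then show ?thesis using disj[of c] that by (auto simp: sp_def)
    qed
    show "case_prod ?H \<in> borel_measurable (unif_seq \<Otimes>\<^sub>M PiM ?J (\<lambda>_. borel))"
      using G_upd_meas[OF a, of "i a"] by (simp add: case_prod_beta)
    show "\<bar>?H u z\<bar> \<le> K * L" for u z
      unfolding abs_mult using G_bound Qb K_nonneg by (intro mult_mono) auto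
    show "depends_on (\<lambda>u. ?H u z) (sp (i a) \<union> S)" for z
      using Qd by (auto simp: depends_on_def sp_def graph_pt_def)
  qed simp
  also have "\<dots> = (LINT u|unif_seq. h i a u * Q u)" by (simp add: h_def)
  finally show ?thesis .
qed

lemma expectation_X: "\<not> intra i \<Longrightarrow> a \<in> {1..r} \<Longrightarrow> (LINT u|unif_seq. X i u) = (LINT u|unif_seq. h i a u)"
  using freeze_others[of i a "\<lambda>_. 1" 1 "{}"] by (simp add: depends_on_def)

text \<open>No label is protected here: all points are averaged out at once, which gives an exact
  product law.\<close>

lemma expectation_X_PiM:
  assumes "\<not> intra i"
  shows "(LINT u|unif_seq. X i u) = (LINT z|PiM {1..r} (\<lambda>c. pt_law \<sigma> (i c)). G z)"
proof -
  have "(LINT u|unif_seq. X i u) = (LINT u|unif_seq. (\<lambda>u z. G z) u (\<lambda>c\<in>{1..r}. graph_pt \<sigma> u (i c)))"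
    by (simp add: X_def)
  also have "\<dots> = (LINT u|unif_seq. LINT z|PiM {1..r} (\<lambda>c. pt_law \<sigma> (i c)). G z)"
  proof (rule integral_freeze_pts[where K = K and S = "{}"])
    show "{i c, \<sigma> (i c)} \<inter> {i d, \<sigma> (i d)} = {}" if "c \<in> {1..r}" "d \<in> {1..r}" "c \<noteq> d" for c d
      using not_intraD[OF assms that] by (simp add: sp_def)
    show "(\<lambda>(u, z). G z) \<in> borel_measurable (unif_seq \<Otimes>\<^sub>M PiM {1..r} (\<lambda>_. borel))"
      using measurable_compose[OF measurable_snd G_meas] by (simp add: case_prod_beta')
  qed (auto simp: G_bound depends_on_def)
  finally show ?thesis by simp
qed

section \<open>Covariances of linked tuples\<close>

text \<open>The difference form, rather than the centred form of \<open>covariance\<close>, because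
  its two parts are summed over tuples separately.\<close>

definition cov :: "((nat \<Rightarrow> real) \<Rightarrow> real) \<Rightarrow> ((nat \<Rightarrow> real) \<Rightarrow> real) \<Rightarrow> real" where
  "cov f f' = (LINT u|unif_seq. f u * f' u) - (LINT u|unif_seq. f u) * (LINT u|unif_seq. f' u)"

lemma cov_X_zero:
  assumes "\<And>a b. a \<in> {1..r} \<Longrightarrow> b \<in> {1..r} \<Longrightarrow> \<not> adj (i a) (j b)"
  shows "cov (X i) (X j) = 0"
proof -
  have "(\<Union>a\<in>{1..r}. sp (i a)) \<inter> (\<Union>b\<in>{1..r}. sp (j b)) = {}" using assms unfolding adj_def by blast
  then have "(LINT u|unif_seq. X i u * X j u) = (LINT u|unif_seq. X i u) * (LINT u|unif_seq. X j u)"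
    by (intro integral_indep[OF X_meas X_meas, of _ K _ K, OF _ _ X_depends X_depends]) (auto simp: X_bound)
  then show ?thesis by (simp add: cov_def)
qed

text \<open>\<open>freeze_others\<close> is applied twice: \<open>X j\<close> meets the labels of
  \<open>i\<close> only through entry \<open>a\<close>, so \<open>X i\<close> may be replaced by
  \<open>h i a\<close>; this function in turn meets the labels of \<open>j\<close> only through
  entry \<open>b\<close>.\<close>

lemma cov_X_single:
  assumes i: "\<not> intra i" and j: "\<not> intra j" and ab: "a \<in> {1..r}" "b \<in> {1..r}"
    and only: "\<And>c d. c \<in> {1..r} \<Longrightarrow> d \<in> {1..r} \<Longrightarrow> adj (i c) (j d) \<Longrightarrow> c = a \<and> d = b"
  shows "cov (X i) (X j) = cov (h i a) (h j b)"
proof -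
  have no: "sp (i c) \<inter> sp (j d) = {}" if "c \<in> {1..r}" "d \<in> {1..r}" "c \<noteq> a \<or> d \<noteq> b" for c d
    using only[OF that(1,2)] that(3) unfolding adj_def by blast
  have "(LINT u|unif_seq. X i u * X j u) = (LINT u|unif_seq. h i a u * X j u)"
    using no by (intro freeze_others[OF i ab(1) X_meas X_bound X_depends]) blast
  also have "\<dots> = (LINT u|unif_seq. X j u * h i a u)" by (simp add: mult.commute)
  also have "\<dots> = (LINT u|unif_seq. h j b u * h i a u)"
    using no ab by (intro freeze_others[OF j ab(2) h_meas h_bound h_depends]) auto
  finally show ?thesis
    using expectation_X[OF i ab(1)] expectation_X[OF j ab(2)] by (simp add: cov_def mult.commute)
qed

lemma cov_bound:
  assumes "\<And>u. \<bar>f u\<bar> \<le> K" "\<And>u. \<bar>f' u\<bar> \<le> K"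
  shows "\<bar>cov f f'\<bar> \<le> 2 * K\<^sup>2"
proof -
  have "\<bar>f u * f' u\<bar> \<le> K * K" for u
    unfolding abs_mult using assms K_nonneg by (intro mult_mono) auto
  then have "\<bar>LINT u|unif_seq. f u * f' u\<bar> \<le> K * K"
    using P.norm_integral_le_const[of "\<lambda>u. f u * f' u" "K * K"] by simp
  moreover have "\<bar>(LINT u|unif_seq. f u) * (LINT u|unif_seq. f' u)\<bar> \<le> K * K"
    unfolding abs_mult using assms K_nonneg P.norm_integral_le_const[of f K] P.norm_integral_le_const[of f' K]
    by (intro mult_mono) auto
  ultimately show ?thesis unfolding cov_def power2_eq_square by linarith
qed

section \<open>Averaging over tuples\<close>

text \<open>Fixed points contribute \<open>unif_diag\<close> and all others
  \<open>unif_square\<close>; the identity is exact because \<open>\<Lambda>\<close> uses the actual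
  fraction \<open>fixq\<close> and not its limit.\<close>

lemma avg_pt_law:
  assumes "bdd_meas borel f L"
  shows "(\<Sum>k\<in>{1..n}. LINT y|pt_law \<sigma> k. f y) = real (card {1..n}) * (LINT y|\<Lambda>. f y)"
proof -
  have f: "f \<in> borel_measurable borel" "\<And>z. \<bar>f z\<bar> \<le> L" using assms by (auto simp: bdd_meas_def)
  let ?F = "{k \<in> {1..n}. \<sigma> k = k}"
  have sub: "?F \<subseteq> {1..n}" by auto
  have c: "card ({1..n} - ?F) = n - card ?F" "card ?F \<le> n"
    using card_mono[OF finite_atLeastAtMost sub] card_Diff_subset[OF finite_subset[OF sub finite_atLeastAtMost] sub] by simp_all
  have "(\<Sum>k\<in>{1..n}. LINT y|pt_law \<sigma> k. f y) = (\<Sum>k\<in>{1..n} - ?F. LINT y|pt_law \<sigma> k. f y) + (\<Sum>k\<in>?F. LINT y|pt_law \<sigma> k. f y)"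
    by (rule sum.subset_diff) auto
  also have "(\<Sum>k\<in>{1..n} - ?F. LINT y|pt_law \<sigma> k. f y) = (\<Sum>k\<in>{1..n} - ?F. LINT y|unif_square. f y)"
    by (intro sum.cong) (auto simp: pt_law_def)
  also have "\<dots> = (real n - card ?F) * (LINT y|unif_square. f y)" using c by (simp add: of_nat_diff)
  also have "(\<Sum>k\<in>?F. LINT y|pt_law \<sigma> k. f y) = (\<Sum>k\<in>?F. LINT y|unif_diag. f y)"
    by (intro sum.cong) (auto simp: pt_law_def)
  also have "\<dots> = card ?F * (LINT y|unif_diag. f y)" by simp
  also have "(real n - card ?F) * (LINT y|unif_square. f y) + card ?F * (LINT y|unif_diag. f y)
    = real n * (fixq * (LINT y|unif_diag. f y) + (1 - fixq) * (LINT y|unif_square. f y))"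
    using n by (simp add: fixq_def field_simps)
  also have "fixq * (LINT y|unif_diag. f y) + (1 - fixq) * (LINT y|unif_square. f y) = (LINT y|\<Lambda>. f y)"
    unfolding \<Lambda>_def by (rule integral_point_law[OF f fixq, symmetric])
  finally show ?thesis by simp
qed

lemma prob_space_\<Lambda>: "prob_space \<Lambda>" and sets_\<Lambda>: "sets \<Lambda> = sets borel"
  by (auto simp: \<Lambda>_def prob_space_point_law)

lemma sum_PiM_pt_law:
  assumes "finite J" "bdd_meas (PiM J (\<lambda>_. borel)) F L"
  shows "(\<Sum>i\<in>PiE J (\<lambda>_. {1..n}). LINT z|PiM J (\<lambda>a. pt_law \<sigma> (i a)). F z) = real n ^ card J * (LINT z|PiM J (\<lambda>_. \<Lambda>). F z)"
  using sum_integral_PiM_tuples[OF prob_space_pt_law sets_pt_law prob_space_\<Lambda> sets_\<Lambda> _ avg_pt_law assms]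
  by simp

lemma sum_T_split:
  fixes f :: "_ \<Rightarrow> real"
  assumes a: "a \<in> {1..r}"
  shows "(\<Sum>i\<in>T. f i) = (\<Sum>k\<in>{1..n}. \<Sum>i\<in>PiE ({1..r} - {a}) (\<lambda>_. {1..n}). f (i(a := k)))"
proof -
  have e: "T = PiE (insert a ({1..r} - {a})) (\<lambda>_. {1..n})" using a unfolding T_def by (simp add: insert_absorb)
  show ?thesis
    unfolding e PiE_insert_eq using inj_combinator[of a "{1..r} - {a}" "\<lambda>_. {1..n}"]
    by (subst sum.reindex) (auto simp: case_prod_beta sum.cartesian_product)
qed

lemma G_upd_bdd_meas:
  assumes "a \<in> {1..r}"
  shows "bdd_meas (PiM ({1..r} - {a}) (\<lambda>_. borel)) (\<lambda>z. G (z(a := x))) K"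
proof -
  have "(\<lambda>z. (\<lambda>(f, y). f(a := y)) (z, x)) \<in> measurable (PiM ({1..r} - {a}) (\<lambda>_. borel)) (PiM (insert a ({1..r} - {a})) (\<lambda>_. borel))"
    by (intro measurable_compose[OF _ measurable_add_dim]) measurable
  moreover have "insert a ({1..r} - {a}) = {1..r}" using assms by blast
  ultimately have "(\<lambda>z. z(a := x)) \<in> measurable (PiM ({1..r} - {a}) (\<lambda>_. borel)) (PiM {1..r} (\<lambda>_. borel))" by simp
  from measurable_compose[OF this G_meas] show ?thesis by (simp add: bdd_meas_def G_bound)
qed

text \<open>The weight depends on entry \<open>a\<close> alone, so the sum over the other
  \<open>r - 1\<close> entries acts on the product law only and turns it into i.i.d. points of law
  \<open>\<Lambda>\<close>, whence the factor n^(r-1).\<close>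

lemma sum_T_h:
  assumes a: "a \<in> {1..r}"
  shows "(\<Sum>i\<in>T. w (i a) * h i a u) = real n ^ (r - 1) * (\<Sum>k\<in>{1..n}. w k * g a (graph_pt \<sigma> u k))"
proof -
  have "(\<Sum>i\<in>T. w (i a) * h i a u) = (\<Sum>k\<in>{1..n}. \<Sum>i\<in>PiE ({1..r} - {a}) (\<lambda>_. {1..n}). w k * h (i(a := k)) a u)"
    using sum_T_split[OF a, of "\<lambda>i. w (i a) * h i a u"] by simp
  also have "\<dots> = (\<Sum>k\<in>{1..n}. w k * (\<Sum>i\<in>PiE ({1..r} - {a}) (\<lambda>_. {1..n}). LINT z|PiM ({1..r} - {a}) (\<lambda>c. pt_law \<sigma> (i c)). G (z(a := graph_pt \<sigma> u k))))"
  proof (simp only: sum_distrib_left, intro sum.cong refl)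
    fix k i
    have "PiM ({1..r} - {a}) (\<lambda>c. pt_law \<sigma> ((i(a := k)) c)) = PiM ({1..r} - {a}) (\<lambda>c. pt_law \<sigma> (i c))"
      by (intro PiM_cong) auto
    then show "w k * h (i(a := k)) a u = w k * (LINT z|PiM ({1..r} - {a}) (\<lambda>c. pt_law \<sigma> (i c)). G (z(a := graph_pt \<sigma> u k)))"
      by (simp only: h_def fun_upd_same)
  qed
  also have "\<dots> = (\<Sum>k\<in>{1..n}. w k * (real n ^ (r - 1) * g a (graph_pt \<sigma> u k)))"
    using a by (subst sum_PiM_pt_law[OF _ G_upd_bdd_meas[OF a]]) (auto simp: g_def)
  finally show ?thesis by (simp add: sum_distrib_left mult_ac)
qed

lemma g_meas: "a \<in> {1..r} \<Longrightarrow> g a \<in> borel_measurable borel"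
proof -
  assume a: "a \<in> {1..r}"
  interpret Q: prob_space "PiM ({1..r} - {a}) (\<lambda>_. \<Lambda>)" by (intro prob_space_PiM prob_space_\<Lambda>)
  have sets: "sets (PiM ({1..r} - {a}) (\<lambda>_. \<Lambda>)) = sets (PiM ({1..r} - {a}) (\<lambda>_. borel))"
    by (intro sets_PiM_cong) (auto simp: sets_\<Lambda>)
  have "(\<lambda>w. (\<lambda>(f, y). f(a := y)) (snd w, fst w)) \<in> measurable (borel \<Otimes>\<^sub>M PiM ({1..r} - {a}) (\<lambda>_. borel)) (PiM (insert a ({1..r} - {a})) (\<lambda>_. borel))"
    by (intro measurable_compose[OF _ measurable_add_dim]) measurable
  moreover have "insert a ({1..r} - {a}) = {1..r}" using a by blast
  ultimately have "(\<lambda>w. (snd w)(a := fst w)) \<in> measurable (borel \<Otimes>\<^sub>M PiM ({1..r} - {a}) (\<lambda>_. borel)) (PiM {1..r} (\<lambda>_. borel))" by simp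
  from measurable_compose[OF this G_meas]
  have "case_prod (\<lambda>x z. G (z(a := x))) \<in> borel_measurable (borel \<Otimes>\<^sub>M PiM ({1..r} - {a}) (\<lambda>_. borel))"
    by (simp add: case_prod_beta')
  then have "case_prod (\<lambda>x z. G (z(a := x))) \<in> borel_measurable (borel \<Otimes>\<^sub>M PiM ({1..r} - {a}) (\<lambda>_. \<Lambda>))"
    by (simp only: measurable_cong_sets[OF sets_pair_measure_cong[OF refl sets] refl])
  from Q.borel_measurable_lebesgue_integral[OF this] show ?thesis unfolding g_def[abs_def] .
qed

lemma g_bound: "\<bar>g a x\<bar> \<le> K"
proof -
  interpret Q: prob_space "PiM ({1..r} - {a}) (\<lambda>_. \<Lambda>)" by (intro prob_space_PiM prob_space_\<Lambda>)
  show ?thesis unfolding g_def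
    using Q.norm_integral_le_const[of "\<lambda>z. G (z(a := x))" K] G_bound by simp
qed

text \<open>The transposition of \<open>a\<close> and \<open>r\<close> preserves \<open>G\<close> by
  symmetry and the law of the remaining i.i.d. points by reindexing. Argument \<open>r\<close> is
  the representative because \<open>\<psi>\<close> adds its point to the first r - 1.\<close>

lemma g_sym:
  assumes a: "a \<in> {1..r}" shows "g a = g r"
proof
  fix x
  let ?f = "Transposition.transpose a r"
  have fp: "?f permutes {1..r}" using a r by (intro permutes_swap_id) auto
  have f: "inj_on ?f ({1..r} - {a})" "?f \<in> {1..r} - {a} \<rightarrow> {1..r} - {r}"
  proof -
    show "inj_on ?f ({1..r} - {a})" by (rule permutes_inj_on[OF fp])
    have "?f m \<in> {1..r} - {r}" if "m \<in> {1..r} - {a}" for m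
    proof -
      have "?f m \<in> {1..r}" using permutes_in_image[OF fp, of m] that by blast
      moreover have "?f m \<noteq> ?f a" using injD[OF permutes_inj[OF fp], of m a] that by blast
      ultimately show ?thesis by simp
    qed
    then show "?f \<in> {1..r} - {a} \<rightarrow> {1..r} - {r}" by blast
  qed
  have d: "distr (PiM ({1..r} - {r}) (\<lambda>_. \<Lambda>)) (PiM ({1..r} - {a}) (\<lambda>_. \<Lambda>)) (\<lambda>\<omega>. \<lambda>m\<in>{1..r} - {a}. \<omega> (?f m)) = PiM ({1..r} - {a}) (\<lambda>_. \<Lambda>)"
    using distr_PiM_reindex[OF prob_space_\<Lambda> f] .
  have setsL: "sets (PiM L (\<lambda>_. \<Lambda>)) = sets (PiM L (\<lambda>_. borel))" for L :: "nat set"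
    by (intro sets_PiM_cong) (auto simp: sets_\<Lambda>)
  have Gm: "(\<lambda>z. G (z(a := x))) \<in> borel_measurable (PiM ({1..r} - {a}) (\<lambda>_. \<Lambda>))"
    using G_upd_bdd_meas[OF a, of x] by (simp add: bdd_meas_def measurable_cong_sets[OF setsL refl])
  have fm: "(\<lambda>\<omega>. \<lambda>m\<in>{1..r} - {a}. \<omega> (?f m)) \<in> measurable (PiM ({1..r} - {r}) (\<lambda>_. \<Lambda>)) (PiM ({1..r} - {a}) (\<lambda>_. \<Lambda>))"
    using f(2) by (intro measurable_restrict measurable_component_singleton) auto
  have "g a x = (LINT z|PiM ({1..r} - {r}) (\<lambda>_. \<Lambda>). G ((\<lambda>m\<in>{1..r} - {a}. z (?f m))(a := x)))"
    unfolding g_def by (subst d[symmetric], subst integral_distr[OF fm Gm]) simp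
  also have "\<dots> = (LINT z|PiM ({1..r} - {r}) (\<lambda>_. \<Lambda>). G (z(r := x)))"
  proof (rule Bochner_Integration.integral_cong[OF refl])
    fix z :: "nat \<Rightarrow> real \<times> real" assume "z \<in> space (PiM ({1..r} - {r}) (\<lambda>_. \<Lambda>))"
    \<comment> \<open>The two arguments of \<open>G\<close> are compared as functions, also off the
      index set, where both take the default value \<open>undefined\<close>.\<close>
    then have z: "z m = undefined" if "m \<notin> {1..r} - {r}" for m using that by (auto simp: space_PiM PiE_def extensional_def)
    have "(\<lambda>m\<in>{1..r} - {a}. z (?f m))(a := x) = (z(r := x)) \<circ> ?f"
    proof
      fix m
      consider "m = a" | "m \<in> {1..r} - {a}" | "m \<notin> {1..r}" by blast
      then show "((\<lambda>m\<in>{1..r} - {a}. z (?f m))(a := x)) m = ((z(r := x)) \<circ> ?f) m"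
      proof cases
        case 2
        then have "?f m \<noteq> r" using f(2) by auto
        then show ?thesis using 2 by simp
      next
        case 3
        then have "?f m = m" "m \<noteq> r" "m \<noteq> a" using permutes_not_in[OF fp 3] a r by auto
        then show ?thesis using 3 z[of m] by simp
      qed simp
    qed
    then show "G ((\<lambda>m\<in>{1..r} - {a}. z (?f m))(a := x)) = G (z(r := x))"
      using sym[OF fp, of "z(r := x)"] by simp
  qed
  finally show "g a x = g r x" by (simp add: g_def)
qed

end

context graph_kernel begin

interpretation P: prob_space unif_seq by (rule prob_space_unif_seq)

definition "gz k u = g r (graph_pt \<sigma> u k)"

lemma gz_meas [measurable]: "gz k \<in> borel_measurable unif_seq"
proof -
  have [measurable]: "g r \<in> borel_measurable borel" using r by (intro g_meas) auto
  show ?thesis unfolding gz_def[abs_def] by measurable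
qed

lemma gz_bound: "\<bar>gz k u\<bar> \<le> K"
  unfolding gz_def by (rule g_bound)

lemma integrable_bdd:
  fixes f :: "(nat \<Rightarrow> real) \<Rightarrow> real"
  shows "f \<in> borel_measurable unif_seq \<Longrightarrow> (\<And>u. \<bar>f u\<bar> \<le> L) \<Longrightarrow> integrable unif_seq f"
  by (rule P.integrable_const_bound[of _ L]) auto

lemma integrable_bdd_mult:
  fixes f f' :: "(nat \<Rightarrow> real) \<Rightarrow> real"
  assumes "f \<in> borel_measurable unif_seq" "\<And>u. \<bar>f u\<bar> \<le> K" "f' \<in> borel_measurable unif_seq" "\<And>u. \<bar>f' u\<bar> \<le> K"
  shows "integrable unif_seq (\<lambda>u. f u * f' u)"
proof (rule integrable_bdd)
  show "\<bar>f u * f' u\<bar> \<le> K * K" for u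
    unfolding abs_mult using assms K_nonneg by (intro mult_mono) auto
qed (use assms in measurable)

lemma sum_T_h': "a \<in> {1..r} \<Longrightarrow> (\<Sum>i\<in>T. w (i a) * h i a u) = real n ^ (r - 1) * (\<Sum>k\<in>{1..n}. w k * gz k u)"
  using sum_T_h[of a w u] g_sym[of a] by (simp add: gz_def)

lemma finite_T [simp]: "finite T"
  unfolding T_def by (intro finite_PiE) auto

lemma sum_T_expectation_h:
  assumes "a \<in> {1..r}"
  shows "(\<Sum>i\<in>T. w (i a) * (LINT u|unif_seq. h i a u)) = real n ^ (r - 1) * (\<Sum>k\<in>{1..n}. w k * (LINT u|unif_seq. gz k u))"
proof -
  have "(\<Sum>i\<in>T. w (i a) * (LINT u|unif_seq. h i a u)) = (LINT u|unif_seq. (\<Sum>i\<in>T. w (i a) * h i a u))"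
    using assms by (subst Bochner_Integration.integral_sum) (auto intro!: integrable_mult_right integrable_bdd[OF h_meas h_bound])
  also have "\<dots> = (LINT u|unif_seq. real n ^ (r - 1) * (\<Sum>k\<in>{1..n}. w k * gz k u))"
    using sum_T_h'[OF assms] by simp
  also have "\<dots> = real n ^ (r - 1) * (\<Sum>k\<in>{1..n}. w k * (LINT u|unif_seq. gz k u))"
    by (simp, subst Bochner_Integration.integral_sum) (auto intro!: integrable_mult_right integrable_bdd[OF gz_meas gz_bound])
  finally show ?thesis .
qed

text \<open>Both parts of \<open>cov\<close> are treated alike: \<open>sum_T_h'\<close>, or
  \<open>sum_T_expectation_h\<close> for the products of expectations, is applied to
  \<open>j\<close> with a weight depending on \<open>i a\<close>, then to \<open>i\<close>.
  Adjacency involves only the two linked entries and so survives as the weight of \<open>k\<close>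
  and \<open>l\<close>.\<close>

lemma sum_cov_h:
  assumes a: "a \<in> {1..r}" and b: "b \<in> {1..r}"
  shows "(\<Sum>i\<in>T. \<Sum>j\<in>T. of_bool (adj (i a) (j b)) * cov (h i a) (h j b))
    = real n ^ (2 * r - 2) * (\<Sum>k\<in>{1..n}. \<Sum>l\<in>{1..n}. of_bool (adj k l) * cov (gz k) (gz l))"
proof -
  let ?N = "real n ^ (r - 1)"
  define w :: "nat \<Rightarrow> nat \<Rightarrow> real" where "w k l = of_bool (adj k l)" for k l
  have N2: "?N * ?N = real n ^ (2 * r - 2)" 
  proof -
    have "(r - 1) + (r - 1) = 2 * r - 2" by simp
    then show ?thesis by (metis power_add)
  qed
  have ih: "integrable unif_seq (\<lambda>u. h i a u * h j b u)" for i j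
    using a b by (intro integrable_bdd_mult h_meas h_bound)
  have ig: "integrable unif_seq (\<lambda>u. gz k u * gz l u)" for k l
    by (intro integrable_bdd_mult gz_meas gz_bound)
  have "(\<Sum>i\<in>T. \<Sum>j\<in>T. w (i a) (j b) * (LINT u|unif_seq. h i a u * h j b u))
    = (LINT u|unif_seq. (\<Sum>i\<in>T. \<Sum>j\<in>T. w (i a) (j b) * (h i a u * h j b u)))"
    by (subst Bochner_Integration.integral_sum)
       (auto intro!: Bochner_Integration.integrable_sum integrable_mult_right ih sum.cong Bochner_Integration.integral_sum[symmetric]
         simp: Bochner_Integration.integral_sum[OF integrable_mult_right[OF ih]])
  also have "\<dots> = (LINT u|unif_seq. ?N * ?N * (\<Sum>k\<in>{1..n}. \<Sum>l\<in>{1..n}. w k l * (gz k u * gz l u)))"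
  proof (rule Bochner_Integration.integral_cong[OF refl])
    fix u
    have "(\<Sum>i\<in>T. \<Sum>j\<in>T. w (i a) (j b) * (h i a u * h j b u)) = (\<Sum>i\<in>T. h i a u * (\<Sum>j\<in>T. w (i a) (j b) * h j b u))"
      by (simp add: sum_distrib_left mult_ac)
    also have "\<dots> = (\<Sum>i\<in>T. (?N * (\<Sum>l\<in>{1..n}. w (i a) l * gz l u)) * h i a u)"
    proof (rule sum.cong[OF refl])
      fix i
      show "h i a u * (\<Sum>j\<in>T. w (i a) (j b) * h j b u) = (?N * (\<Sum>l\<in>{1..n}. w (i a) l * gz l u)) * h i a u"
        using sum_T_h'[OF b, of "w (i a)" u] by simp
    qed
    also have "\<dots> = ?N * (\<Sum>k\<in>{1..n}. (?N * (\<Sum>l\<in>{1..n}. w k l * gz l u)) * gz k u)"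
      by (rule sum_T_h'[OF a])
    also have "\<dots> = ?N * ?N * (\<Sum>k\<in>{1..n}. \<Sum>l\<in>{1..n}. w k l * (gz k u * gz l u))"
      by (simp add: sum_distrib_left sum_distrib_right mult_ac)
    finally show "(\<Sum>i\<in>T. \<Sum>j\<in>T. w (i a) (j b) * (h i a u * h j b u)) = ?N * ?N * (\<Sum>k\<in>{1..n}. \<Sum>l\<in>{1..n}. w k l * (gz k u * gz l u))" .
  qed
  also have "\<dots> = ?N * ?N * (\<Sum>k\<in>{1..n}. \<Sum>l\<in>{1..n}. w k l * (LINT u|unif_seq. gz k u * gz l u))"
  proof -
    have "(LINT u|unif_seq. (\<Sum>k\<in>{1..n}. \<Sum>l\<in>{1..n}. w k l * (gz k u * gz l u))) = (\<Sum>k\<in>{1..n}. LINT u|unif_seq. (\<Sum>l\<in>{1..n}. w k l * (gz k u * gz l u)))"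
      by (rule Bochner_Integration.integral_sum) (intro Bochner_Integration.integrable_sum integrable_mult_right ig)
    also have "\<dots> = (\<Sum>k\<in>{1..n}. \<Sum>l\<in>{1..n}. w k l * (LINT u|unif_seq. gz k u * gz l u))"
      by (intro sum.cong refl) (subst Bochner_Integration.integral_sum[OF integrable_mult_right[OF ig]], simp)
    finally show ?thesis by (simp only: integral_mult_right_zero)
  qed
  finally have 1: "(\<Sum>i\<in>T. \<Sum>j\<in>T. w (i a) (j b) * (LINT u|unif_seq. h i a u * h j b u))
    = ?N * ?N * (\<Sum>k\<in>{1..n}. \<Sum>l\<in>{1..n}. w k l * (LINT u|unif_seq. gz k u * gz l u))" .
  let ?e = "\<lambda>f. LINT u|unif_seq. f u"
  have "(\<Sum>i\<in>T. \<Sum>j\<in>T. w (i a) (j b) * (?e (h i a) * ?e (h j b))) = (\<Sum>i\<in>T. ?e (h i a) * (\<Sum>j\<in>T. w (i a) (j b) * ?e (h j b)))"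
    by (simp add: sum_distrib_left mult_ac)
  also have "\<dots> = (\<Sum>i\<in>T. (?N * (\<Sum>l\<in>{1..n}. w (i a) l * ?e (gz l))) * ?e (h i a))"
  proof (rule sum.cong[OF refl])
    fix i
    show "?e (h i a) * (\<Sum>j\<in>T. w (i a) (j b) * ?e (h j b)) = (?N * (\<Sum>l\<in>{1..n}. w (i a) l * ?e (gz l))) * ?e (h i a)"
      using sum_T_expectation_h[OF b, of "w (i a)"] by simp
  qed
  also have "\<dots> = ?N * (\<Sum>k\<in>{1..n}. (?N * (\<Sum>l\<in>{1..n}. w k l * ?e (gz l))) * ?e (gz k))"
    by (rule sum_T_expectation_h[OF a])
  also have "\<dots> = ?N * ?N * (\<Sum>k\<in>{1..n}. \<Sum>l\<in>{1..n}. w k l * (?e (gz k) * ?e (gz l)))"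
    by (simp add: sum_distrib_left sum_distrib_right mult_ac)
  finally have 2: "(\<Sum>i\<in>T. \<Sum>j\<in>T. w (i a) (j b) * (?e (h i a) * ?e (h j b)))
    = ?N * ?N * (\<Sum>k\<in>{1..n}. \<Sum>l\<in>{1..n}. w k l * (?e (gz k) * ?e (gz l)))" .
  show ?thesis
    unfolding w_def[symmetric] cov_def right_diff_distrib sum_subtractf 1 2 N2 ..
qed

section \<open>Counting tuples by their links\<close>

definition "nbr k = {l \<in> {1..n}. adj k l}"

text \<open>A label shared by \<open>{k, \<sigma> k}\<close> and \<open>{l, \<sigma> l}\<close>
  forces \<open>l\<close> to be \<open>k\<close>, its image or its preimage.\<close>

lemma nbr_card: "card (nbr k) \<le> 3"
proof -
  have "nbr k \<subseteq> {k, \<sigma> k, inv \<sigma> k}"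
    using permutes_inv_eq[OF \<sigma>] permutes_inj[OF \<sigma>] by (auto simp: nbr_def adj_def sp_def dest: injD)
  then have "card (nbr k) \<le> card {k, \<sigma> k, inv \<sigma> k}" by (intro card_mono) auto
  also have "\<dots> \<le> 3" by (simp add: card_insert_if)
  finally show ?thesis .
qed

lemma T_range: "i \<in> T \<Longrightarrow> a \<in> {1..r} \<Longrightarrow> i a \<in> {1..n}"
  by (auto simp: T_def)

lemma nbr_iff: "j \<in> T \<Longrightarrow> b \<in> {1..r} \<Longrightarrow> adj k (j b) \<longleftrightarrow> j b \<in> nbr k"
  using T_range[of j b] by (simp add: nbr_def)

lemma card_T: "card T = n ^ r"
  by (simp add: T_def card_PiE)

text \<open>The rule behind all counts below: confining one entry to a set of bounded size costs a
  factor n.\<close>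

lemma card_T_one:
  assumes b: "b \<in> {1..r}" and S: "S \<subseteq> {1..n}"
  shows "card {j \<in> T. j b \<in> S} \<le> card S * n ^ (r - 1)"
proof -
  have "{j \<in> T. j b \<in> S} \<subseteq> PiE {1..r} (\<lambda>c. if c = b then S else {1..n})"
    by (auto simp: T_def PiE_def)
  then have "card {j \<in> T. j b \<in> S} \<le> card (PiE {1..r} (\<lambda>c. if c = b then S else {1..n}))"
    using S by (intro card_mono finite_PiE) (auto intro: finite_subset)
  also have "\<dots> = (\<Prod>c\<in>{1..r}. if c = b then card S else n)"
    by (subst card_PiE) (auto intro!: prod.cong)
  also have "\<dots> = card S * (\<Prod>c\<in>{1..r} - {b}. n)"
    using b by (subst prod.remove[of _ b]) (auto intro!: prod.cong)
  finally show ?thesis using b by simp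
qed

lemma card_T_two:
  assumes b: "b \<in> {1..r}" "b' \<in> {1..r}" "b \<noteq> b'" and S: "S \<subseteq> {1..n}" "S' \<subseteq> {1..n}"
  shows "card {j \<in> T. j b \<in> S \<and> j b' \<in> S'} \<le> card S * card S' * n ^ (r - 2)"
proof -
  let ?A = "\<lambda>c. if c = b then S else if c = b' then S' else {1..n}"
  have "{j \<in> T. j b \<in> S \<and> j b' \<in> S'} \<subseteq> PiE {1..r} ?A"
    by (auto simp: T_def PiE_def)
  then have "card {j \<in> T. j b \<in> S \<and> j b' \<in> S'} \<le> card (PiE {1..r} ?A)"
    using S by (intro card_mono finite_PiE) (auto intro: finite_subset)
  also have "\<dots> = (\<Prod>c\<in>{1..r}. if c = b then card S else if c = b' then card S' else n)"
    by (subst card_PiE) (auto intro!: prod.cong)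
  also have "\<dots> = card S * (card S' * (\<Prod>c\<in>{1..r} - {b} - {b'}. n))"
    using b by (subst prod.remove[of _ b], simp, simp, subst prod.remove[of _ b']) (auto intro!: prod.cong)
  also have "card ({1..r} - {b} - {b'}) = r - 2" using b by (simp add: card_Diff_subset)
  then have "(\<Prod>c\<in>{1..r} - {b} - {b'}. n) = n ^ (r - 2)" by simp
  finally show ?thesis by simp
qed

lemma nbr_sub: "nbr k \<subseteq> {1..n}" by (auto simp: nbr_def)

lemma card_adj_one: "b \<in> {1..r} \<Longrightarrow> card {j \<in> T. adj k (j b)} \<le> 3 * n ^ (r - 1)"
proof -
  assume b: "b \<in> {1..r}"
  have "{j \<in> T. adj k (j b)} = {j \<in> T. j b \<in> nbr k}" using nbr_iff[OF _ b] by blast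
  then have "card {j \<in> T. adj k (j b)} \<le> card (nbr k) * n ^ (r - 1)" using card_T_one[OF b nbr_sub] by simp
  also have "\<dots> \<le> 3 * n ^ (r - 1)" by (intro mult_right_mono nbr_card) auto
  finally show ?thesis .
qed

lemma card_adj_two:
  assumes b: "b \<in> {1..r}" "b' \<in> {1..r}" "b \<noteq> b'"
  shows "card {j \<in> T. adj k (j b) \<and> adj k' (j b')} \<le> 9 * n ^ (r - 2)"
proof -
  have "{j \<in> T. adj k (j b) \<and> adj k' (j b')} = {j \<in> T. j b \<in> nbr k \<and> j b' \<in> nbr k'}"
    using nbr_iff[OF _ b(1)] nbr_iff[OF _ b(2)] by blast
  then have "card {j \<in> T. adj k (j b) \<and> adj k' (j b')} \<le> card (nbr k) * card (nbr k') * n ^ (r - 2)"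
    using card_T_two[OF b nbr_sub nbr_sub] by simp
  also have "\<dots> \<le> (3 * 3) * n ^ (r - 2)" by (intro mult_right_mono mult_mono nbr_card) auto
  finally show ?thesis by simp
qed

lemma n_power: "r \<ge> 2 \<Longrightarrow> n * n ^ (r - 2) = n ^ (r - 1)"
  by (cases r) (auto simp: power_Suc[symmetric] Suc_diff_Suc numeral_2_eq_2 simp del: power_Suc)

text \<open>There are at most r^2 pairs of positions; the value at the first is free, the second has
  at most 3 values, the other r - 2 entries are free. Such tuples form a fraction O(1/n) of
  all.\<close>

lemma card_intra: "card {i \<in> T. intra i} \<le> 3 * r\<^sup>2 * n ^ (r - 1)"
proof -
  let ?I = "{(a, b). a \<in> {1..r} \<and> b \<in> {1..r} \<and> a \<noteq> b}"
  have fI: "finite ?I" "card ?I \<le> r\<^sup>2"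
  proof -
    have "?I \<subseteq> {1..r} \<times> {1..r}" by auto
    from card_mono[OF _ this] finite_subset[OF this] show "finite ?I" "card ?I \<le> r\<^sup>2" by (auto simp: power2_eq_square)
  qed
  have one: "card {i \<in> T. adj (i a) (i b)} \<le> 3 * n ^ (r - 1)" if ab: "a \<in> {1..r}" "b \<in> {1..r}" "a \<noteq> b" for a b
  proof -
    have "{i \<in> T. adj (i a) (i b)} \<subseteq> (\<Union>k\<in>{1..n}. {i \<in> T. i a \<in> {k} \<and> i b \<in> nbr k})"
      using nbr_iff[OF _ ab(2)] T_range[OF _ ab(1)] by auto
    then have "card {i \<in> T. adj (i a) (i b)} \<le> card (\<Union>k\<in>{1..n}. {i \<in> T. i a \<in> {k} \<and> i b \<in> nbr k})"
      by (intro card_mono) auto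
    also have "\<dots> \<le> (\<Sum>k\<in>{1..n}. card {i \<in> T. i a \<in> {k} \<and> i b \<in> nbr k})" by (rule card_UN_le) simp
    also have "\<dots> \<le> (\<Sum>k\<in>{1..n}. 3 * n ^ (r - 2))"
    proof (rule sum_mono)
      fix k assume "k \<in> {1..n}"
      then have "card {i \<in> T. i a \<in> {k} \<and> i b \<in> nbr k} \<le> card {k} * card (nbr k) * n ^ (r - 2)"
        by (intro card_T_two ab nbr_sub) auto
      also have "\<dots> \<le> 3 * n ^ (r - 2)" using nbr_card[of k] by simp
      finally show "card {i \<in> T. i a \<in> {k} \<and> i b \<in> nbr k} \<le> 3 * n ^ (r - 2)" .
    qed
    also have "\<dots> = 3 * n ^ (r - 1)" using ab n_power by simp
    finally show ?thesis .
  qed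
  have "{i \<in> T. intra i} \<subseteq> (\<Union>(a, b)\<in>?I. {i \<in> T. adj (i a) (i b)})" unfolding intra_def by blast
  then have "card {i \<in> T. intra i} \<le> card (\<Union>(a, b)\<in>?I. {i \<in> T. adj (i a) (i b)})"
    using fI by (intro card_mono) auto
  also have "\<dots> \<le> (\<Sum>(a, b)\<in>?I. card {i \<in> T. adj (i a) (i b)})" using card_UN_le[OF fI(1), of "\<lambda>(a, b). {i \<in> T. adj (i a) (i b)}"] by (simp add: case_prod_beta)
  also have "\<dots> \<le> (\<Sum>(a, b)\<in>?I. 3 * n ^ (r - 1))" using one by (intro sum_mono) auto
  also have "\<dots> = card ?I * (3 * n ^ (r - 1))" by (simp add: case_prod_beta)
  also have "\<dots> \<le> r\<^sup>2 * (3 * n ^ (r - 1))" by (intro mult_right_mono fI) auto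
  finally show ?thesis by (simp add: mult_ac)
qed

definition "cross i j \<longleftrightarrow> (\<exists>a\<in>{1..r}. \<exists>b\<in>{1..r}. adj (i a) (j b))"

text \<open>At most r^2 pairs of positions, and for each of them one entry of \<open>j\<close> has
  at most 3 values. This becomes the degree of the dependency graph.\<close>

lemma card_cross: "card {j \<in> T. cross i j} \<le> 3 * r\<^sup>2 * n ^ (r - 1)"
proof -
  have "{j \<in> T. cross i j} \<subseteq> (\<Union>(a, b)\<in>{1..r} \<times> {1..r}. {j \<in> T. adj (i a) (j b)})" unfolding cross_def by blast
  then have "card {j \<in> T. cross i j} \<le> card (\<Union>(a, b)\<in>{1..r} \<times> {1..r}. {j \<in> T. adj (i a) (j b)})"
    by (intro card_mono) auto
  also have "\<dots> \<le> (\<Sum>(a, b)\<in>{1..r} \<times> {1..r}. card {j \<in> T. adj (i a) (j b)})"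
    using card_UN_le[of "{1..r} \<times> {1..r}" "\<lambda>(a, b). {j \<in> T. adj (i a) (j b)}"] by (simp add: case_prod_beta)
  also have "\<dots> \<le> (\<Sum>(a, b)\<in>{1..r} \<times> {1..r}. 3 * n ^ (r - 1))" by (intro sum_mono) (simp only: case_prod_beta mem_Times_iff card_adj_one)
  also have "\<dots> = 3 * r\<^sup>2 * n ^ (r - 1)" by (simp add: case_prod_beta power2_eq_square)
  finally show ?thesis .
qed

end

context graph_kernel begin

interpretation P: prob_space unif_seq by (rule prob_space_unif_seq)

text \<open>Only the pairs of positions have to differ, so two links may share an entry on one side;
  a second link still costs another factor n.\<close>

definition "twice i j \<longleftrightarrow> (\<exists>a\<in>{1..r}. \<exists>b\<in>{1..r}. \<exists>a'\<in>{1..r}. \<exists>b'\<in>{1..r}.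
  (a, b) \<noteq> (a', b') \<and> adj (i a) (j b) \<and> adj (i a') (j b'))"

lemma card_pairs_le:
  fixes R :: "(nat \<Rightarrow> nat) \<Rightarrow> (nat \<Rightarrow> nat) \<Rightarrow> bool"
  assumes "A \<subseteq> T" "\<And>i. i \<in> A \<Longrightarrow> card {j \<in> T. R i j} \<le> m"
  shows "card {(i, j) \<in> A \<times> T. R i j} \<le> card A * m"
proof -
  have fA: "finite A" using assms(1) finite_T finite_subset by blast
  have "{(i, j) \<in> A \<times> T. R i j} = (SIGMA i:A. {j \<in> T. R i j})" by auto
  then have "card {(i, j) \<in> A \<times> T. R i j} = (\<Sum>i\<in>A. card {j \<in> T. R i j})"
    using fA by simp
  also have "\<dots> \<le> (\<Sum>i\<in>A. m)" using assms by (intro sum_mono) auto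
  finally show ?thesis by simp
qed

lemma card_pairs_swap: "card {(i, j) \<in> A \<times> B. R i j} = card {(j, i) \<in> B \<times> A. R i j}"
proof -
  have "{(j, i) \<in> B \<times> A. R i j} = prod.swap ` {(i, j) \<in> A \<times> B. R i j}" by auto
  then show ?thesis by (simp add: card_image)
qed

lemma power_split: "r \<ge> 2 \<Longrightarrow> n ^ r * n ^ (r - 2) = n ^ (2 * r - 2)" "n ^ (r - 1) * n ^ (r - 1) = n ^ (2 * r - 2)"
proof -
  assume "r \<ge> 2"
  then have "r + (r - 2) = 2 * r - 2" by simp
  then show "n ^ r * n ^ (r - 2) = n ^ (2 * r - 2)" by (metis power_add)
next
  have "(r - 1) + (r - 1) = 2 * r - 2" by simp
  then show "n ^ (r - 1) * n ^ (r - 1) = n ^ (2 * r - 2)" by (metis power_add)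
qed

text \<open>If the links end at different entries of \<open>j\<close>, two entries of
  \<open>j\<close> are confined once \<open>i\<close> is known; otherwise they start at different
  entries of \<open>i\<close> and the roles are exchanged. Either way at most 9 = 3 * 3 choices
  remain for the two confined entries.\<close>

lemma card_twice: "card {(i, j) \<in> T \<times> T. twice i j} \<le> 9 * r ^ 4 * n ^ (2 * r - 2)"
proof -
  let ?R = "{1..r}"
  let ?I = "{(a, b, a', b'). a \<in> ?R \<and> b \<in> ?R \<and> a' \<in> ?R \<and> b' \<in> ?R \<and> (a, b) \<noteq> (a', b')}"
  let ?S = "\<lambda>(a, b, a', b'). {(i, j) \<in> T \<times> T. adj (i a) (j b) \<and> adj (i a') (j b')}"
  have sub: "?I \<subseteq> ?R \<times> ?R \<times> ?R \<times> ?R" by auto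
  have fI: "finite ?I" by (rule finite_subset[OF sub]) auto
  have cI: "card ?I \<le> r ^ 4"
    using card_mono[OF _ sub] by (simp add: card_cartesian_product power4_eq_xxxx mult_ac)
  have one: "card (?S x) \<le> 9 * n ^ (2 * r - 2)" if "x \<in> ?I" for x
  proof -
    obtain a b a' b' where x: "x = (a, b, a', b')" "a \<in> ?R" "b \<in> ?R" "a' \<in> ?R" "b' \<in> ?R" "(a, b) \<noteq> (a', b')"
      using \<open>x \<in> ?I\<close> by auto
    show ?thesis
    proof (cases "b = b'")
      case False
      then have r2: "r \<ge> 2" using x by auto
      have "card {(i, j) \<in> T \<times> T. adj (i a) (j b) \<and> adj (i a') (j b')} \<le> card T * (9 * n ^ (r - 2))"
        using False x by (intro card_pairs_le card_adj_two) auto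
      then show ?thesis using power_split(1)[OF r2] x(1) by (simp add: card_T mult_ac)
    next
      case True
      then have aa: "a \<noteq> a'" using x by auto
      then have r2: "r \<ge> 2" using x by auto
      have "card {(i, j) \<in> T \<times> T. adj (i a) (j b) \<and> adj (i a') (j b')} = card {(j, i) \<in> T \<times> T. adj (j b) (i a) \<and> adj (j b') (i a')}"
        using card_pairs_swap[of T T "\<lambda>i j. adj (i a) (j b) \<and> adj (i a') (j b')"] by (simp add: adj_sym)
      also have "\<dots> \<le> card T * (9 * n ^ (r - 2))"
        using aa x by (intro card_pairs_le card_adj_two) auto
      finally show ?thesis using power_split(1)[OF r2] x(1) by (simp add: card_T mult_ac)
    qed
  qed
  have "{(i, j) \<in> T \<times> T. twice i j} \<subseteq> (\<Union>x\<in>?I. ?S x)"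
  proof clarify
    fix i j assume ij: "i \<in> T" "j \<in> T" "twice i j"
    then obtain a b a' b' where "a \<in> ?R" "b \<in> ?R" "a' \<in> ?R" "b' \<in> ?R" "(a, b) \<noteq> (a', b')" "adj (i a) (j b)" "adj (i a') (j b')"
      unfolding twice_def by blast
    then show "(i, j) \<in> (\<Union>x\<in>?I. ?S x)" using ij by (intro UN_I[of "(a, b, a', b')"]) auto
  qed
  moreover have "finite (\<Union>x\<in>?I. ?S x)"
    by (rule finite_subset[of _ "T \<times> T"]) auto
  ultimately have "card {(i, j) \<in> T \<times> T. twice i j} \<le> card (\<Union>x\<in>?I. ?S x)"
    by (rule card_mono[rotated])
  also have "\<dots> \<le> (\<Sum>x\<in>?I. card (?S x))" by (rule card_UN_le[OF fI])
  also have "\<dots> \<le> (\<Sum>x\<in>?I. 9 * n ^ (2 * r - 2))" by (rule sum_mono[OF one])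
  also have "\<dots> = card ?I * (9 * n ^ (2 * r - 2))" by (simp only: sum_constant of_nat_id)
  also have "\<dots> \<le> r ^ 4 * (9 * n ^ (2 * r - 2))" using cI by (intro mult_right_mono) auto
  finally show ?thesis by (simp add: mult_ac)
qed

lemma cross_sym: "cross i j \<longleftrightarrow> cross j i"
  unfolding cross_def using adj_sym by blast

text \<open>There are O(n^(r-1)) tuples with an internal link, and each is linked to O(n^(r-1))
  tuples.\<close>

lemma card_intra_cross:
  "card {(i, j) \<in> T \<times> T. intra i \<and> cross i j} \<le> 9 * r ^ 4 * n ^ (2 * r - 2)"
  "card {(i, j) \<in> T \<times> T. intra j \<and> cross i j} \<le> 9 * r ^ 4 * n ^ (2 * r - 2)"
proof -
  show *: "card {(i, j) \<in> T \<times> T. intra i \<and> cross i j} \<le> 9 * r ^ 4 * n ^ (2 * r - 2)"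
  proof -
    have "{(i, j) \<in> T \<times> T. intra i \<and> cross i j} = {(i, j) \<in> {i \<in> T. intra i} \<times> T. cross i j}" by auto
    then have "card {(i, j) \<in> T \<times> T. intra i \<and> cross i j} \<le> card {i \<in> T. intra i} * (3 * r\<^sup>2 * n ^ (r - 1))"
      using card_pairs_le[of "{i \<in> T. intra i}" cross] card_cross by auto
    also have "\<dots> \<le> (3 * r\<^sup>2 * n ^ (r - 1)) * (3 * r\<^sup>2 * n ^ (r - 1))"
      by (intro mult_right_mono card_intra) auto
    also have "\<dots> = 9 * (r\<^sup>2 * r\<^sup>2) * (n ^ (r - 1) * n ^ (r - 1))" by (simp add: mult_ac)
    also have "r\<^sup>2 * r\<^sup>2 = r ^ 4" by (simp add: power_add[symmetric])
    finally show ?thesis by (simp only: power_split)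
  qed
  have "card {(i, j) \<in> T \<times> T. intra j \<and> cross i j} = card {(j, i) \<in> T \<times> T. intra j \<and> cross j i}"
    using card_pairs_swap[of T T "\<lambda>i j. intra j \<and> cross i j"] by (simp add: cross_sym)
  then show "card {(i, j) \<in> T \<times> T. intra j \<and> cross i j} \<le> 9 * r ^ 4 * n ^ (2 * r - 2)" using * by simp
qed

text \<open>The pairs for which the reduction to a single link can fail. A pair with internal links
  but no link across is not among them, since its covariance vanishes by independence.\<close>

definition "bad i j \<longleftrightarrow> intra i \<and> cross i j \<or> intra j \<and> cross i j \<or> twice i j"

lemma card_bad: "card {(i, j) \<in> T \<times> T. bad i j} \<le> 27 * r ^ 4 * n ^ (2 * r - 2)"
proof -
  have "{(i, j) \<in> T \<times> T. bad i j} = {(i, j) \<in> T \<times> T. intra i \<and> cross i j} \<union> {(i, j) \<in> T \<times> T. intra j \<and> cross i j} \<union> {(i, j) \<in> T \<times> T. twice i j}"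
    unfolding bad_def by auto
  then have "card {(i, j) \<in> T \<times> T. bad i j} \<le> card {(i, j) \<in> T \<times> T. intra i \<and> cross i j} + card {(i, j) \<in> T \<times> T. intra j \<and> cross i j} + card {(i, j) \<in> T \<times> T. twice i j}"
    by (metis (no_types, lifting) card_Un_le add_le_mono1 order_trans)
  then show ?thesis using card_intra_cross card_twice by linarith
qed

text \<open>At most one term is nonzero unless the pair is linked twice; summing over all positions
  for every pair keeps the total over \<open>T\<close> within reach of
  \<open>sum_cov_h\<close>.\<close>

definition "single_cov i j = (\<Sum>a\<in>{1..r}. \<Sum>b\<in>{1..r}. of_bool (adj (i a) (j b)) * cov (h i a) (h j b))"

lemma cov_X_not_bad:
  assumes "\<not> bad i j" shows "cov (X i) (X j) = single_cov i j"
proof (cases "cross i j")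
  case False
  then show ?thesis using cov_X_zero[of i j] by (simp add: cross_def single_cov_def)
next
  case True
  then obtain a b where ab: "a \<in> {1..r}" "b \<in> {1..r}" "adj (i a) (j b)" unfolding cross_def by blast
  have only: "c = a \<and> d = b" if "c \<in> {1..r}" "d \<in> {1..r}" "adj (i c) (j d)" for c d
  proof (rule ccontr)
    assume "\<not> (c = a \<and> d = b)"
    then have "twice i j"
      unfolding twice_def using ab that
      by (intro bexI[of _ a] bexI[of _ b] bexI[of _ c] bexI[of _ d]) auto
    then show False using assms by (simp add: bad_def)
  qed
  have "single_cov i j = (\<Sum>c\<in>{1..r}. \<Sum>d\<in>{1..r}. if c = a \<and> d = b then cov (h i a) (h j b) else 0)"
    unfolding single_cov_def
  proof (intro sum.cong refl)
    fix c d assume cd: "c \<in> {1..r}" "d \<in> {1..r}"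
    show "of_bool (adj (i c) (j d)) * cov (h i c) (h j d) = (if c = a \<and> d = b then cov (h i a) (h j b) else 0)"
    proof (cases "c = a \<and> d = b")
      case False
      then have "\<not> adj (i c) (j d)" using only[OF cd] by blast
      then show ?thesis using False by auto
    qed (use ab in simp)
  qed
  also have "\<dots> = (\<Sum>c\<in>{1..r}. if c = a then \<Sum>d\<in>{1..r}. if d = b then cov (h i a) (h j b) else 0 else 0)"
    by (intro sum.cong refl) auto
  also have "\<dots> = cov (h i a) (h j b)" using ab by (simp add: sum.delta)
  finally show ?thesis
    using assms True cov_X_single[of i j a b, OF _ _ ab(1,2) only] by (simp add: bad_def)
qed

lemma abs_cov_X_diff: "\<bar>cov (X i) (X j) - single_cov i j\<bar> \<le> 2 * K\<^sup>2 * (1 + r\<^sup>2)"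
proof -
  have "\<bar>single_cov i j\<bar> \<le> (\<Sum>a\<in>{1..r}. \<Sum>b\<in>{1..r}. 2 * K\<^sup>2)"
    unfolding single_cov_def
  proof (intro order_trans[OF sum_abs] sum_mono)
    fix a b
    have "\<bar>of_bool (adj (i a) (j b)) * cov (h i a) (h j b)\<bar> \<le> \<bar>cov (h i a) (h j b)\<bar>" by (auto simp: of_bool_def)
    also have "\<dots> \<le> 2 * K\<^sup>2" by (rule cov_bound) (rule h_bound)+
    finally show "\<bar>of_bool (adj (i a) (j b)) * cov (h i a) (h j b)\<bar> \<le> 2 * K\<^sup>2" .
  qed
  moreover have "\<bar>cov (X i) (X j)\<bar> \<le> 2 * K\<^sup>2" by (rule cov_bound) (rule X_bound)+
  ultimately show ?thesis by (simp add: power2_eq_square algebra_simps)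
qed

text \<open>Only bad pairs contribute to the difference. There are at most 27 r^4 n^(2r-2) of them,
  each contributing at most 2 K^2 (1 + r^2); this gives the constant 54 and an error one order in n
  below the scale n^(2r-1) of the variance.\<close>

lemma sum_cov_X:
  "\<bar>(\<Sum>i\<in>T. \<Sum>j\<in>T. cov (X i) (X j)) - (real r)\<^sup>2 * real n ^ (2 * r - 2) * (\<Sum>k\<in>{1..n}. \<Sum>l\<in>{1..n}. of_bool (adj k l) * cov (gz k) (gz l))\<bar>
    \<le> 54 * real r ^ 4 * (1 + (real r)\<^sup>2) * K\<^sup>2 * real n ^ (2 * r - 2)"
proof -
  let ?c = "\<lambda>i j a b. of_bool (adj (i a) (j b)) * cov (h i a) (h j b)"
  have "(\<Sum>i\<in>T. \<Sum>j\<in>T. single_cov i j) = (\<Sum>i\<in>T. \<Sum>a\<in>{1..r}. \<Sum>j\<in>T. \<Sum>b\<in>{1..r}. ?c i j a b)"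
    unfolding single_cov_def by (intro sum.cong refl sum.swap)
  also have "\<dots> = (\<Sum>a\<in>{1..r}. \<Sum>i\<in>T. \<Sum>j\<in>T. \<Sum>b\<in>{1..r}. ?c i j a b)"
    by (rule sum.swap)
  also have "\<dots> = (\<Sum>a\<in>{1..r}. \<Sum>i\<in>T. \<Sum>b\<in>{1..r}. \<Sum>j\<in>T. ?c i j a b)"
    by (intro sum.cong refl sum.swap)
  also have "\<dots> = (\<Sum>a\<in>{1..r}. \<Sum>b\<in>{1..r}. \<Sum>i\<in>T. \<Sum>j\<in>T. ?c i j a b)"
    by (intro sum.cong refl sum.swap)
  also have "\<dots> = (\<Sum>a\<in>{1..r}. \<Sum>b\<in>{1..r}. real n ^ (2 * r - 2) * (\<Sum>k\<in>{1..n}. \<Sum>l\<in>{1..n}. of_bool (adj k l) * cov (gz k) (gz l)))"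
    by (intro sum.cong refl sum_cov_h)
  finally have s: "(\<Sum>i\<in>T. \<Sum>j\<in>T. single_cov i j) = (real r)\<^sup>2 * real n ^ (2 * r - 2) * (\<Sum>k\<in>{1..n}. \<Sum>l\<in>{1..n}. of_bool (adj k l) * cov (gz k) (gz l))"
    by (simp add: power2_eq_square)
  let ?B = "{(i, j) \<in> T \<times> T. bad i j}"
  let ?f = "\<lambda>(i, j). cov (X i) (X j) - single_cov i j"
  have "(\<Sum>i\<in>T. \<Sum>j\<in>T. cov (X i) (X j)) - (\<Sum>i\<in>T. \<Sum>j\<in>T. single_cov i j) = (\<Sum>x\<in>T \<times> T. ?f x)"
    by (simp add: sum_subtractf[symmetric] sum.cartesian_product)
  also have "\<dots> = (\<Sum>x\<in>?B. ?f x)"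
  proof (intro sum.mono_neutral_right ballI)
    fix x assume "x \<in> T \<times> T - ?B"
    then obtain i j where "x = (i, j)" "\<not> bad i j" by (cases x) auto
    then show "?f x = 0" using cov_X_not_bad by simp
  qed auto
  finally have e: "(\<Sum>i\<in>T. \<Sum>j\<in>T. cov (X i) (X j)) - (\<Sum>i\<in>T. \<Sum>j\<in>T. single_cov i j) = (\<Sum>x\<in>?B. ?f x)" .
  have "\<bar>\<Sum>x\<in>?B. ?f x\<bar> \<le> (\<Sum>x\<in>?B. \<bar>?f x\<bar>)" by (rule sum_abs)
  also have "\<dots> \<le> real (card ?B) * (2 * K\<^sup>2 * (1 + r\<^sup>2))"
    by (rule sum_bounded_above) (use abs_cov_X_diff in auto)
  also have "\<dots> \<le> real (27 * r ^ 4 * n ^ (2 * r - 2)) * (2 * K\<^sup>2 * (1 + r\<^sup>2))"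
  proof -
    have "real (card ?B) \<le> real (27 * r ^ 4 * n ^ (2 * r - 2))" by (rule of_nat_mono[OF card_bad])
    moreover have "0 \<le> 2 * K\<^sup>2 * real (1 + r\<^sup>2)" by simp
    ultimately show ?thesis by (rule mult_right_mono)
  qed
  also have "\<dots> = 54 * real r ^ 4 * (1 + (real r)\<^sup>2) * K\<^sup>2 * real n ^ (2 * r - 2)" by simp
  finally show ?thesis unfolding s[symmetric] e .
qed

text \<open>Without internal links the points of a tuple are independent and the expectation is
  exact; each of the at most 3 r^2 n^(r-1) other tuples is off by at most 2K.\<close>

lemma sum_expectation_X:
  "\<bar>(\<Sum>i\<in>T. LINT u|unif_seq. X i u) - real n ^ r * (LINT z|PiM {1..r} (\<lambda>_. \<Lambda>). G z)\<bar> \<le> 6 * (real r)\<^sup>2 * K * real n ^ (r - 1)"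
proof -
  let ?m = "\<lambda>i. LINT z|PiM {1..r} (\<lambda>c. pt_law \<sigma> (i c)). G z"
  have s: "real n ^ r * (LINT z|PiM {1..r} (\<lambda>_. \<Lambda>). G z) = (\<Sum>i\<in>T. ?m i)"
    unfolding T_def using sum_PiM_pt_law[of "{1..r}" G K] G by simp
  let ?B = "{i \<in> T. intra i}" and ?f = "\<lambda>i. (LINT u|unif_seq. X i u) - ?m i"
  have "(\<Sum>i\<in>T. LINT u|unif_seq. X i u) - (\<Sum>i\<in>T. ?m i) = (\<Sum>i\<in>T. ?f i)"
    by (simp add: sum_subtractf)
  also have "\<dots> = (\<Sum>i\<in>?B. ?f i)"
    using expectation_X_PiM by (intro sum.mono_neutral_right) auto
  finally have e: "(\<Sum>i\<in>T. LINT u|unif_seq. X i u) - (\<Sum>i\<in>T. ?m i) = (\<Sum>i\<in>?B. ?f i)" .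
  have "\<bar>\<Sum>i\<in>?B. ?f i\<bar> \<le> (\<Sum>i\<in>?B. \<bar>?f i\<bar>)" by (rule sum_abs)
  also have "\<dots> \<le> real (card ?B) * (2 * K)"
  proof (rule sum_bounded_above)
    fix i
    interpret Q: prob_space "PiM {1..r} (\<lambda>c. pt_law \<sigma> (i c))" by (intro prob_space_PiM prob_space_pt_law)
    have "\<bar>LINT u|unif_seq. X i u\<bar> \<le> K" "\<bar>?m i\<bar> \<le> K"
      using P.norm_integral_le_const[of "X i" K] Q.norm_integral_le_const[of G K] X_bound G_bound by auto
    then show "\<bar>?f i\<bar> \<le> 2 * K" by linarith
  qed
  also have "\<dots> \<le> real (3 * r\<^sup>2 * n ^ (r - 1)) * (2 * K)"
  proof -
    have "real (card ?B) \<le> real (3 * r\<^sup>2 * n ^ (r - 1))" by (rule of_nat_mono[OF card_intra])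
    moreover have "0 \<le> 2 * K" using K_nonneg by simp
    ultimately show ?thesis by (rule mult_right_mono)
  qed
  also have "\<dots> = 6 * (real r)\<^sup>2 * K * real n ^ (r - 1)" by simp
  finally show ?thesis unfolding s e .
qed

text \<open>The r! accounts for the enumerations of an r-subset; the powers of n multiply to n^(r -
  1/2).\<close>

definition "Z i u = (X i u - (LINT u|unif_seq. X i u)) / (fact r * (real n ^ (r - 1) * sqrt (real n)))"

text \<open>A vertex of the dependency graph is a whole tuple; supports meet exactly when the tuples
  are linked, so \<open>card_cross\<close> is the degree bound.\<close>

sublocale dn: dependency_nbhd T Z "\<lambda>i. \<Union>a\<in>{1..r}. sp (i a)" "2 * K / (fact r * (real n ^ (r - 1) * sqrt (real n)))" "3 * r\<^sup>2 * n ^ (r - 1)"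
proof
  show "finite T" by simp
  fix i assume i: "i \<in> T"
  have pos: "0 < fact r * (real n ^ (r - 1) * sqrt (real n))" using n by simp
  show "Z i \<in> borel_measurable unif_seq" unfolding Z_def[abs_def] by measurable
  show "\<bar>Z i u\<bar> \<le> 2 * K / (fact r * (real n ^ (r - 1) * sqrt (real n)))" for u
  proof -
    have "\<bar>X i u - (LINT u|unif_seq. X i u)\<bar> \<le> 2 * K"
      using X_bound[of i u] P.norm_integral_le_const[of "X i" K] X_bound by (simp add: abs_le_iff) (smt (verit))
    then show ?thesis unfolding Z_def abs_divide using pos by (simp add: divide_right_mono)
  qed
  have "(LINT u|unif_seq. X i u - (LINT u|unif_seq. X i u)) = 0"
    using integrable_bdd[OF X_meas X_bound, of i] by (simp add: P.prob_space)
  then show "(LINT u|unif_seq. Z i u) = 0" unfolding Z_def by simp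
  show "depends_on (Z i) (\<Union>a\<in>{1..r}. sp (i a))"
    unfolding Z_def[abs_def] by (rule depends_on_compose[OF X_depends])
  have "{j \<in> T. (\<Union>a\<in>{1..r}. sp (i a)) \<inter> (\<Union>a\<in>{1..r}. sp (j a)) \<noteq> {}} = {j \<in> T. cross i j}"
    unfolding cross_def adj_def by blast
  then show "card {j \<in> T. (\<Union>a\<in>{1..r}. sp (i a)) \<inter> (\<Union>a\<in>{1..r}. sp (j a)) \<noteq> {}} \<le> 3 * r\<^sup>2 * n ^ (r - 1)"
    using card_cross by simp
qed

end

section \<open>The limiting variance\<close>

lemma covariance_bounded:
  fixes f f' :: "'a \<Rightarrow> real"
  assumes "prob_space M" and [measurable]: "f \<in> borel_measurable M" "f' \<in> borel_measurable M"
    and b: "\<And>x. \<bar>f x\<bar> \<le> K" "\<And>x. \<bar>f' x\<bar> \<le> K"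
  shows "covariance M f f' = (LINT x|M. f x * f' x) - (LINT x|M. f x) * (LINT x|M. f' x)"
proof -
  interpret prob_space M by fact
  have K: "0 \<le> K" using b(1)[of undefined] by linarith
  have i: "integrable M f" "integrable M f'"
    using b by (auto intro!: integrable_const_bound[of _ K])
  have ii: "integrable M (\<lambda>x. f x * f' x)"
  proof (rule integrable_const_bound[of _ "K * K"])
    show "AE x in M. norm (f x * f' x) \<le> K * K"
      unfolding real_norm_def abs_mult using b K by (auto intro!: mult_mono)
  qed simp
  have "covariance M f f' = (LINT x|M. f x * f' x - (LINT x|M. f' x) * f x - (LINT x|M. f x) * f' x + (LINT x|M. f x) * (LINT x|M. f' x))"
    unfolding covariance_def by (simp add: algebra_simps)
  also have "\<dots> = (LINT x|M. f x * f' x) - (LINT x|M. f' x) * (LINT x|M. f x) - (LINT x|M. f x) * (LINT x|M. f' x) + (LINT x|M. f x) * (LINT x|M. f' x)"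
    using i ii by (simp add: prob_space)
  finally show ?thesis by simp
qed

lemma prob_space_unif_triple: "prob_space unif_triple"
proof -
  have "prob_space (distr unif_seq unif_triple (\<lambda>u. (u 0, u 1, u 2)))"
    by (intro prob_space.prob_space_distr[OF prob_space_unif_seq]) (simp add: unif_triple_def)
  then show ?thesis using distr_unif_seq_triple[of 0 1 2] by simp
qed

lemma sets_unif_triple [measurable_cong]: "sets unif_triple = sets (borel \<Otimes>\<^sub>M borel \<Otimes>\<^sub>M borel)"
  unfolding unif_triple_def by (intro sets_pair_measure_cong) auto

context graph_kernel begin

interpretation P: prob_space unif_seq by (rule prob_space_unif_seq)

lemma integral_triple:
  fixes f :: "real \<times> real \<times> real \<Rightarrow> real"
  assumes "distinct [k, l, m]" "f \<in> borel_measurable unif_triple"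
  shows "(LINT u|unif_seq. f (u k, u l, u m)) = (LINT x|unif_triple. f x)"
proof -
  have "(LINT x|unif_triple. f x) = (LINT x|distr unif_seq unif_triple (\<lambda>u. (u k, u l, u m)). f x)"
    using assms(1) distr_unif_seq_triple[of k l m] by simp
  also have "\<dots> = (LINT u|unif_seq. f (u k, u l, u m))"
    using assms(2) by (intro integral_distr) (simp_all add: unif_triple_def)
  finally show ?thesis ..
qed

lemma cov_triple:
  fixes f f' :: "real \<times> real \<times> real \<Rightarrow> real"
  assumes d: "distinct [k, l, m]" and m: "f \<in> borel_measurable unif_triple" "f' \<in> borel_measurable unif_triple"
    and b: "\<And>x. \<bar>f x\<bar> \<le> K" "\<And>x. \<bar>f' x\<bar> \<le> K"
  shows "cov (\<lambda>u. f (u k, u l, u m)) (\<lambda>u. f' (u k, u l, u m)) = covariance unif_triple f f'"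
  unfolding covariance_bounded[OF prob_space_unif_triple m b] cov_def
  using integral_triple[OF d m(1)] integral_triple[OF d m(2)] integral_triple[OF d borel_measurable_times[OF m]] by simp

abbreviation "\<gamma> \<equiv> g r"

lemma \<gamma>_meas [measurable]: "\<gamma> \<in> borel_measurable borel"
  using r by (intro g_meas) auto

definition "c1 = covariance unif_triple (\<lambda>(U, V, W). \<gamma> (U, U)) (\<lambda>(U, V, W). \<gamma> (U, U))"
definition "c2 = covariance unif_triple (\<lambda>(U, V, W). \<gamma> (U, V)) (\<lambda>(U, V, W). \<gamma> (U, V))"
definition "c3 = covariance unif_triple (\<lambda>(U, V, W). \<gamma> (U, V)) (\<lambda>(U, V, W). \<gamma> (V, U))"
definition "c4 = covariance unif_triple (\<lambda>(U, V, W). \<gamma> (U, V)) (\<lambda>(U, V, W). \<gamma> (V, W))"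

lemma \<gamma>_meas_triple [measurable]:
  "(\<lambda>(U, V, W). \<gamma> (U, U)) \<in> borel_measurable unif_triple"
  "(\<lambda>(U, V, W). \<gamma> (U, V)) \<in> borel_measurable unif_triple"
  "(\<lambda>(U, V, W). \<gamma> (V, U)) \<in> borel_measurable unif_triple"
  "(\<lambda>(U, V, W). \<gamma> (V, W)) \<in> borel_measurable unif_triple"
proof -
  have [measurable]: "\<gamma> \<in> borel_measurable (borel \<Otimes>\<^sub>M borel)" by (simp add: borel_prod)
  show "(\<lambda>(U, V, W). \<gamma> (U, U)) \<in> borel_measurable unif_triple"
    "(\<lambda>(U, V, W). \<gamma> (U, V)) \<in> borel_measurable unif_triple"
    "(\<lambda>(U, V, W). \<gamma> (V, U)) \<in> borel_measurable unif_triple"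
    "(\<lambda>(U, V, W). \<gamma> (V, W)) \<in> borel_measurable unif_triple" by measurable
qed

text \<open>Only one label is involved; \<open>Suc k\<close> and \<open>Suc (Suc k)\<close> merely
  fill the places of \<open>V\<close> and \<open>W\<close>.\<close>

lemma cov_gz_fixed: "\<sigma> k = k \<Longrightarrow> cov (gz k) (gz k) = c1"
  using cov_triple[of k "Suc k" "Suc (Suc k)" "\<lambda>(U, V, W). \<gamma> (U, U)" "\<lambda>(U, V, W). \<gamma> (U, U)"]
  by (simp add: c1_def gz_def[abs_def] graph_pt_def g_bound split_beta)

lemma cov_gz_self: "\<sigma> k \<noteq> k \<Longrightarrow> cov (gz k) (gz k) = c2"
proof -
  assume "\<sigma> k \<noteq> k"
  \<comment> \<open>\<open>Suc (k + \<sigma> k)\<close> exceeds both other indices and serves as the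
    third coordinate, which neither function reads.\<close>
  then have "distinct [k, \<sigma> k, Suc (k + \<sigma> k)]" by auto
  then show ?thesis
    using cov_triple[of k "\<sigma> k" "Suc (k + \<sigma> k)" "\<lambda>(U, V, W). \<gamma> (U, V)" "\<lambda>(U, V, W). \<gamma> (U, V)"]
    by (simp add: c2_def gz_def[abs_def] graph_pt_def g_bound split_beta)
qed

lemma cov_gz_two: "\<sigma> k \<noteq> k \<Longrightarrow> \<sigma> (\<sigma> k) = k \<Longrightarrow> cov (gz k) (gz (\<sigma> k)) = c3"
proof -
  assume "\<sigma> k \<noteq> k" and 2: "\<sigma> (\<sigma> k) = k"
  then have "distinct [k, \<sigma> k, Suc (k + \<sigma> k)]" by auto
  then show ?thesis
    using 2 cov_triple[of k "\<sigma> k" "Suc (k + \<sigma> k)" "\<lambda>(U, V, W). \<gamma> (U, V)" "\<lambda>(U, V, W). \<gamma> (V, U)"]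
    by (simp add: c3_def gz_def[abs_def] graph_pt_def g_bound split_beta)
qed

text \<open>The two points share exactly the label of \<open>\<sigma> k\<close>: with
  \<open>U\<close>, \<open>V\<close>, \<open>W\<close> at \<open>k\<close>,
  \<open>\<sigma> k\<close>, \<open>\<sigma> (\<sigma> k)\<close> they are \<open>(U, V)\<close> and
  \<open>(V, W)\<close>.\<close>

lemma cov_gz_next: "\<sigma> k \<noteq> k \<Longrightarrow> \<sigma> (\<sigma> k) \<noteq> k \<Longrightarrow> cov (gz k) (gz (\<sigma> k)) = c4"
proof -
  assume "\<sigma> k \<noteq> k" "\<sigma> (\<sigma> k) \<noteq> k"
  then have "distinct [k, \<sigma> k, \<sigma> (\<sigma> k)]" using injD[OF permutes_inj[OF \<sigma>], of "\<sigma> k" k] by auto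
  then show ?thesis
    using cov_triple[OF _ \<gamma>_meas_triple(2,4), of k "\<sigma> k" "\<sigma> (\<sigma> k)"]
    by (simp add: c4_def gz_def[abs_def] graph_pt_def g_bound split_beta)
qed

lemma cov_sym: "cov f f' = cov f' f"
proof -
  have "(\<lambda>u. f u * f' u) = (\<lambda>u. f' u * f u)" by (simp add: fun_eq_iff mult.commute)
  then show ?thesis unfolding cov_def by (simp only: mult.commute)
qed

text \<open>The neighbours of \<open>k\<close> are \<open>k\<close>, its image and its preimage. All
  three coincide at a fixed point, image and preimage coincide on a 2-cycle, and on longer cycles
  each of these two gives \<open>c4\<close>, the preimage by symmetry of \<open>cov\<close>.\<close>

lemma row_sum:
  assumes k: "k \<in> {1..n}"
  shows "(\<Sum>l\<in>{1..n}. of_bool (adj k l) * cov (gz k) (gz l)) =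
    (if \<sigma> k = k then c1 else if \<sigma> (\<sigma> k) = k then c2 + c3 else c2 + 2 * c4)"
proof -
  let ?\<tau> = "inv \<sigma>"
  have in_n: "\<sigma> k \<in> {1..n}" "?\<tau> k \<in> {1..n}"
    using permutes_in_image[OF \<sigma>, of k] permutes_in_image[OF permutes_inv[OF \<sigma>], of k] k by auto
  have inv: "\<sigma> (?\<tau> k) = k" using permutes_inverses[OF \<sigma>] by simp
  have inj: "\<sigma> a = \<sigma> b \<longleftrightarrow> a = b" for a b using permutes_inj[OF \<sigma>] by (auto dest: injD)
  have adj_iff: "adj k l \<longleftrightarrow> l = k \<or> l = \<sigma> k \<or> l = ?\<tau> k" for l
    using inj[of l "?\<tau> k"] by (auto simp: adj_def sp_def inv inj)
  have "(\<Sum>l\<in>{1..n}. of_bool (adj k l) * cov (gz k) (gz l)) = (\<Sum>l\<in>{k, \<sigma> k, ?\<tau> k}. cov (gz k) (gz l))"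
    using k in_n by (intro sum.mono_neutral_cong_right) (auto simp: adj_iff)
  also have "\<dots> = (if \<sigma> k = k then c1 else if \<sigma> (\<sigma> k) = k then c2 + c3 else c2 + 2 * c4)"
  proof -
    consider "\<sigma> k = k" | "\<sigma> k \<noteq> k" "\<sigma> (\<sigma> k) = k" | "\<sigma> k \<noteq> k" "\<sigma> (\<sigma> k) \<noteq> k" by blast
    then show ?thesis
    proof cases
      case 1
      then have "?\<tau> k = k" using inj[of "?\<tau> k" k] inv by simp
      then show ?thesis using 1 cov_gz_fixed by simp
    next
      case 2
      then have "?\<tau> k = \<sigma> k" using inj[of "?\<tau> k" "\<sigma> k"] inv by simp
      then show ?thesis using 2 cov_gz_self cov_gz_two by simp
    next
      case 3
      have t: "\<sigma> (?\<tau> k) \<noteq> ?\<tau> k" "\<sigma> (\<sigma> (?\<tau> k)) \<noteq> ?\<tau> k"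
        using 3 inv inj[of "\<sigma> k" "?\<tau> k"] inj[of k "?\<tau> k"] by metis+
      have "cov (gz k) (gz (?\<tau> k)) = c4"
        using cov_gz_next[OF t] cov_sym[of "gz k"] inv by simp
      moreover have "k \<noteq> \<sigma> k" "k \<noteq> ?\<tau> k" "\<sigma> k \<noteq> ?\<tau> k" using 3 t inv by metis+
      ultimately show ?thesis using 3 cov_gz_self cov_gz_next by simp
    qed
  qed
  finally show ?thesis .
qed

definition "t1 = card {k \<in> {1..n}. \<sigma> k = k}"
definition "t2 = card {k \<in> {1..n}. \<sigma> k \<noteq> k \<and> \<sigma> (\<sigma> k) = k}"

text \<open>The source of the four coefficients of \<open>cov_mat\<close>, with \<open>t1\<close>
  and \<open>t2\<close> over \<open>n\<close> in place of \<open>p1\<close> and \<open>p2\<close>;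
  the factor 2 counts image and preimage.\<close>

lemma sum_cov_gz:
  "(\<Sum>k\<in>{1..n}. \<Sum>l\<in>{1..n}. of_bool (adj k l) * cov (gz k) (gz l))
    = t1 * c1 + (real n - t1) * c2 + t2 * c3 + 2 * (real n - t1 - t2) * c4"
proof -
  let ?A = "{k \<in> {1..n}. \<sigma> k = k}" and ?B = "{k \<in> {1..n}. \<sigma> k \<noteq> k \<and> \<sigma> (\<sigma> k) = k}"
  have "(\<Sum>k\<in>{1..n}. \<Sum>l\<in>{1..n}. of_bool (adj k l) * cov (gz k) (gz l)) =
    (\<Sum>k\<in>{1..n}. (c2 + 2 * c4) + (if k \<in> ?A then c1 - c2 - 2 * c4 else 0) + (if k \<in> ?B then c3 - 2 * c4 else 0))"
  proof (rule sum.cong[OF refl])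
    fix k assume k: "k \<in> {1..n}"
    show "(\<Sum>l\<in>{1..n}. of_bool (adj k l) * cov (gz k) (gz l)) = (c2 + 2 * c4) + (if k \<in> ?A then c1 - c2 - 2 * c4 else 0) + (if k \<in> ?B then c3 - 2 * c4 else 0)"
      unfolding row_sum[OF k] using k by auto
  qed
  also have "\<dots> = real n * (c2 + 2 * c4) + t1 * (c1 - c2 - 2 * c4) + t2 * (c3 - 2 * c4)"
    unfolding sum.distrib
    by (simp add: t1_def t2_def sum.inter_filter[symmetric] distrib_left)
  finally show ?thesis by (simp add: algebra_simps)
qed

text \<open>r^2 is the number of position pairs at which a link can sit; with the r! of the
  normalisation it leaves 1 / ((r - 1)!)^2.\<close>

definition "limvar = (real r)\<^sup>2 / (fact r)\<^sup>2 * ((t1 * c1 + (real n - t1) * c2 + t2 * c3 + 2 * (real n - t1 - t2) * c4) / real n)"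

lemma var_eq: "dn.var = (\<Sum>i\<in>T. \<Sum>j\<in>T. cov (X i) (X j)) / ((fact r)\<^sup>2 * (real n ^ (2 * r - 2) * real n))"
proof -
  let ?d = "fact r * (real n ^ (r - 1) * sqrt (real n))"
  have d: "?d * ?d = (fact r)\<^sup>2 * (real n ^ (2 * r - 2) * real n)"
  proof -
    have "(r - 1) + (r - 1) = 2 * r - 2" by simp
    then have "real n ^ (r - 1) * real n ^ (r - 1) = real n ^ (2 * r - 2)" by (metis power_add)
    moreover have "?d * ?d = (fact r)\<^sup>2 * ((real n ^ (r - 1) * real n ^ (r - 1)) * (sqrt (real n) * sqrt (real n)))"
      by (simp only: power2_eq_square mult_ac)
    ultimately show ?thesis by simp
  qed
  have z: "(LINT u|unif_seq. Z i u * Z j u) = cov (X i) (X j) / (?d * ?d)" for i j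
  proof -
    let ?e = "\<lambda>i. LINT u|unif_seq. X i u"
    have i: "integrable unif_seq (X i)" for i by (rule integrable_bdd[OF X_meas X_bound])
    have ii: "integrable unif_seq (\<lambda>u. X i u * X j u)" by (intro integrable_bdd_mult X_meas X_bound)
    have "(LINT u|unif_seq. Z i u * Z j u) = (LINT u|unif_seq. (X i u * X j u - ?e j * X i u - ?e i * X j u + ?e i * ?e j) / (?d * ?d))"
      unfolding Z_def by (simp add: algebra_simps)
    also have "\<dots> = (LINT u|unif_seq. X i u * X j u - ?e j * X i u - ?e i * X j u + ?e i * ?e j) / (?d * ?d)"
      by (rule integral_divide_zero)
    also have "(LINT u|unif_seq. X i u * X j u - ?e j * X i u - ?e i * X j u + ?e i * ?e j) = cov (X i) (X j)"
      using i ii by (simp add: cov_def P.prob_space)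
    finally show ?thesis .
  qed
  have iZ: "integrable unif_seq (\<lambda>u. Z i u * Z j u)" if "i \<in> T" "j \<in> T" for i j
    by (rule dn.integrable_prod[OF that])
  have "dn.var = (LINT u|unif_seq. (\<Sum>i\<in>T. \<Sum>j\<in>T. Z i u * Z j u))"
    unfolding dn.var_def dn.W_def by (simp add: power2_eq_square sum_product)
  also have "\<dots> = (\<Sum>i\<in>T. \<Sum>j\<in>T. LINT u|unif_seq. Z i u * Z j u)"
    by (subst Bochner_Integration.integral_sum)
       (auto intro!: sum.cong Bochner_Integration.integral_sum iZ)
  also have "\<dots> = (\<Sum>i\<in>T. \<Sum>j\<in>T. cov (X i) (X j)) / (?d * ?d)"
    unfolding z by (simp add: sum_divide_distrib)
  finally show ?thesis unfolding d .
qed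

text \<open>This is the error of \<open>sum_cov_X\<close> divided by the squared normalisation,
  whose n^(2r-1) leaves 1/n.\<close>

lemma var_limvar: "\<bar>dn.var - limvar\<bar> \<le> 54 * real r ^ 4 * (1 + (real r)\<^sup>2) * K\<^sup>2 / ((fact r)\<^sup>2 * real n)"
proof -
  let ?N = "real n ^ (2 * r - 2)" and ?f = "(fact r)\<^sup>2 :: real"
  let ?S = "t1 * c1 + (real n - t1) * c2 + t2 * c3 + 2 * (real n - t1 - t2) * c4"
  let ?V = "\<Sum>i\<in>T. \<Sum>j\<in>T. cov (X i) (X j)"
  have pos: "0 < ?N" "0 < ?f" "0 < real n" using n by auto
  have "dn.var - limvar = (?V - (real r)\<^sup>2 * ?N * ?S) / (?f * (?N * real n))"
    unfolding var_eq limvar_def diff_divide_distrib using pos by simp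
  then have "\<bar>dn.var - limvar\<bar> = \<bar>?V - (real r)\<^sup>2 * ?N * ?S\<bar> / (?f * (?N * real n))"
    using pos by (simp only: abs_divide) simp
  also have "\<dots> \<le> (54 * real r ^ 4 * (1 + (real r)\<^sup>2) * K\<^sup>2 * ?N) / (?f * (?N * real n))"
    by (rule divide_right_mono[OF sum_cov_X[unfolded sum_cov_gz]]) simp
  also have "\<dots> = 54 * real r ^ 4 * (1 + (real r)\<^sup>2) * K\<^sup>2 / (?f * real n)"
    using pos by simp
  finally show ?thesis .
qed

text \<open>252 = 7/2 * 3^2 * 2^3, from \<open>stein_tikhomirov\<close> with degree 3 r^2 n^(r-1)
  and summands bounded by 2K over the normalisation; the powers of n combine to n^(-1/2).\<close>

lemma char_W: "cmod ((LINT u|unif_seq. iexp (dn.W u)) - exp (- dn.var / 2)) \<le> 252 * real r ^ 4 * K ^ 3 / (fact r) ^ 3 / sqrt (real n)"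
proof -
  let ?N = "real n ^ (r - 1)" and ?s = "sqrt (real n)"
  have pos: "0 < ?N" "0 < ?s" using n by auto
  have s2: "?s * ?s = real n" by simp
  have "real n ^ r = ?N * real n" using r by (cases r) auto
  then have cT: "real (card T) = ?N * (?s * ?s)" by (simp add: card_T)
  have eq: "7 / 2 * real (card T) * real ((3 * r\<^sup>2 * n ^ (r - 1))\<^sup>2) * (2 * K / (fact r * (?N * ?s))) ^ 3
    = 252 * real r ^ 4 * K ^ 3 / (fact r) ^ 3 / ?s"
    unfolding cT using pos by (simp add: field_simps power2_eq_square power3_eq_cube power4_eq_xxxx)
  show ?thesis using dn.stein_tikhomirov unfolding eq .
qed

end

section \<open>Characteristic functions and weak convergence of vectors\<close>

text \<open>\<open>f\<close> is the pointwise limit of its values at the grid points floor((k+1) x)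
  / (k+1), and these approximations factor through a countable set.\<close>

lemma borel_measurable_continuous_map_product:
  fixes f :: "('i \<Rightarrow> real) \<Rightarrow> real"
  assumes I: "finite I" and f: "continuous_map (product_topology (\<lambda>_. euclideanreal) I) euclideanreal f"
  shows "f \<in> borel_measurable (PiM I (\<lambda>_. borel))"
proof (rule borel_measurable_LIMSEQ_real)
  define h where "h k x = (\<lambda>i\<in>I. \<lfloor>real (Suc k) * x i\<rfloor>)" for k and x :: "'i \<Rightarrow> real"
  define e where "e k y = (\<lambda>i\<in>I. real_of_int (y i) / real (Suc k))" for k and y :: "'i \<Rightarrow> int"
  let ?A = "PiE I (\<lambda>_. UNIV :: int set)"
  have cA: "countable ?A" using I by (intro countable_PiE) auto
  show "(\<lambda>x. f (e k (h k x))) \<in> borel_measurable (PiM I (\<lambda>_. borel))" for k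
  proof (rule measurable_compose_countable'[OF _ _ cA])
    show "h k \<in> measurable (PiM I (\<lambda>_. borel)) (count_space ?A)"
      unfolding measurable_count_space_eq_countable[OF cA]
    proof (intro conjI ballI)
      show "h k \<in> space (PiM I (\<lambda>_. borel)) \<rightarrow> ?A" by (auto simp: h_def)
      fix y assume y: "y \<in> ?A"
      have "h k -` {y} \<inter> space (PiM I (\<lambda>_. borel)) = {x \<in> space (PiM I (\<lambda>_. borel)). \<forall>i\<in>I. \<lfloor>real (Suc k) * x i\<rfloor> = y i}"
        using y by (auto simp: h_def fun_eq_iff PiE_iff extensional_def restrict_def) 
      also have "\<dots> \<in> sets (PiM I (\<lambda>_. borel))"
        using I by measurable
      finally show "h k -` {y} \<inter> space (PiM I (\<lambda>_. borel)) \<in> sets (PiM I (\<lambda>_. borel))" .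
    qed
  qed simp
  fix x :: "'i \<Rightarrow> real" assume "x \<in> space (PiM I (\<lambda>_. borel))"
  then have x: "x \<in> extensional I" by (auto simp: space_PiM PiE_def)
  have "limitin (product_topology (\<lambda>_. euclideanreal) I) (\<lambda>k. e k (h k x)) x sequentially"
    unfolding limitin_componentwise
  proof (intro conjI ballI x)
    show "\<forall>\<^sub>F k in sequentially. e k (h k x) \<in> topspace (product_topology (\<lambda>_. euclideanreal) I)"
      by (simp add: e_def)
    fix i assume i: "i \<in> I"
    have "(\<lambda>k. real_of_int \<lfloor>real (Suc k) * x i\<rfloor> / real (Suc k)) \<longlonglongrightarrow> x i"
    proof (rule LIMSEQ_I)
      fix r :: real assume "0 < r"
      then obtain N where N: "1 / real (Suc N) < r"
        using reals_Archimedean[of r] by (auto simp: inverse_eq_divide)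
      have "norm (real_of_int \<lfloor>real (Suc k) * x i\<rfloor> / real (Suc k) - x i) < r" if "k \<ge> N" for k
      proof -
        have "\<bar>real_of_int \<lfloor>real (Suc k) * x i\<rfloor> - real (Suc k) * x i\<bar> \<le> 1" by linarith
        moreover have "real_of_int \<lfloor>real (Suc k) * x i\<rfloor> / real (Suc k) - x i = (real_of_int \<lfloor>real (Suc k) * x i\<rfloor> - real (Suc k) * x i) / real (Suc k)"
          by (simp add: field_simps)
        ultimately have "norm (real_of_int \<lfloor>real (Suc k) * x i\<rfloor> / real (Suc k) - x i) \<le> 1 / real (Suc k)"
          by (simp add: abs_divide divide_right_mono)
        also have "\<dots> \<le> 1 / real (Suc N)" using that by (simp add: frac_le)
        finally show ?thesis using N by simp
      qed
      then show "\<exists>N. \<forall>k\<ge>N. norm (real_of_int \<lfloor>real (Suc k) * x i\<rfloor> / real (Suc k) - x i) < r" by blast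
    qed
    then show "limitin euclideanreal (\<lambda>k. e k (h k x) i) (x i) sequentially"
      using i by (simp add: e_def h_def)
  qed
  from continuous_map_limit[OF f this]
  show "(\<lambda>k. f (e k (h k x))) \<longlonglongrightarrow> f x" by (simp add: o_def)
qed

section \<open>Trigonometric polynomials and the continuity theorem\<close>

text \<open>A list of coefficients and frequencies turns sums into concatenation and products into
  pairing. The functions are real-valued because Stone-Weierstrass is applied over the
  reals.\<close>

definition trig_poly :: "'i set \<Rightarrow> (('i \<Rightarrow> real) \<Rightarrow> real) \<Rightarrow> bool" where
  "trig_poly I g \<longleftrightarrow> (\<exists>l :: (complex \<times> ('i \<Rightarrow> real)) list. \<forall>x.
     complex_of_real (g x) = (\<Sum>(c, a)\<leftarrow>l. c * iexp (\<Sum>i\<in>I. a i * x i)))"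

lemma trig_poly_const: "trig_poly I (\<lambda>_. c)"
  unfolding trig_poly_def by (rule exI[of _ "[(complex_of_real c, \<lambda>_. 0)]"]) simp

lemma trig_poly_add: "trig_poly I g \<Longrightarrow> trig_poly I h \<Longrightarrow> trig_poly I (\<lambda>x. g x + h x)"
  unfolding trig_poly_def
proof (elim exE)
  fix l m :: "(complex \<times> ('a \<Rightarrow> real)) list"
  assume "\<forall>x. complex_of_real (g x) = (\<Sum>(c, a)\<leftarrow>l. c * iexp (\<Sum>i\<in>I. a i * x i))"
    "\<forall>x. complex_of_real (h x) = (\<Sum>(c, a)\<leftarrow>m. c * iexp (\<Sum>i\<in>I. a i * x i))"
  then show "\<exists>l :: (complex \<times> ('a \<Rightarrow> real)) list. \<forall>x. complex_of_real (g x + h x) = (\<Sum>(c, a)\<leftarrow>l. c * iexp (\<Sum>i\<in>I. a i * x i))"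
    by (intro exI[of _ "l @ m"]) simp
qed

lemma trig_poly_mult: "trig_poly I g \<Longrightarrow> trig_poly I h \<Longrightarrow> trig_poly I (\<lambda>x. g x * h x)"
  unfolding trig_poly_def
proof (elim exE)
  fix l m :: "(complex \<times> ('a \<Rightarrow> real)) list"
  assume l: "\<forall>x. complex_of_real (g x) = (\<Sum>(c, a)\<leftarrow>l. c * iexp (\<Sum>i\<in>I. a i * x i))"
    and m: "\<forall>x. complex_of_real (h x) = (\<Sum>(c, a)\<leftarrow>m. c * iexp (\<Sum>i\<in>I. a i * x i))"
  let ?sc = "\<lambda>c (a :: 'a \<Rightarrow> real) m. map (\<lambda>(d, b). (c * d, \<lambda>i. a i + b i)) m"
  have sc: "(\<Sum>(c, a)\<leftarrow>?sc c a m. c * iexp (\<Sum>i\<in>I. a i * x i)) = c * iexp (\<Sum>i\<in>I. a i * x i) * (\<Sum>(c, a)\<leftarrow>m. c * iexp (\<Sum>i\<in>I. a i * x i))"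
    for c a x and m :: "(complex \<times> ('a \<Rightarrow> real)) list"
    by (induction m) (auto simp: algebra_simps sum.distrib exp_add simp del: of_real_sum of_real_mult)
  have "(\<Sum>(c, a)\<leftarrow>concat (map (\<lambda>(c, a). ?sc c a m) l). c * iexp (\<Sum>i\<in>I. a i * x i))
     = (\<Sum>(c, a)\<leftarrow>l. c * iexp (\<Sum>i\<in>I. a i * x i)) * (\<Sum>(c, a)\<leftarrow>m. c * iexp (\<Sum>i\<in>I. a i * x i))" for x
    by (induction l) (auto simp: sc distrib_right simp del: map_map of_real_sum of_real_mult)
  then show "\<exists>l :: (complex \<times> ('a \<Rightarrow> real)) list. \<forall>x. complex_of_real (g x * h x) = (\<Sum>(c, a)\<leftarrow>l. c * iexp (\<Sum>i\<in>I. a i * x i))"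
    using l m by (intro exI[of _ "concat (map (\<lambda>(c, a). ?sc c a m) l)"]) simp
qed

lemma trig_poly_sin:
  assumes "finite I" "j \<in> I" shows "trig_poly I (\<lambda>x. sin (\<theta> * x j))"
  unfolding trig_poly_def
proof (intro exI allI)
  fix x :: "'a \<Rightarrow> real"
  have "(\<Sum>i\<in>I. (if i = j then t else 0) * x i) = t * x j" for t
    using assms by (simp add: if_distrib[of "\<lambda>c. c * _"] sum.delta cong: if_cong)
  moreover have "complex_of_real (sin (\<theta> * x j)) = 1 / (2 * \<i>) * iexp (\<theta> * x j) + - 1 / (2 * \<i>) * iexp (- \<theta> * x j)"
    using sin_exp_eq[of "complex_of_real (\<theta> * x j)"]
    by (simp only: sin_of_real diff_divide_distrib minus_divide_left[symmetric] times_divide_eq_left mult_1_left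
        mult_minus_left mult_minus_right of_real_minus) simp
  ultimately show "complex_of_real (sin (\<theta> * x j)) = (\<Sum>(c, a)\<leftarrow>[(1 / (2 * \<i>), \<lambda>i. if i = j then \<theta> else 0), (- 1 / (2 * \<i>), \<lambda>i. if i = j then - \<theta> else 0)]. c * iexp (\<Sum>i\<in>I. a i * x i))"
    by (simp del: of_real_sum of_real_mult)
qed

lemma trig_poly_integral_tendsto:
  fixes M :: "nat \<Rightarrow> ('i \<Rightarrow> real) measure"
  assumes I: "finite I" and M: "\<And>n. prob_space (M n)" "\<And>n. sets (M n) = sets (PiM I (\<lambda>_. borel))"
    and N: "prob_space N" "sets N = sets (PiM I (\<lambda>_. borel))"
    and char: "\<And>a :: 'i \<Rightarrow> real. (\<lambda>n. CLINT x|M n. iexp (\<Sum>i\<in>I. a i * x i)) \<longlonglongrightarrow> (CLINT x|N. iexp (\<Sum>i\<in>I. a i * x i))"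
    and g: "trig_poly I g"
  shows "g \<in> borel_measurable (PiM I (\<lambda>_. borel))" "(\<lambda>n. LINT x|M n. g x) \<longlonglongrightarrow> (LINT x|N. g x)"
proof -
  from g obtain l :: "(complex \<times> ('i \<Rightarrow> real)) list" where l: "\<And>x. complex_of_real (g x) = (\<Sum>(c, a)\<leftarrow>l. c * iexp (\<Sum>i\<in>I. a i * x i))"
    unfolding trig_poly_def by blast
  have meas: "(\<lambda>x. (\<Sum>(c, a)\<leftarrow>l. c * iexp (\<Sum>i\<in>I. a i * x i))) \<in> borel_measurable (PiM I (\<lambda>_. borel))"
    for l :: "(complex \<times> ('i \<Rightarrow> real)) list"
    by (induction l) (auto simp: split_beta)
  have "(\<lambda>x. Re (\<Sum>(c, a)\<leftarrow>l. c * iexp (\<Sum>i\<in>I. a i * x i))) \<in> borel_measurable (PiM I (\<lambda>_. borel))"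
    using meas by measurable
  then show gm: "g \<in> borel_measurable (PiM I (\<lambda>_. borel))"
    by (simp only: l[symmetric] Re_complex_of_real)
  have int: "integrable M (\<lambda>x. (\<Sum>(c, a)\<leftarrow>l. c * iexp (\<Sum>i\<in>I. a i * x i))) \<and>
    (LINT x|M. (\<Sum>(c, a)\<leftarrow>l. c * iexp (\<Sum>i\<in>I. a i * x i))) = (\<Sum>(c, a)\<leftarrow>l. c * (LINT x|M. iexp (\<Sum>i\<in>I. a i * x i)))"
    if "prob_space M" "sets M = sets (PiM I (\<lambda>_. borel))" for M and l :: "(complex \<times> ('i \<Rightarrow> real)) list"
  proof -
    interpret prob_space M by fact
    have "integrable M (\<lambda>x. iexp (\<Sum>i\<in>I. a i * x i))" for a
      using that(2) by (intro integrable_const_bound[of _ 1]) (auto simp: cong: measurable_cong_sets)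
    then show ?thesis
      by (induction l) (auto simp: split_beta simp del: of_real_sum)
  qed
  have "(\<lambda>n. \<Sum>(c, a)\<leftarrow>l. c * (LINT x|M n. iexp (\<Sum>i\<in>I. a i * x i))) \<longlonglongrightarrow> (\<Sum>(c, a)\<leftarrow>l. c * (LINT x|N. iexp (\<Sum>i\<in>I. a i * x i)))"
    for l :: "(complex \<times> ('i \<Rightarrow> real)) list"
  proof (induction l)
    case (Cons p l)
    show ?case using Cons tendsto_add[OF tendsto_mult[OF tendsto_const char]] by (cases p) (simp del: of_real_sum)
  qed simp
  from this[of l] have "(\<lambda>n. complex_of_real (LINT x|M n. g x)) \<longlonglongrightarrow> complex_of_real (LINT x|N. g x)"
    using int[OF M] int[OF N] by (simp del: of_real_sum integral_complex_of_real add: l integral_complex_of_real[symmetric])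
  then show "(\<lambda>n. LINT x|M n. g x) \<longlonglongrightarrow> (LINT x|N. g x)"
    by (simp add: tendsto_of_real_iff)
qed

text \<open>Since \<open>x = L \<cdot> (2 / \<pi>) \<cdot> arcsin (sin (\<theta> x))\<close> for \<open>\<bar>x\<bar> \<le> L\<close>, \<open>\<theta> = \<pi> / (2 L)\<close>, on the cube \<open>f\<close> agrees
  with a continuous function of the sines, which is bounded by \<open>K\<close> everywhere.\<close>

lemma trig_poly_approx:
  fixes f :: "('i \<Rightarrow> real) \<Rightarrow> real"
  assumes I: "finite I" and f: "continuous_map (product_topology (\<lambda>_. euclideanreal) I) euclideanreal f"
    and K: "\<And>x. x \<in> extensional I \<Longrightarrow> \<bar>f x\<bar> \<le> K" and L: "0 < L" and e: "0 < e"
  obtains g where "trig_poly I g" "\<And>x. x \<in> extensional I \<Longrightarrow> \<bar>g x\<bar> \<le> K + e"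
    "\<And>x. x \<in> extensional I \<Longrightarrow> (\<forall>i\<in>I. \<bar>x i\<bar> \<le> L) \<Longrightarrow> \<bar>f x - g x\<bar> \<le> e"
proof -
  define \<theta> where "\<theta> = pi / (2 * L)"
  obtain q :: "nat \<Rightarrow> 'i" where q: "bij_betw q {..<card I} I"
    using ex_bij_betw_nat_finite[OF I] by (auto simp: atLeast0LessThan)
  define b where "b = the_inv_into {..<card I} q"
  have b: "b i < card I" "q (b i) = i" if "i \<in> I" for i
    using that q the_inv_into_into[of q "{..<card I}" i "{..<card I}"] f_the_inv_into_f_bij_betw[OF q]
    by (auto simp: b_def bij_betw_def)
  define S :: "(nat \<Rightarrow> real) set" where "S = PiE {..<card I} (\<lambda>_. {-1..1})"
  define s where "s x = (\<lambda>k\<in>{..<card I}. sin (\<theta> * x (q k)))" for x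
  define F where "F y = f (\<lambda>i\<in>I. arcsin (y (b i)) / \<theta>)" for y
  have th: "\<theta> > 0" using L by (simp add: \<theta>_def)
  have sS: "s x \<in> S" for x by (auto simp: s_def S_def)
  \<comment> \<open>Written as a full product with the singleton \<open>{undefined}\<close> at the
    idle indices, \<open>S\<close> is compact by Tychonoff in the topology of the function
    type.\<close>
  have S_alt: "S = PiE UNIV (\<lambda>i. if i < card I then {-1..1} else {undefined})"
  proof (rule set_eqI)
    fix x :: "nat \<Rightarrow> real"
    have "x k \<in> (if k < card I then {-1..1} else {undefined}) \<longleftrightarrow> (k < card I \<longrightarrow> x k \<in> {-1..1}) \<and> (\<not> k < card I \<longrightarrow> x k = undefined)" for k
      by simp
    then show "x \<in> S \<longleftrightarrow> x \<in> PiE UNIV (\<lambda>i. if i < card I then {-1..1} else {undefined})"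
      unfolding S_def PiE_iff by (simp only: extensional_UNIV extensional_def mem_Collect_eq lessThan_iff UNIV_I) blast
  qed
  have "compactin (product_topology (\<lambda>_. euclidean) UNIV) S"
    unfolding S_alt compactin_PiE by auto
  then have compact: "compact S"
    by (simp add: euclidean_product_topology)
  have contF: "continuous_on S F"
  proof -
    have "continuous_map (top_of_set S) (product_topology (\<lambda>_. euclideanreal) I) (\<lambda>y. \<lambda>i\<in>I. arcsin (y (b i)) / \<theta>)"
      unfolding continuous_map_componentwise
    proof (intro conjI ballI)
      fix i assume i: "i \<in> I"
      have "continuous_on S (\<lambda>y. arcsin (y (b i)) / \<theta>)"
        using i th by (intro continuous_intros continuous_on_product_coordinates continuous_on_subset[OF continuous_on_product_coordinates]) (use b(1)[OF i] in \<open>auto simp: S_def PiE_iff Ball_def\<close>)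
      then show "continuous_map (top_of_set S) euclideanreal (\<lambda>x. (\<lambda>i\<in>I. arcsin (x (b i)) / \<theta>) i)"
        using i by simp
    qed auto
    from continuous_map_compose[OF this f] show ?thesis
      by (simp add: F_def[abs_def] o_def)
  qed
  let ?P = "\<lambda>h. continuous_on S h \<and> trig_poly I (\<lambda>x. h (s x))"
  have "\<exists>h. ?P h \<and> (\<forall>y\<in>S. \<bar>F y - h y\<bar> < e)"
  proof (rule Stone_Weierstrass_HOL[OF compact, where P = ?P])
    show "\<exists>f. ?P f \<and> f x \<noteq> f y" if "x \<in> S \<and> y \<in> S \<and> x \<noteq> y" for x y
    proof -
      \<comment> \<open>Points of \<open>S\<close> are extensional, so distinct ones differ at an
        index below \<open>card I\<close>, where a sine separates them.\<close>
      have "\<exists>k<card I. x k \<noteq> y k"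
        using that PiE_ext[of x "{..<card I}" "\<lambda>_. {-1..1}" y] unfolding S_def by blast
      then obtain k where k: "k < card I" "x k \<noteq> y k" by blast
      then have "q k \<in> I" using q by (auto simp: bij_betw_def)
      then show ?thesis
        using trig_poly_sin[OF I] k
        by (intro exI[of _ "\<lambda>y. y k"]) (auto simp: s_def intro: continuous_on_subset[OF continuous_on_product_coordinates])
    qed
  qed (use e contF in \<open>auto intro!: trig_poly_const trig_poly_add trig_poly_mult continuous_on_add continuous_on_mult\<close>)
  then obtain h where h: "trig_poly I (\<lambda>x. h (s x))" "\<And>y. y \<in> S \<Longrightarrow> \<bar>F y - h y\<bar> < e" by blast
  show thesis
  proof (rule that[OF h(1)])
    fix x :: "'i \<Rightarrow> real" assume x: "x \<in> extensional I"
    have "\<bar>F (s x)\<bar> \<le> K" unfolding F_def by (rule K) simp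
    then show "\<bar>h (s x)\<bar> \<le> K + e" using h(2)[OF sS, of x] by linarith
    assume xL: "\<forall>i\<in>I. \<bar>x i\<bar> \<le> L"
    have "(\<lambda>i\<in>I. arcsin (s x (b i)) / \<theta>) = x"
    proof
      fix i show "(\<lambda>i\<in>I. arcsin (s x (b i)) / \<theta>) i = x i"
      proof (cases "i \<in> I")
        case True
        then have "\<bar>\<theta> * x i\<bar> \<le> \<theta> * L" using xL th by (simp add: abs_mult)
        also have "\<theta> * L = pi / 2" using L by (simp add: \<theta>_def)
        finally have "arcsin (sin (\<theta> * x i)) = \<theta> * x i" by (intro arcsin_sin) auto
        then show ?thesis using True th b[OF True] by (simp add: s_def)
      qed (use x in \<open>auto simp: extensional_def\<close>)
    qed
    then show "\<bar>f x - h (s x)\<bar> \<le> e" using h(2)[OF sS, of x] by (simp add: F_def)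
  qed
qed

text \<open>On the good set the functions differ by at most \<open>e\<close>, elsewhere by at most
  the sum of their bounds.\<close>

lemma (in prob_space) abs_integral_diff_le_good_set:
  fixes f g :: "'a \<Rightarrow> real"
  assumes [measurable]: "f \<in> borel_measurable M" "g \<in> borel_measurable M" "{x \<in> space M. \<not> P x} \<in> sets M"
    and "\<And>x. x \<in> space M \<Longrightarrow> \<bar>f x\<bar> \<le> K" "\<And>x. x \<in> space M \<Longrightarrow> \<bar>g x\<bar> \<le> K'"
    and "\<And>x. x \<in> space M \<Longrightarrow> P x \<Longrightarrow> \<bar>f x - g x\<bar> \<le> e" and "0 \<le> e"
  shows "\<bar>integral\<^sup>L M f - integral\<^sup>L M g\<bar> \<le> e + (K + K') * prob {x \<in> space M. \<not> P x}"
proof -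
  have i: "integrable M f" "integrable M g"
    using assms(4,5) by (auto intro!: integrable_const_bound[of f K] integrable_const_bound[of g K'])
  have "\<bar>integral\<^sup>L M f - integral\<^sup>L M g\<bar> = \<bar>LINT x|M. f x - g x\<bar>" using i by simp
  also have "\<dots> \<le> (LINT x|M. \<bar>f x - g x\<bar>)" by (rule integral_abs_bound)
  also have "\<dots> \<le> (LINT x|M. e + (K + K') * indicator {x \<in> space M. \<not> P x} x)"
  proof (rule integral_mono)
    fix x assume x: "x \<in> space M"
    have "\<bar>f x - g x\<bar> \<le> K + K'" using assms(4,5)[OF x] by linarith
    then show "\<bar>f x - g x\<bar> \<le> e + (K + K') * indicator {x \<in> space M. \<not> P x} x"
      using assms(6)[OF x] \<open>0 \<le> e\<close> x by (cases "P x") auto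
  qed (use i in \<open>auto intro!: integrable_mult_right integrable_real_indicator simp: emeasure_eq_measure\<close>)
  also have "\<dots> = e + (K + K') * prob {x \<in> space M. \<not> P x}"
    by (subst Bochner_Integration.integral_add) (auto simp: prob_space emeasure_eq_measure intro!: integrable_mult_right integrable_real_indicator)
  finally show ?thesis .
qed

text \<open>Levy's continuity theorem. Second moments give tightness by Markov's inequality; on a
  large cube \<open>f\<close> is uniformly close to a trigonometric polynomial that stays bounded by
  \<open>K + e\<close> off the cube, and integrals of trigonometric polynomials converge because
  characteristic functions do.\<close>

lemma converges_weakly_charI:
  fixes M :: "nat \<Rightarrow> ('i \<Rightarrow> real) measure"
  assumes I: "finite I" and M: "\<And>n. prob_space (M n)" "\<And>n. sets (M n) = sets (PiM I (\<lambda>_. borel))"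
    and N: "prob_space N" "sets N = sets (PiM I (\<lambda>_. borel))"
    and char: "\<And>a :: 'i \<Rightarrow> real. (\<lambda>n. CLINT x|M n. iexp (\<Sum>i\<in>I. a i * x i)) \<longlonglongrightarrow> (CLINT x|N. iexp (\<Sum>i\<in>I. a i * x i))"
    and tight: "\<forall>\<^sub>F n in sequentially. \<forall>i\<in>I. integrable (M n) (\<lambda>x. (x i)\<^sup>2) \<and> (LINT x|M n. (x i)\<^sup>2) \<le> C"
  shows "converges_weakly (product_topology (\<lambda>_. euclideanreal) I) M N"
  unfolding converges_weakly_def
proof (intro allI impI, elim conjE)
  fix f :: "('i \<Rightarrow> real) \<Rightarrow> real"
  assume f: "continuous_map (product_topology (\<lambda>_. euclideanreal) I) euclideanreal f"
    and "bounded (f ` topspace (product_topology (\<lambda>_. euclideanreal) I))"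
  then obtain K where K0: "0 < K" "\<forall>y\<in>f ` topspace (product_topology (\<lambda>_. euclideanreal) I). norm y \<le> K"
    unfolding bounded_pos by blast
  then have K: "\<And>x. x \<in> extensional I \<Longrightarrow> \<bar>f x\<bar> \<le> K" "0 < K"
    by (auto simp: PiE_iff)
  interpret N: prob_space N by fact
  note [measurable] = borel_measurable_continuous_map_product[OF I f]
  have space: "space (PiM I (\<lambda>_. borel :: real measure)) = extensional I" by (auto simp: space_PiM PiE_def)
  let ?bad = "\<lambda>L::real. {x \<in> extensional I. \<not> (\<forall>i\<in>I. \<bar>x i\<bar> \<le> L)}"
  have bad_meas: "?bad L \<in> sets (PiM I (\<lambda>_. borel))" for L
  proof -
    have "?bad L = (\<Union>i\<in>I. {x \<in> space (PiM I (\<lambda>_. borel)). L < \<bar>x i\<bar>})" by (auto simp: space not_le)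
    also have "\<dots> \<in> sets (PiM I (\<lambda>_. borel))" using I by (intro sets.finite_UN) auto
    finally show ?thesis .
  qed
  \<comment> \<open>A single law is tight for free: the complements of growing cubes decrease to the
    empty set.\<close>
  have badN: "(\<lambda>k. measure N (?bad (real k))) \<longlonglongrightarrow> 0"
  proof -
    have "(\<lambda>k. measure N (?bad (real k))) \<longlonglongrightarrow> measure N (\<Inter>k. ?bad (real k))"
    proof (rule N.finite_Lim_measure_decseq)
      show "range (\<lambda>k. ?bad (real k)) \<subseteq> sets N" using bad_meas N(2) by auto
      show "decseq (\<lambda>k. ?bad (real k))"
        unfolding decseq_def by (auto, meson of_nat_mono order_trans)
    qed
    also have "(\<Inter>k. ?bad (real k)) = {}"
    proof safe
      fix x assume x: "x \<in> (\<Inter>k. ?bad (real k))"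
      obtain k where k: "(\<Sum>i\<in>I. \<bar>x i\<bar>) \<le> real k" using real_arch_simple by blast
      have "\<bar>x i\<bar> \<le> real k" if "i \<in> I" for i
        using member_le_sum[of i I "\<lambda>i. \<bar>x i\<bar>"] that I k by auto
      then show "x \<in> {}" using x by auto
    qed
    finally show ?thesis by simp
  qed
  show "(\<lambda>n. LINT x|M n. f x) \<longlonglongrightarrow> (LINT x|N. f x)"
  proof (rule LIMSEQ_I)
    fix \<epsilon> :: real assume "0 < \<epsilon>"
    \<comment> \<open>Approximating under \<open>M n\<close> and under \<open>N\<close> costs
      \<open>e + (2 * K + e) * e\<close> each, convergence for the polynomial another
      \<open>e\<close>; with \<open>e \<le> 1\<close> the total is at most
      \<open>e * (4 * K + 8)\<close>.\<close>
    define e where "e = min (\<epsilon> / (4 * K + 8)) 1"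
    have e: "0 < e" "e \<le> 1"
      using \<open>0 < \<epsilon>\<close> K(2) by (auto simp: e_def)
    have "e \<le> \<epsilon> / (4 * K + 8)" by (simp add: e_def)
    then have e3: "e * (4 * K + 8) \<le> \<epsilon>" using K(2) by (simp add: pos_le_divide_eq)
    obtain k1 where k1: "\<And>k. k \<ge> k1 \<Longrightarrow> measure N (?bad (real k)) < e"
      using LIMSEQ_D[OF badN e(1)] by auto
    obtain k2 where k2: "card I * \<bar>C\<bar> / e \<le> real k2" using real_arch_simple by blast
    define L where "L = real (Suc (max k1 k2))"
    have L: "1 \<le> L" "card I * \<bar>C\<bar> / e \<le> L" using k2 by (auto simp: L_def)
    have NL: "measure N (?bad L) \<le> e" unfolding L_def by (intro less_imp_le k1) simp
    have LC: "card I * (C / L\<^sup>2) \<le> e"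
    proof -
      have "card I * C \<le> card I * \<bar>C\<bar>" by (intro mult_left_mono) auto
      also have "\<dots> \<le> e * L" using L(2) e(1) by (simp add: field_simps)
      also have "\<dots> \<le> e * L\<^sup>2" using L(1) e(1) by (intro mult_left_mono) (auto simp: power2_eq_square)
      finally show ?thesis using L(1) by (simp add: field_simps)
    qed
    obtain g where g: "trig_poly I g" "\<And>x. x \<in> extensional I \<Longrightarrow> \<bar>g x\<bar> \<le> K + e"
      "\<And>x. x \<in> extensional I \<Longrightarrow> (\<forall>i\<in>I. \<bar>x i\<bar> \<le> L) \<Longrightarrow> \<bar>f x - g x\<bar> \<le> e"
      using trig_poly_approx[OF I f K(1), of L e] L(1) e(1) by auto
    note gt = trig_poly_integral_tendsto[OF I M N char g(1)]
    note [measurable] = gt(1)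
    have approx: "\<bar>(LINT x|Q. f x) - (LINT x|Q. g x)\<bar> \<le> e + (K + (K + e)) * e"
      if Q: "prob_space Q" "sets Q = sets (PiM I (\<lambda>_. borel))" and b: "measure Q (?bad L) \<le> e" for Q
    proof -
      interpret Q: prob_space Q by fact
      have sp: "space Q = extensional I" using sets_eq_imp_space_eq[OF Q(2)] space by simp
      have "\<bar>(LINT x|Q. f x) - (LINT x|Q. g x)\<bar> \<le> e + (K + (K + e)) * Q.prob {x \<in> space Q. \<not> (\<forall>i\<in>I. \<bar>x i\<bar> \<le> L)}"
        using bad_meas[of L] e(1) K g gt(1) borel_measurable_continuous_map_product[OF I f]
        by (intro Q.abs_integral_diff_le_good_set) (auto simp: sp Q(2) cong: measurable_cong_sets)
      also have "\<dots> \<le> e + (K + (K + e)) * e"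
        using b K(2) e(1) by (intro add_left_mono mult_left_mono) (auto simp: sp)
      finally show ?thesis .
    qed
    have badM: "\<forall>\<^sub>F n in sequentially. measure (M n) (?bad L) \<le> e"
      using tight
    proof eventually_elim
      case (elim n)
      interpret Mn: prob_space "M n" by (rule M)
      have sp: "space (M n) = extensional I" using sets_eq_imp_space_eq[OF M(2)] space by simp
      have 1: "{x \<in> space (M n). L\<^sup>2 \<le> (x i)\<^sup>2} \<in> sets (M n)" if "i \<in> I" for i
        using that sets_eq_imp_space_eq[OF M(2), of n] unfolding M(2) by simp
      have "measure (M n) (?bad L) \<le> measure (M n) (\<Union>i\<in>I. {x \<in> space (M n). L\<^sup>2 \<le> (x i)\<^sup>2})"
      proof (rule Mn.finite_measure_mono)
        show "?bad L \<subseteq> (\<Union>i\<in>I. {x \<in> space (M n). L\<^sup>2 \<le> (x i)\<^sup>2})"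
          using L(1) by (auto simp: sp abs_le_square_iff[symmetric])
        show "(\<Union>i\<in>I. {x \<in> space (M n). L\<^sup>2 \<le> (x i)\<^sup>2}) \<in> sets (M n)"
          using I 1 by auto
      qed
      also have "\<dots> \<le> (\<Sum>i\<in>I. measure (M n) {x \<in> space (M n). L\<^sup>2 \<le> (x i)\<^sup>2})"
        using I 1 by (intro Mn.finite_measure_subadditive_finite) auto
      also have "\<dots> \<le> (\<Sum>i\<in>I. C / L\<^sup>2)"
      proof (rule sum_mono)
        fix i assume i: "i \<in> I"
        have "measure (M n) {x \<in> space (M n). L\<^sup>2 \<le> (x i)\<^sup>2} \<le> (LINT x|M n. (x i)\<^sup>2) / L\<^sup>2"
          using elim i L(1) by (intro integral_Markov_inequality_measure[where A = "{}"]) auto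
        also have "\<dots> \<le> C / L\<^sup>2" using elim i by (intro divide_right_mono) auto
        finally show "measure (M n) {x \<in> space (M n). L\<^sup>2 \<le> (x i)\<^sup>2} \<le> C / L\<^sup>2" .
      qed
      finally show ?case using LC by simp
    qed
    have close: "\<forall>\<^sub>F n in sequentially. \<bar>(LINT x|M n. g x) - (LINT x|N. g x)\<bar> < e"
      using gt(2) e(1) by (simp add: tendsto_iff dist_real_def)
    have "\<forall>\<^sub>F n in sequentially. norm ((LINT x|M n. f x) - (LINT x|N. f x)) < \<epsilon>"
      using badM close
    proof eventually_elim
      case (elim n)
      define R where "R = e + (K + (K + e)) * e"
      have "\<bar>(LINT x|M n. f x) - (LINT x|N. f x)\<bar> < 2 * R + e"
        using approx[OF M elim(1)] approx[OF N NL] elim(2) unfolding R_def[symmetric] by linarith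
      also have "\<dots> \<le> e * (4 * K + 8)"
      proof -
        have "e * e \<le> e * 1" using e by (intro mult_left_mono) auto
        then show ?thesis using e by (simp add: R_def algebra_simps)
      qed
      finally show ?case using e3 by simp
    qed
    then show "\<exists>n0. \<forall>n\<ge>n0. norm ((LINT x|M n. f x) - (LINT x|N. f x)) < \<epsilon>"
      by (simp add: eventually_sequentially)
  qed
qed

section \<open>Gaussian laws with a prescribed quadratic form\<close>

text \<open>Symmetric elimination: completing the square in the variable \<open>x\<close> splits off
  the row of \<open>x\<close>, scaled by the root of the pivot, and leaves the Schur complement,
  which is again positive semidefinite. A zero pivot forces its whole row to vanish, so degenerate
  forms are covered.\<close>

lemma psd_imp_gram:
  fixes Q :: "'i \<Rightarrow> 'i \<Rightarrow> real"
  assumes "finite I" and "\<And>i j. i \<in> I \<Longrightarrow> j \<in> I \<Longrightarrow> Q i j = Q j i"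
    and "\<And>a. 0 \<le> (\<Sum>i\<in>I. \<Sum>j\<in>I. a i * Q i j * a j)"
  shows "\<exists>B. \<forall>i\<in>I. \<forall>j\<in>I. Q i j = (\<Sum>k\<in>I. B k i * B k j)"
  using assms
proof (induction I arbitrary: Q rule: finite_induct)
  case empty
  then show ?case by simp
next
  case (insert x I)
  have expand: "(\<Sum>i\<in>insert x I. \<Sum>j\<in>insert x I. a i * Q i j * a j)
    = a x * Q x x * a x + 2 * a x * (\<Sum>j\<in>I. Q x j * a j) + (\<Sum>i\<in>I. \<Sum>j\<in>I. a i * Q i j * a j)" for a
  proof -
    have "(\<Sum>i\<in>I. a i * Q i x * a x) = a x * (\<Sum>j\<in>I. Q x j * a j)"
      using insert.prems(1) by (auto simp: sum_distrib_left mult_ac intro!: sum.cong)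
    moreover have "(\<Sum>j\<in>I. a x * Q x j * a j) = a x * (\<Sum>j\<in>I. Q x j * a j)"
      by (simp add: sum_distrib_left mult_ac)
    ultimately show ?thesis using insert.hyps by (simp add: sum.distrib)
  qed
  have cong: "(\<Sum>i\<in>I. \<Sum>j\<in>I. (a(x := t)) i * Q i j * (a(x := t)) j) = (\<Sum>i\<in>I. \<Sum>j\<in>I. a i * Q i j * a j)"
    "(\<Sum>j\<in>I. Q x j * (a(x := t)) j) = (\<Sum>j\<in>I. Q x j * a j)" for a t
    using insert.hyps by (auto intro!: sum.cong)
  have psd: "0 \<le> t * Q x x * t + 2 * t * (\<Sum>j\<in>I. Q x j * a j) + (\<Sum>i\<in>I. \<Sum>j\<in>I. a i * Q i j * a j)" for a t
    using insert.prems(2)[of "a(x := t)"] unfolding expand cong by simp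
  have Qxx: "0 \<le> Q x x" using psd[of 1 "\<lambda>_. 0"] by simp
  show ?case
  proof (cases "Q x x = 0")
    case True
    have zero: "Q x j = 0" if j: "j \<in> I" for j
    proof (rule ccontr)
      assume ne: "Q x j \<noteq> 0"
      have d: "(\<Sum>i\<in>I. Q x i * (if i = j then 1 else 0)) = Q x j"
        "(\<Sum>i\<in>I. \<Sum>k\<in>I. (if i = j then 1 else 0) * Q i k * (if k = j then 1 else 0)) = Q j j"
        using j insert.hyps(1) by (simp_all add: if_distrib[of "\<lambda>c. _ * c"] if_distrib[of "\<lambda>c. c * _"] sum.delta cong: if_cong)
      have "0 \<le> 2 * t * Q x j + Q j j" for t
        using psd[of t "\<lambda>i. if i = j then 1 else 0"] unfolding d True by simp
      \<comment> \<open>At this \<open>t\<close> the affine function of \<open>t\<close> equals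
        -1.\<close>
      from this[of "(- Q j j - 1) / (2 * Q x j)"] ne show False by (simp add: field_simps)
    qed
    have "\<exists>B. \<forall>i\<in>I. \<forall>j\<in>I. Q i j = (\<Sum>k\<in>I. B k i * B k j)"
      using insert.prems(1) psd[of 0] by (intro insert.IH) auto
    then obtain B where B: "\<forall>i\<in>I. \<forall>j\<in>I. Q i j = (\<Sum>k\<in>I. B k i * B k j)" ..
    have "(\<Sum>k\<in>I. (if k = x \<or> i = x then 0 else B k i) * (if k = x \<or> j = x then 0 else B k j)) = (if i = x \<or> j = x then 0 else \<Sum>k\<in>I. B k i * B k j)" for i j
      using insert.hyps(2) by (auto intro!: sum.cong)
    then show ?thesis using insert.hyps B zero True insert.prems(1)
      by (intro exI[of _ "\<lambda>k i. if k = x \<or> i = x then 0 else B k i"]) (auto simp del: mult_eq_0_iff)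
  next
    case False
    then have pos: "0 < Q x x" using Qxx by simp
    define R where "R i j = Q i j - Q x i * Q x j / Q x x" for i j
    have "\<exists>B. \<forall>i\<in>I. \<forall>j\<in>I. R i j = (\<Sum>k\<in>I. B k i * B k j)"
    proof (rule insert.IH)
      show "R i j = R j i" if "i \<in> I" "j \<in> I" for i j
        using insert.prems(1)[of i j] that by (simp add: R_def mult.commute)
      fix a :: "'i \<Rightarrow> real"
      let ?S = "\<Sum>j\<in>I. Q x j * a j"
      have "(\<Sum>i\<in>I. \<Sum>j\<in>I. a i * R i j * a j) = (\<Sum>i\<in>I. \<Sum>j\<in>I. a i * Q i j * a j) - ?S * ?S / Q x x"
        unfolding sum_product sum_divide_distrib sum_subtractf[symmetric] R_def
        by (intro sum.cong refl) (simp add: field_simps)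
      \<comment> \<open>\<open>- ?S / Q x x\<close> minimises the quadratic in \<open>t\<close>, and
        the minimum is the form of the Schur complement.\<close>
      also have "\<dots> \<ge> 0"
        using psd[of "- ?S / Q x x" a] pos by (simp add: field_simps)
      finally show "0 \<le> (\<Sum>i\<in>I. \<Sum>j\<in>I. a i * R i j * a j)" .
    qed
    then obtain B where B: "\<forall>i\<in>I. \<forall>j\<in>I. R i j = (\<Sum>k\<in>I. B k i * B k j)" ..
    define B' where "B' k i = (if k = x then Q x i / sqrt (Q x x) else if i = x then 0 else B k i)" for k i
    have x: "B' x i * B' x j = Q x i * Q x j / Q x x" for i j
      using pos by (simp add: B'_def)
    have s: "(\<Sum>k\<in>I. B' k i * B' k j) = (if i = x \<or> j = x then 0 else \<Sum>k\<in>I. B k i * B k j)" for i j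
    proof (cases "i = x \<or> j = x")
      case True
      then have "B' k i * B' k j = 0" if "k \<in> I" for k
        using that insert.hyps(2) by (auto simp: B'_def)
      then have "(\<Sum>k\<in>I. B' k i * B' k j) = 0" by (intro sum.neutral) blast
      then show ?thesis using True by simp
    next
      case False
      then show ?thesis using insert.hyps(2) by (auto simp: B'_def intro!: sum.cong)
    qed
    have "Q i j = (\<Sum>k\<in>insert x I. B' k i * B' k j)" if ij: "i \<in> insert x I" "j \<in> insert x I" for i j
    proof -
      have "(\<Sum>k\<in>insert x I. B' k i * B' k j) = Q x i * Q x j / Q x x + (if i = x \<or> j = x then 0 else R i j)"
        using insert.hyps ij B by (auto simp: x s)
      then show ?thesis using ij pos insert.prems(1)[of i j] by (auto simp: R_def)
    qed
    then show ?thesis by blast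
  qed
qed

text \<open>Only the quadratic form enters, so \<open>\<Sigma>\<close> is replaced by its symmetric
  part, factored as a Gram matrix, and i.i.d. standard normals are mapped linearly by the
  factor.\<close>

lemma centered_gaussian_exists:
  fixes \<Sigma> :: "'i \<Rightarrow> 'i \<Rightarrow> real"
  assumes I: "finite I" and psd: "\<And>a. 0 \<le> (\<Sum>i\<in>I. \<Sum>j\<in>I. a i * \<Sigma> i j * a j)"
  shows "\<exists>N. is_centered_gaussian I \<Sigma> N"
proof -
  define Q where "Q i j = (\<Sigma> i j + \<Sigma> j i) / 2" for i j
  have Q: "(\<Sum>i\<in>I. \<Sum>j\<in>I. a i * Q i j * a j) = (\<Sum>i\<in>I. \<Sum>j\<in>I. a i * \<Sigma> i j * a j)" for a
  proof -
    have "(\<Sum>i\<in>I. \<Sum>j\<in>I. a i * \<Sigma> j i * a j) = (\<Sum>i\<in>I. \<Sum>j\<in>I. a i * \<Sigma> i j * a j)"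
      by (subst sum.swap) (simp add: mult_ac)
    moreover have "(\<Sum>i\<in>I. \<Sum>j\<in>I. a i * Q i j * a j) = ((\<Sum>i\<in>I. \<Sum>j\<in>I. a i * \<Sigma> i j * a j) + (\<Sum>i\<in>I. \<Sum>j\<in>I. a i * \<Sigma> j i * a j)) / 2"
      by (simp add: Q_def sum.distrib[symmetric] sum_divide_distrib algebra_simps add_divide_distrib)
    ultimately show ?thesis by simp
  qed
  have "\<exists>B. \<forall>i\<in>I. \<forall>j\<in>I. Q i j = (\<Sum>k\<in>I. B k i * B k j)"
    using I psd by (intro psd_imp_gram) (auto simp: Q, simp add: Q_def)
  then obtain B where B: "\<And>i j. i \<in> I \<Longrightarrow> j \<in> I \<Longrightarrow> Q i j = (\<Sum>k\<in>I. B k i * B k j)" by blast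
  let ?G = "PiM I (\<lambda>_. std_normal_distribution)"
  let ?T = "\<lambda>g. \<lambda>i\<in>I. \<Sum>k\<in>I. B k i * g k"
  interpret n: real_distribution std_normal_distribution by (rule real_dist_normal_dist)
  interpret G: product_prob_space "\<lambda>_ :: 'i. std_normal_distribution" I by unfold_locales
  have sG: "sets ?G = sets (PiM I (\<lambda>_. borel))" by (intro sets_PiM_cong) auto
  have T [measurable]: "?T \<in> measurable ?G (PiM I (\<lambda>_. borel))"
    unfolding measurable_cong_sets[OF sG refl] by measurable
  have "is_centered_gaussian I \<Sigma> (distr ?G (PiM I (\<lambda>_. borel)) ?T)"
    unfolding is_centered_gaussian_def
  proof (intro conjI allI)
    show "prob_space (distr ?G (PiM I (\<lambda>_. borel)) ?T)" by (rule G.P.prob_space_distr) (rule T)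
    fix a :: "'i \<Rightarrow> real"
    define b where "b k = (\<Sum>i\<in>I. a i * B k i)" for k
    have lin: "(\<Sum>i\<in>I. a i * ?T g i) = (\<Sum>k\<in>I. b k * g k)" for g
      unfolding b_def by (simp add: sum_distrib_left sum_distrib_right mult_ac) (rule sum.swap)
    have "(CLINT x|distr ?G (PiM I (\<lambda>_. borel)) ?T. iexp (\<Sum>i\<in>I. a i * x i)) = (CLINT g|?G. iexp (\<Sum>i\<in>I. a i * ?T g i))"
      by (subst integral_distr[OF T]) auto
    also have "\<dots> = (CLINT g|?G. (\<Prod>k\<in>I. iexp (b k * g k)))"
      unfolding lin using I by (simp add: exp_sum[symmetric] sum_distrib_left)
    also have "\<dots> = (\<Prod>k\<in>I. CLINT x|std_normal_distribution. iexp (b k * x))"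
      using I by (intro G.product_integral_prod) (auto intro!: n.integrable_const_bound[of _ 1])
    also have "\<dots> = (\<Prod>k\<in>I. complex_of_real (exp (- ((b k)\<^sup>2) / 2)))"
      using char_std_normal_distribution by (simp add: char_def fun_eq_iff)
    also have "\<dots> = complex_of_real (exp (- (\<Sum>k\<in>I. (b k)\<^sup>2) / 2))"
      using I by (simp add: exp_sum[symmetric] sum_negf[symmetric] sum_divide_distrib flip: of_real_prod)
    also have "(\<Sum>k\<in>I. (b k)\<^sup>2) = (\<Sum>i\<in>I. \<Sum>j\<in>I. a i * Q i j * a j)"
    proof -
      have "(\<Sum>k\<in>I. (b k)\<^sup>2) = (\<Sum>k\<in>I. \<Sum>i\<in>I. \<Sum>j\<in>I. a i * (B k i * B k j) * a j)"
        unfolding b_def power2_eq_square sum_product by (simp add: mult_ac)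
      also have "\<dots> = (\<Sum>i\<in>I. \<Sum>k\<in>I. \<Sum>j\<in>I. a i * (B k i * B k j) * a j)"
        by (rule sum.swap)
      also have "\<dots> = (\<Sum>i\<in>I. \<Sum>j\<in>I. \<Sum>k\<in>I. a i * (B k i * B k j) * a j)"
        by (intro sum.cong refl sum.swap)
      also have "\<dots> = (\<Sum>i\<in>I. \<Sum>j\<in>I. a i * Q i j * a j)"
        by (intro sum.cong refl) (simp add: B sum_distrib_left sum_distrib_right)
      finally show ?thesis .
    qed
    finally show "(CLINT x|distr ?G (PiM I (\<lambda>_. borel)) ?T. iexp (\<Sum>i\<in>I. a i * x i)) =
        complex_of_real (exp (- (\<Sum>i\<in>I. \<Sum>j\<in>I. a i * \<Sigma> i j * a j) / 2))"
      unfolding Q .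
  qed simp
  then show ?thesis by blast
qed

section \<open>The kernel of a linear combination of pattern counts\<close>

text \<open>\<open>is_Perm\<close> speaks of a set of points, whereas measurability is checked
  coordinatewise on tuples. Either side makes \<open>z\<close> injective on \<open>J\<close>, so
  points can be counted by their indices.\<close>

lemma is_Perm_image_iff:
  assumes J: "finite J" "card J = r"
  shows "is_Perm r (z ` J) \<pi> \<longleftrightarrow> \<pi> \<in> Sym r \<and> (\<forall>a\<in>J. \<forall>b\<in>J. a \<noteq> b \<longrightarrow> fst (z a) \<noteq> fst (z b) \<and> snd (z a) \<noteq> snd (z b))
    \<and> (\<forall>a\<in>J. \<pi> (card {b \<in> J. fst (z b) \<le> fst (z a)}) = card {b \<in> J. snd (z b) \<le> snd (z a)})"
proof -
  have c: "card {w \<in> z ` J. p w \<le> p (z a)} = card {b \<in> J. p (z b) \<le> p (z a)}" if "inj_on z J" for p :: "_ \<Rightarrow> real" and a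
  proof -
    have "{w \<in> z ` J. p w \<le> p (z a)} = z ` {b \<in> J. p (z b) \<le> p (z a)}" by auto
    moreover have "inj_on z {b \<in> J. p (z b) \<le> p (z a)}" by (rule inj_on_subset[OF that]) auto
    ultimately show ?thesis by (simp add: card_image)
  qed
  show ?thesis
  proof
    assume P: "is_Perm r (z ` J) \<pi>"
    then have inj: "inj_on z J" using J by (intro eq_card_imp_inj_on) (auto simp: is_Perm_def)
    have "fst (z a) \<noteq> fst (z b) \<and> snd (z a) \<noteq> snd (z b)" if "a \<in> J" "b \<in> J" "a \<noteq> b" for a b
      using P inj_on_contraD[OF inj that(3,1,2)] that unfolding is_Perm_def by (auto dest: inj_onD)
    then show "\<pi> \<in> Sym r \<and> (\<forall>a\<in>J. \<forall>b\<in>J. a \<noteq> b \<longrightarrow> fst (z a) \<noteq> fst (z b) \<and> snd (z a) \<noteq> snd (z b))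
      \<and> (\<forall>a\<in>J. \<pi> (card {b \<in> J. fst (z b) \<le> fst (z a)}) = card {b \<in> J. snd (z b) \<le> snd (z a)})"
      using P c[OF inj, of fst] c[OF inj, of snd] by (auto simp: is_Perm_def)
  next
    assume R: "\<pi> \<in> Sym r \<and> (\<forall>a\<in>J. \<forall>b\<in>J. a \<noteq> b \<longrightarrow> fst (z a) \<noteq> fst (z b) \<and> snd (z a) \<noteq> snd (z b))
      \<and> (\<forall>a\<in>J. \<pi> (card {b \<in> J. fst (z b) \<le> fst (z a)}) = card {b \<in> J. snd (z b) \<le> snd (z a)})"
    have inj: "inj_on z J" using R by (intro inj_onI) metis
    have fi: "inj_on p (z ` J)" if p: "\<And>a b. a \<in> J \<Longrightarrow> b \<in> J \<Longrightarrow> a \<noteq> b \<Longrightarrow> p (z a) \<noteq> p (z b)" for p :: "real \<times> real \<Rightarrow> real"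
    proof (rule inj_onI)
      fix x y assume "x \<in> z ` J" "y \<in> z ` J" and e: "p x = p y"
      then obtain a b where "a \<in> J" "b \<in> J" "x = z a" "y = z b" by blast
      then show "x = y" using p[of a b] e by (cases "a = b") auto
    qed
    have f: "inj_on fst (z ` J)" "inj_on snd (z ` J)"
      using R by (intro fi; blast)+
    show "is_Perm r (z ` J) \<pi>"
      unfolding is_Perm_def using R J f c[OF inj, of fst] c[OF inj, of snd] by (simp add: card_image[OF inj])
  qed
qed

lemma measurable_is_Perm_image:
  assumes J: "finite J" "card J = r"
  shows "{z \<in> space (PiM J (\<lambda>_. borel)). is_Perm r (z ` J) \<pi>} \<in> sets (PiM (J :: nat set) (\<lambda>_. borel))"
proof -
  have f: "(\<lambda>z. fst (z a)) \<in> borel_measurable (PiM J (\<lambda>_. borel :: (real \<times> real) measure))"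
    and s: "(\<lambda>z. snd (z a)) \<in> borel_measurable (PiM J (\<lambda>_. borel :: (real \<times> real) measure))" if "a \<in> J" for a
    using that by (auto intro!: measurable_compose[OF measurable_component_singleton] simp: borel_prod[symmetric])
  have c: "(\<lambda>z. card {b \<in> J. p (z b) \<le> p (z a)}) \<in> measurable (PiM J (\<lambda>_. borel :: (real \<times> real) measure)) (count_space UNIV)"
    if "\<And>a. a \<in> J \<Longrightarrow> (\<lambda>z. p (z a)) \<in> borel_measurable (PiM J (\<lambda>_. borel :: (real \<times> real) measure))" "a \<in> J" for p :: "_ \<Rightarrow> real" and a
  proof (rule measurable_card)
    fix b
    show "{z \<in> space (PiM J (\<lambda>_. borel)). b \<in> {b \<in> J. p (z b) \<le> p (z a)}} \<in> sets (PiM J (\<lambda>_. borel))"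
      using that by (cases "b \<in> J") auto
  qed
  have ne: "{z \<in> space (PiM J (\<lambda>_. borel)). a \<noteq> b \<longrightarrow> fst (z a) \<noteq> fst (z b) \<and> snd (z a) \<noteq> snd (z b)} \<in> sets (PiM J (\<lambda>_. borel :: (real \<times> real) measure))"
    if "a \<in> J" "b \<in> J" for a b
  proof (cases "a = b")
    case False
    have "{z \<in> space (PiM J (\<lambda>_. borel)). p (z a) \<noteq> p (z b)} \<in> sets (PiM J (\<lambda>_. borel :: (real \<times> real) measure))"
      if "(\<lambda>z. p (z a)) \<in> borel_measurable (PiM J (\<lambda>_. borel :: (real \<times> real) measure))"
        "(\<lambda>z. p (z b)) \<in> borel_measurable (PiM J (\<lambda>_. borel :: (real \<times> real) measure))" for p :: "real \<times> real \<Rightarrow> real"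
      by (rule borel_measurable_neq[OF that])
    from sets.Int[OF this[OF f[OF that(1)] f[OF that(2)]] this[OF s[OF that(1)] s[OF that(2)]]]
    have "{z \<in> space (PiM J (\<lambda>_. borel)). fst (z a) \<noteq> fst (z b) \<and> snd (z a) \<noteq> snd (z b)} \<in> sets (PiM J (\<lambda>_. borel :: (real \<times> real) measure))"
      by (rule back_subst[where P = "\<lambda>A. A \<in> sets (PiM J (\<lambda>_. borel :: (real \<times> real) measure))"]) auto
    then show ?thesis using False by simp
  qed simp
  have eq: "{z \<in> space (PiM J (\<lambda>_. borel)). \<pi> (card {b \<in> J. fst (z b) \<le> fst (z a)}) = card {b \<in> J. snd (z b) \<le> snd (z a)}} \<in> sets (PiM J (\<lambda>_. borel :: (real \<times> real) measure))"
    if "a \<in> J" for a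
  proof -
    have "{z \<in> space M. \<pi> (F z) = F' z} \<in> sets M"
      if [measurable]: "F \<in> measurable M (count_space UNIV)" "F' \<in> measurable M (count_space UNIV)" for M :: "(nat \<Rightarrow> real \<times> real) measure" and F F' :: "_ \<Rightarrow> nat"
      by measurable
    from this[OF c[OF f that] c[OF s that]] show ?thesis by simp
  qed
  show ?thesis
    unfolding is_Perm_image_iff[OF J]
    by (intro sets.sets_Collect_conj sets.sets_Collect_finite_All sets.sets_Collect_const J(1) ne eq)
qed

text \<open>A linear combination over all patterns, so that joint convergence follows from
  real-valued statements for every \<open>a\<close>. It reads \<open>z\<close> only through an image
  set, which makes it symmetric.\<close>

definition kern :: "nat \<Rightarrow> ((nat \<Rightarrow> nat) \<Rightarrow> real) \<Rightarrow> (nat \<Rightarrow> real \<times> real) \<Rightarrow> real" where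
  "kern r a z = (\<Sum>\<pi>\<in>Sym r. a \<pi> * indicator {P. is_Perm r P \<pi>} (z ` {1..r}))"

definition kern_bound :: "nat \<Rightarrow> ((nat \<Rightarrow> nat) \<Rightarrow> real) \<Rightarrow> real" where
  "kern_bound r a = (\<Sum>\<pi>\<in>Sym r. \<bar>a \<pi>\<bar>)"

lemma kern_bound_nonneg: "0 \<le> kern_bound r a"
  unfolding kern_bound_def by (rule sum_nonneg) simp

lemma measurable_indicator_is_Perm:
  "(\<lambda>z. indicator {P. is_Perm r P \<pi>} (z ` {1..r}) :: real) \<in> borel_measurable (PiM {1..r} (\<lambda>_. borel))"
proof -
  have "(\<lambda>z. indicator {z \<in> space (PiM {1..r} (\<lambda>_. borel)). is_Perm r (z ` {1..r}) \<pi>} z :: real) \<in> borel_measurable (PiM {1..r} (\<lambda>_. borel))"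
    using measurable_is_Perm_image[of "{1..r}" r \<pi>] by simp
  then show ?thesis by (rule measurable_cong[THEN iffD1, rotated]) (auto simp: indicator_def)
qed

lemma bdd_meas_kern: "bdd_meas (PiM {1..r} (\<lambda>_. borel)) (kern r a) (kern_bound r a)"
proof -
  have "\<bar>kern r a z\<bar> \<le> kern_bound r a" for z
    unfolding kern_def kern_bound_def
    by (intro order_trans[OF sum_abs] sum_mono) (auto simp: indicator_def)
  moreover have "kern r a \<in> borel_measurable (PiM {1..r} (\<lambda>_. borel))"
    unfolding kern_def[abs_def] by (intro borel_measurable_sum borel_measurable_times borel_measurable_const measurable_indicator_is_Perm)
  ultimately show ?thesis by (simp add: bdd_meas_def)
qed

lemma graph_kernel_kern:
  assumes "0 < n" "1 \<le> r" "\<sigma> \<in> Sym n"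
  shows "graph_kernel n r \<sigma> (kern r a) (kern_bound r a)"
proof
  show "kern r a (z \<circ> \<rho>) = kern r a z" if "\<rho> permutes {1..r}" for \<rho> z
  proof -
    have "(z \<circ> \<rho>) ` {1..r} = z ` {1..r}" unfolding image_comp[symmetric] permutes_image[OF that] ..
    then show ?thesis by (simp only: kern_def)
  qed
qed (use assms bdd_meas_kern in \<open>auto simp: Sym_def\<close>)

lemma sets_PiM_point_law: "sets (PiM J (\<lambda>_. point_law p)) = sets (PiM J (\<lambda>_. borel))"
  by (intro sets_PiM_cong) auto

lemma integral_sum_kern:
  assumes M: "prob_space M" and meas: "\<And>\<pi>. (\<lambda>Z. indicator {P. is_Perm r P \<pi>} (F Z ` {1..r}) :: real) \<in> borel_measurable M"
  shows "(\<Sum>\<pi>\<in>Sym r. a \<pi> * measure M {Z \<in> space M. is_Perm r (F Z ` {1..r}) \<pi>}) = (LINT Z|M. kern r a (F Z))"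
proof -
  interpret prob_space M by fact
  have int: "integrable M (\<lambda>Z. indicator {P. is_Perm r P \<pi>} (F Z ` {1..r}) :: real)" for \<pi>
    using meas by (intro integrable_const_bound[of _ 1]) (auto simp: indicator_def)
  have m: "measure M {Z \<in> space M. is_Perm r (F Z ` {1..r}) \<pi>} = (LINT Z|M. indicator {P. is_Perm r P \<pi>} (F Z ` {1..r}))" for \<pi>
  proof -
    have "(LINT Z|M. indicator {P. is_Perm r P \<pi>} (F Z ` {1..r}) :: real) = (LINT Z|M. indicator {Z \<in> space M. is_Perm r (F Z ` {1..r}) \<pi>} Z)"
      by (rule Bochner_Integration.integral_cong) (auto simp: indicator_def)
    also have "\<dots> = measure M ({Z \<in> space M. is_Perm r (F Z ` {1..r}) \<pi>} \<inter> space M)" by (rule Bochner_Integration.integral_indicator)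
    finally show ?thesis by (simp add: Int_absorb2)
  qed
  show ?thesis
    unfolding kern_def m using int by (subst Bochner_Integration.integral_sum) auto
qed

lemma sum_\<mu>: "(\<Sum>\<pi>\<in>Sym r. a \<pi> * \<mu> r p \<pi>) = (LINT Z|PiM {1..r} (\<lambda>_. point_law p). kern r a Z)"
proof -
  have "prob_space (PiM {1..r} (\<lambda>_. point_law p))" by (intro prob_space_PiM prob_space_point_law)
  moreover have "(\<lambda>Z. indicator {P. is_Perm r P \<pi>} (Z ` {1..r}) :: real) \<in> borel_measurable (PiM {1..r} (\<lambda>_. point_law p))" for \<pi>
    using measurable_indicator_is_Perm by (simp only: measurable_cong_sets[OF sets_PiM_point_law refl])
  ultimately show ?thesis
    using integral_sum_kern[of "PiM {1..r} (\<lambda>_. point_law p)" r "\<lambda>Z. Z" a] by (simp add: \<mu>_def Let_def)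
qed

text \<open>The projection of the pattern kernel as a function of the parameter \<open>p\<close>, so
  that the fraction of fixed points and its limit can be compared; position \<open>r\<close> is the
  one left free in \<open>\<psi>\<close>.\<close>

definition \<Psi> :: "nat \<Rightarrow> ((nat \<Rightarrow> nat) \<Rightarrow> real) \<Rightarrow> real \<Rightarrow> real \<times> real \<Rightarrow> real" where
  "\<Psi> r a p z = (LINT Z|PiM {1..<r} (\<lambda>_. point_law p). kern r a (Z(r := z)))"

lemma measurable_upd_last:
  fixes r :: nat
  assumes "1 \<le> r" and f: "f \<in> borel_measurable (PiM {1..r} (\<lambda>_. borel))"
  shows "(\<lambda>w. f ((snd w)(r := fst w))) \<in> borel_measurable (borel \<Otimes>\<^sub>M PiM {1..<r} (\<lambda>_. borel :: (real \<times> real) measure))"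
    "(\<lambda>Z. f (Z(r := z))) \<in> borel_measurable (PiM {1..<r} (\<lambda>_. borel :: (real \<times> real) measure))"
proof -
  have i: "insert r {1..<r} = {1..r}" using assms(1) by auto
  have "(\<lambda>w. (\<lambda>(f, y). f(r := y)) (snd w, fst w)) \<in> measurable (borel \<Otimes>\<^sub>M PiM {1..<r} (\<lambda>_. borel :: (real \<times> real) measure)) (PiM (insert r {1..<r}) (\<lambda>_. borel))"
    by (intro measurable_compose[OF _ measurable_add_dim]) measurable
  then have 1: "(\<lambda>w. (snd w)(r := fst w)) \<in> measurable (borel \<Otimes>\<^sub>M PiM {1..<r} (\<lambda>_. borel :: (real \<times> real) measure)) (PiM {1..r} (\<lambda>_. borel))"
    unfolding i case_prod_conv .
  show 2: "(\<lambda>w. f ((snd w)(r := fst w))) \<in> borel_measurable (borel \<Otimes>\<^sub>M PiM {1..<r} (\<lambda>_. borel :: (real \<times> real) measure))"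
    using measurable_compose[OF 1 f] .
  show "(\<lambda>Z. f (Z(r := z))) \<in> borel_measurable (PiM {1..<r} (\<lambda>_. borel :: (real \<times> real) measure))"
    using measurable_compose[OF measurable_Pair1' 2, of z] by simp
qed

lemma sum_\<psi>:
  assumes r: "1 \<le> r"
  shows "(\<Sum>\<pi>\<in>Sym r. a \<pi> * \<psi> r p \<pi> z) = \<Psi> r a p z"
proof -
  let ?M = "PiM {1..<r} (\<lambda>_. point_law p)"
  have img: "insert z (Z ` {1..<r}) = (Z(r := z)) ` {1..r}" for Z
  proof -
    have "{1..r} = insert r {1..<r}" using r by auto
    then show ?thesis by (auto simp: image_def)
  qed
  have "prob_space ?M" by (intro prob_space_PiM prob_space_point_law)
  moreover have "(\<lambda>Z. indicator {P. is_Perm r P \<pi>} ((Z(r := z)) ` {1..r}) :: real) \<in> borel_measurable ?M" for \<pi>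
    using measurable_upd_last(2)[OF r measurable_indicator_is_Perm] by (simp only: measurable_cong_sets[OF sets_PiM_point_law refl])
  ultimately show ?thesis
    using integral_sum_kern[of ?M r "\<lambda>Z. Z(r := z)" a] unfolding \<psi>_def Let_def \<Psi>_def img by simp
qed

lemma \<Psi>_bound: "\<bar>\<Psi> r a p z\<bar> \<le> kern_bound r a"
proof -
  interpret prob_space "PiM {1..<r} (\<lambda>_. point_law p)" by (intro prob_space_PiM prob_space_point_law)
  show ?thesis unfolding \<Psi>_def
    using norm_integral_le_const[of "\<lambda>Z. kern r a (Z(r := z))" "kern_bound r a"] bdd_meas_kern[of r a] by (simp add: bdd_meas_def)
qed

lemma \<Psi>_meas:
  assumes "1 \<le> r" shows "\<Psi> r a p \<in> borel_measurable borel"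
proof -
  interpret prob_space "PiM {1..<r} (\<lambda>_. point_law p)" by (intro prob_space_PiM prob_space_point_law)
  have "case_prod (\<lambda>z Z. kern r a (Z(r := z))) \<in> borel_measurable (borel \<Otimes>\<^sub>M PiM {1..<r} (\<lambda>_. borel))"
    using measurable_upd_last(1)[OF assms, of "kern r a"] bdd_meas_kern[of r a] by (simp add: bdd_meas_def case_prod_beta')
  then have "case_prod (\<lambda>z Z. kern r a (Z(r := z))) \<in> borel_measurable (borel \<Otimes>\<^sub>M PiM {1..<r} (\<lambda>_. point_law p))"
    by (simp only: measurable_cong_sets[OF sets_pair_measure_cong[OF refl sets_PiM_point_law] refl])
  from borel_measurable_lebesgue_integral[OF this] show ?thesis unfolding \<Psi>_def[abs_def] .
qed

lemma \<Psi>_lipschitz: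
  assumes "1 \<le> r" "p \<in> {0..1}" "q \<in> {0..1}"
  shows "\<bar>\<Psi> r a p z - \<Psi> r a q z\<bar> \<le> 2 * real r * kern_bound r a * \<bar>p - q\<bar>"
proof -
  have "\<bar>\<Psi> r a p z - \<Psi> r a q z\<bar> \<le> card {1..<r} * (2 * kern_bound r a * \<bar>p - q\<bar>)"
    unfolding \<Psi>_def using assms measurable_upd_last(2)[OF assms(1), of "kern r a" z] bdd_meas_kern[of r a]
    by (intro integral_PiM_point_law_lipschitz) (auto simp: bdd_meas_def)
  also have "\<dots> \<le> real r * (2 * kern_bound r a * \<bar>p - q\<bar>)"
    using kern_bound_nonneg by (intro mult_right_mono) auto
  finally show ?thesis by (simp add: mult_ac)
qed

section \<open>The limiting quadratic form\<close>

text \<open>In this family both slots carry the same function: only the quadratic form of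
  \<open>cov_mat\<close> matters, and it is evaluated at the combination
  \<open>\<Psi>\<close>.\<close>

definition cov1 :: "(real \<times> real \<Rightarrow> real) \<Rightarrow> real" where
  "cov1 f = covariance unif_triple (\<lambda>(U, V, W). f (U, U)) (\<lambda>(U, V, W). f (U, U))"
definition cov2 :: "(real \<times> real \<Rightarrow> real) \<Rightarrow> real" where
  "cov2 f = covariance unif_triple (\<lambda>(U, V, W). f (U, V)) (\<lambda>(U, V, W). f (U, V))"
definition cov3 :: "(real \<times> real \<Rightarrow> real) \<Rightarrow> real" where
  "cov3 f = covariance unif_triple (\<lambda>(U, V, W). f (U, V)) (\<lambda>(U, V, W). f (V, U))"
definition cov4 :: "(real \<times> real \<Rightarrow> real) \<Rightarrow> real" where
  "cov4 f = covariance unif_triple (\<lambda>(U, V, W). f (U, V)) (\<lambda>(U, V, W). f (V, W))"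

definition asymp_var :: "nat \<Rightarrow> real \<Rightarrow> real \<Rightarrow> (real \<times> real \<Rightarrow> real) \<Rightarrow> real" where
  "asymp_var r s1 s2 f = (s1 * cov1 f + (1 - s1) * cov2 f + s2 * cov3 f + 2 * (1 - s1 - s2) * cov4 f) / (fact (r - 1))\<^sup>2"

lemma meas_triple:
  assumes "f \<in> borel_measurable borel"
  shows "(\<lambda>(U, V, W). f (U, U)) \<in> borel_measurable unif_triple"
    "(\<lambda>(U, V, W). f (U, V)) \<in> borel_measurable unif_triple"
    "(\<lambda>(U, V, W). f (V, U)) \<in> borel_measurable unif_triple"
    "(\<lambda>(U, V, W). f (V, W)) \<in> borel_measurable unif_triple"
proof -
  have [measurable]: "f \<in> borel_measurable (borel \<Otimes>\<^sub>M borel)" using assms by (simp add: borel_prod)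
  show "(\<lambda>(U, V, W). f (U, U)) \<in> borel_measurable unif_triple"
    "(\<lambda>(U, V, W). f (U, V)) \<in> borel_measurable unif_triple"
    "(\<lambda>(U, V, W). f (V, U)) \<in> borel_measurable unif_triple"
    "(\<lambda>(U, V, W). f (V, W)) \<in> borel_measurable unif_triple" by measurable
qed

text \<open>Half of the constant comes from the expectation of the product and half from the product
  of the expectations, each changing by at most \<open>2 * K * d\<close>.\<close>

lemma covariance_diff_le:
  fixes f f' g g' :: "'a \<Rightarrow> real"
  assumes M: "prob_space M" and meas: "f \<in> borel_measurable M" "f' \<in> borel_measurable M" "g \<in> borel_measurable M" "g' \<in> borel_measurable M"
    and b: "\<And>x. \<bar>f x\<bar> \<le> K" "\<And>x. \<bar>f' x\<bar> \<le> K" "\<And>x. \<bar>g x\<bar> \<le> K" "\<And>x. \<bar>g' x\<bar> \<le> K"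
    and d: "\<And>x. \<bar>f x - g x\<bar> \<le> d" "\<And>x. \<bar>f' x - g' x\<bar> \<le> d"
  shows "\<bar>covariance M f f' - covariance M g g'\<bar> \<le> 4 * K * d"
proof -
  interpret prob_space M by fact
  have K: "0 \<le> K" using b(1)[of undefined] by linarith
  have prod: "\<bar>x * x' - y * y'\<bar> \<le> 2 * K * d" if "\<bar>x'\<bar> \<le> K" "\<bar>y\<bar> \<le> K" "\<bar>x - y\<bar> \<le> d" "\<bar>x' - y'\<bar> \<le> d" for x x' y y' :: real
  proof -
    have "x * x' - y * y' = (x - y) * x' + y * (x' - y')" by (simp add: algebra_simps)
    moreover have "\<bar>x - y\<bar> * \<bar>x'\<bar> \<le> d * K" "\<bar>y\<bar> * \<bar>x' - y'\<bar> \<le> K * d"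
      using that K by (intro mult_mono; linarith)+
    moreover have "\<bar>(x - y) * x' + y * (x' - y')\<bar> \<le> \<bar>x - y\<bar> * \<bar>x'\<bar> + \<bar>y\<bar> * \<bar>x' - y'\<bar>"
      using abs_triangle_ineq[of "(x - y) * x'" "y * (x' - y')"] unfolding abs_mult .
    ultimately show ?thesis by (simp only: mult.commute[of d K] mult.assoc)
  qed
  have i: "integrable M h" if "h \<in> borel_measurable M" "\<And>x. \<bar>h x\<bar> \<le> K" for h :: "'a \<Rightarrow> real"
    using that by (intro integrable_const_bound[of _ K]) auto
  have ii: "integrable M (\<lambda>x. h x * h' x)" if "h \<in> borel_measurable M" "\<And>x. \<bar>h x\<bar> \<le> K" "h' \<in> borel_measurable M" "\<And>x. \<bar>h' x\<bar> \<le> K" for h h' :: "'a \<Rightarrow> real"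
  proof (rule integrable_const_bound[of _ "K * K"])
    show "AE x in M. norm (h x * h' x) \<le> K * K"
      unfolding real_norm_def abs_mult using that K by (auto intro!: mult_mono)
  qed (use that in auto)
  have 1: "\<bar>(LINT x|M. f x * f' x) - (LINT x|M. g x * g' x)\<bar> \<le> 2 * K * d"
    using norm_integral_diff_le[OF ii[OF meas(1) b(1) meas(2) b(2)] ii[OF meas(3) b(3) meas(4) b(4)], of "2 * K * d"]
      prod[OF b(2) b(3) d(1) d(2)] by simp
  have 2: "\<bar>(LINT x|M. f x) * (LINT x|M. f' x) - (LINT x|M. g x) * (LINT x|M. g' x)\<bar> \<le> 2 * K * d"
    using norm_integral_diff_le[OF i[OF meas(1) b(1)] i[OF meas(3) b(3)], of d] norm_integral_diff_le[OF i[OF meas(2) b(2)] i[OF meas(4) b(4)], of d]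
      norm_integral_le_const[of f' K] norm_integral_le_const[of g K] b d by (intro prod) auto
  show ?thesis
    unfolding covariance_bounded[OF M meas(1,2) b(1,2)] covariance_bounded[OF M meas(3,4) b(3,4)]
    using 1 2 by linarith
qed

lemma covs_diff_le:
  assumes "f \<in> borel_measurable borel" "g \<in> borel_measurable borel"
    and "\<And>x. \<bar>f x\<bar> \<le> K" "\<And>x. \<bar>g x\<bar> \<le> K" "\<And>x. \<bar>f x - g x\<bar> \<le> d"
  shows "\<bar>cov1 f - cov1 g\<bar> \<le> 4 * K * d" "\<bar>cov2 f - cov2 g\<bar> \<le> 4 * K * d"
    "\<bar>cov3 f - cov3 g\<bar> \<le> 4 * K * d" "\<bar>cov4 f - cov4 g\<bar> \<le> 4 * K * d"
  unfolding cov1_def cov2_def cov3_def cov4_def using assms(3-)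
  by (intro covariance_diff_le[OF prob_space_unif_triple] meas_triple assms(1,2); clarsimp)+

lemma covariance_bilinear:
  fixes F F' :: "'i \<Rightarrow> 'a \<Rightarrow> real"
  assumes M: "prob_space M" and I: "finite I"
    and meas: "\<And>i. F i \<in> borel_measurable M" "\<And>i. F' i \<in> borel_measurable M"
    and b: "\<And>i x. \<bar>F i x\<bar> \<le> 1" "\<And>i x. \<bar>F' i x\<bar> \<le> 1"
  shows "(\<Sum>i\<in>I. \<Sum>j\<in>I. a i * covariance M (F i) (F' j) * a j) = covariance M (\<lambda>x. \<Sum>i\<in>I. a i * F i x) (\<lambda>x. \<Sum>i\<in>I. a i * F' i x)"
proof -
  interpret prob_space M by fact
  let ?A = "\<Sum>i\<in>I. \<bar>a i\<bar>"
  have i: "integrable M (F i)" "integrable M (F' i)" for i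
    using meas b by (auto intro!: integrable_const_bound[of _ 1])
  have ii: "integrable M (\<lambda>x. F i x * F' j x)" for i j
  proof (rule integrable_const_bound[of _ 1])
    show "AE x in M. norm (F i x * F' j x) \<le> 1"
      unfolding real_norm_def abs_mult using b by (auto intro!: mult_le_one)
  qed (use meas in auto)
  have bb: "\<bar>\<Sum>i\<in>I. a i * H i x\<bar> \<le> ?A" if "\<And>i x. \<bar>H i x\<bar> \<le> 1" for H :: "'i \<Rightarrow> 'a \<Rightarrow> real" and x
    using that by (intro order_trans[OF sum_abs] sum_mono) (auto simp: abs_mult intro!: mult_left_le)
  have e1: "(LINT x|M. (\<Sum>i\<in>I. a i * F i x) * (\<Sum>j\<in>I. a j * F' j x)) = (\<Sum>i\<in>I. \<Sum>j\<in>I. a i * a j * (LINT x|M. F i x * F' j x))"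
  proof -
    have "(LINT x|M. (\<Sum>i\<in>I. a i * F i x) * (\<Sum>j\<in>I. a j * F' j x)) = (LINT x|M. (\<Sum>i\<in>I. \<Sum>j\<in>I. a i * a j * (F i x * F' j x)))"
      by (simp add: sum_product mult_ac)
    also have "\<dots> = (\<Sum>i\<in>I. \<Sum>j\<in>I. (LINT x|M. a i * a j * (F i x * F' j x)))"
    proof -
      have i2: "integrable M (\<lambda>x. a i * a j * (F i x * F' j x))" for i j by (intro integrable_mult_right ii)
      show ?thesis
        by (subst Bochner_Integration.integral_sum[OF Bochner_Integration.integrable_sum[OF i2]])
           (simp only: Bochner_Integration.integral_sum[OF i2])
    qed
    finally show ?thesis by simp
  qed
  have e2: "(LINT x|M. (\<Sum>i\<in>I. a i * H i x)) = (\<Sum>i\<in>I. a i * (LINT x|M. H i x))" if "\<And>i. integrable M (H i)" for H :: "'i \<Rightarrow> 'a \<Rightarrow> real"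
    using that by (subst Bochner_Integration.integral_sum) auto
  have "covariance M (\<lambda>x. \<Sum>i\<in>I. a i * F i x) (\<lambda>x. \<Sum>i\<in>I. a i * F' i x)
    = (\<Sum>i\<in>I. \<Sum>j\<in>I. a i * a j * (LINT x|M. F i x * F' j x)) - (\<Sum>i\<in>I. a i * (LINT x|M. F i x)) * (\<Sum>j\<in>I. a j * (LINT x|M. F' j x))"
    using meas by (subst covariance_bounded[OF M, of _ _ ?A]) (auto intro!: bb b simp: e1 e2[OF i(1)] e2[OF i(2)])
  also have "\<dots> = (\<Sum>i\<in>I. \<Sum>j\<in>I. a i * covariance M (F i) (F' j) * a j)"
    unfolding covariance_bounded[OF M meas b] sum_product sum_subtractf[symmetric]
    by (intro sum.cong refl) (simp add: algebra_simps)
  finally show ?thesis ..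
qed

text \<open>Covariance is bilinear, so the weights \<open>a\<close> move inside and combine the
  \<open>\<psi>\<close> into \<open>\<Psi>\<close>.\<close>

lemma quadratic_form_cov_mat:
  assumes r: "1 \<le> r"
  shows "(\<Sum>\<pi>\<in>Sym r. \<Sum>\<rho>\<in>Sym r. a \<pi> * cov_mat r p1 p2 \<pi> \<rho> * a \<rho>) = asymp_var r p1 p2 (\<Psi> r a p1)"
proof -
  let ?f = "\<lambda>\<pi>. \<psi> r p1 \<pi>"
  have m: "?f \<pi> \<in> borel_measurable borel" and b: "\<bar>?f \<pi> z\<bar> \<le> 1" for \<pi> z
  proof -
    interpret prob_space "PiM {1..<r} (\<lambda>_. point_law p1)" by (intro prob_space_PiM prob_space_point_law)
    show "\<bar>?f \<pi> z\<bar> \<le> 1" unfolding \<psi>_def Let_def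
      by (simp only: abs_of_nonneg[OF measure_nonneg] prob_le_1)
    show "?f \<pi> \<in> borel_measurable borel"
    proof (cases "\<pi> \<in> Sym r")
      case True
      \<comment> \<open>Measurability of a single \<open>\<psi>\<close> is that of
        \<open>\<Psi>\<close> with a unit coefficient vector.\<close>
      have "?f \<pi> z = \<Psi> r (\<lambda>\<rho>. if \<rho> = \<pi> then 1 else 0) p1 z" for z
      proof -
        have "(\<Sum>\<rho>\<in>Sym r. (if \<rho> = \<pi> then 1 else 0) * \<psi> r p1 \<rho> z) = (\<Sum>\<rho>\<in>Sym r. if \<rho> = \<pi> then \<psi> r p1 \<rho> z else 0)"
          by (intro sum.cong) auto
        also have "\<dots> = \<psi> r p1 \<pi> z" using True by (simp only: sum.delta[OF Sym_finite] if_True)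
        finally show ?thesis using sum_\<psi>[OF r, of "\<lambda>\<rho>. if \<rho> = \<pi> then 1 else 0" p1 z] by (simp only:)
      qed
      then have "?f \<pi> = \<Psi> r (\<lambda>\<rho>. if \<rho> = \<pi> then 1 else 0) p1" by (rule ext)
      then show ?thesis using \<Psi>_meas[OF r] by simp
    next
      case False
      then have "?f \<pi> = (\<lambda>_. 0)" by (auto simp: \<psi>_def is_Perm_def fun_eq_iff)
      then show ?thesis by simp
    qed
  qed
  have lin: "(\<Sum>\<pi>\<in>Sym r. a \<pi> * ?f \<pi> z) = \<Psi> r a p1 z" for z by (rule sum_\<psi>[OF r])
  note bil = covariance_bilinear[OF prob_space_unif_triple Sym_finite[of r], where a = a]
  have 1: "(\<Sum>\<pi>\<in>Sym r. \<Sum>\<rho>\<in>Sym r. a \<pi> * covariance unif_triple (\<lambda>(U, V, W). ?f \<pi> (U, U)) (\<lambda>(U, V, W). ?f \<rho> (U, U)) * a \<rho>) = cov1 (\<Psi> r a p1)"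
    unfolding cov1_def by (subst bil) (simp_all add: meas_triple[OF m, unfolded split_beta'] meas_triple(4)[OF m, unfolded split_beta' prod.collapse] b lin split_beta')
  have 2: "(\<Sum>\<pi>\<in>Sym r. \<Sum>\<rho>\<in>Sym r. a \<pi> * covariance unif_triple (\<lambda>(U, V, W). ?f \<pi> (U, V)) (\<lambda>(U, V, W). ?f \<rho> (U, V)) * a \<rho>) = cov2 (\<Psi> r a p1)"
    unfolding cov2_def by (subst bil) (simp_all add: meas_triple[OF m, unfolded split_beta'] meas_triple(4)[OF m, unfolded split_beta' prod.collapse] b lin split_beta')
  have 3: "(\<Sum>\<pi>\<in>Sym r. \<Sum>\<rho>\<in>Sym r. a \<pi> * covariance unif_triple (\<lambda>(U, V, W). ?f \<pi> (U, V)) (\<lambda>(U, V, W). ?f \<rho> (V, U)) * a \<rho>) = cov3 (\<Psi> r a p1)"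
    unfolding cov3_def by (subst bil) (simp_all add: meas_triple[OF m, unfolded split_beta'] meas_triple(4)[OF m, unfolded split_beta' prod.collapse] b lin split_beta')
  have 4: "(\<Sum>\<pi>\<in>Sym r. \<Sum>\<rho>\<in>Sym r. a \<pi> * covariance unif_triple (\<lambda>(U, V, W). ?f \<pi> (U, V)) (\<lambda>(U, V, W). ?f \<rho> (V, W)) * a \<rho>) = cov4 (\<Psi> r a p1)"
    unfolding cov4_def by (subst bil) (simp_all add: meas_triple[OF m, unfolded split_beta'] meas_triple(4)[OF m, unfolded split_beta' prod.collapse] b lin split_beta')
  have dist: "a \<pi> * ((x1 * A + x2 * B + x3 * C + x4 * D) / F) * a \<rho> = (x1 * (a \<pi> * A * a \<rho>) + x2 * (a \<pi> * B * a \<rho>) + x3 * (a \<pi> * C * a \<rho>) + x4 * (a \<pi> * D * a \<rho>)) / F"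
    for \<pi> \<rho> and x1 x2 x3 x4 A B C D F :: real
    by (simp add: algebra_simps add_divide_distrib)
  show ?thesis
    unfolding cov_mat_def dist sum_divide_distrib[symmetric] sum.distrib sum_distrib_left[symmetric] 1 2 3 4 asymp_var_def ..
qed

section \<open>From kernel sums back to pattern counts\<close>

text \<open>A tie between two given labels has probability zero, and there are countably many
  pairs.\<close>

lemma AE_unif_seq_inj: "AE u in unif_seq. inj u"
proof -
  have "AE u in unif_seq. u k \<noteq> u l" if "k \<noteq> l" for k l
  proof -
    interpret U: prob_space unif01 by (rule prob_space_unif01)
    interpret UU: pair_sigma_finite unif01 unif01 ..
    have "AE y in unif01. x \<noteq> y" for x
      unfolding unif01_def by (rule AE_uniform_measureI) (use AE_lborel_singleton[of x] in \<open>auto elim: eventually_mono\<close>)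
    moreover have "{z \<in> space (unif01 \<Otimes>\<^sub>M unif01). fst z \<noteq> snd z} \<in> sets (unif01 \<Otimes>\<^sub>M unif01)"
      unfolding unif01_def by measurable
    ultimately have "AE z in unif01 \<Otimes>\<^sub>M unif01. fst z \<noteq> snd z"
      by (intro UU.AE_pair_measure) auto
    then have "AE z in distr unif_seq (unif01 \<Otimes>\<^sub>M unif01) (\<lambda>u. (u k, u l)). fst z \<noteq> snd z"
      unfolding distr_unif_seq_pair[OF that] .
    from AE_distrD[OF _ this] show ?thesis by simp
  qed
  then have "AE u in unif_seq. k \<noteq> l \<longrightarrow> u k \<noteq> u l" for k l by (cases "k = l") simp_all
  then have "AE u in unif_seq. \<forall>k l. k \<noteq> l \<longrightarrow> u k \<noteq> u l" unfolding AE_all_countable by blast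
  then show ?thesis by (rule eventually_mono) (auto intro: injI)
qed

definition scaled_count :: "nat \<Rightarrow> nat \<Rightarrow> real \<Rightarrow> ((nat \<Rightarrow> nat) \<Rightarrow> real) \<Rightarrow> (nat \<Rightarrow> nat) \<Rightarrow> real" where
  "scaled_count r n p a \<tau> = (\<Sum>\<pi>\<in>Sym r. a \<pi> * ((real (pattern_count n r \<pi> \<tau>) - real (n choose r) * \<mu> r p \<pi>) / real n powr (real r - 1 / 2)))"

text \<open>By \<open>scaled_count_conj\<close> this is the value of \<open>scaled_count\<close> on the conjugate of \<open>\<sigma>\<close> by the
  ranking permutation of \<open>u\<close>.\<close>

definition scaled_sum :: "nat \<Rightarrow> nat \<Rightarrow> real \<Rightarrow> ((nat \<Rightarrow> nat) \<Rightarrow> real) \<Rightarrow> (nat \<Rightarrow> nat) \<Rightarrow> (nat \<Rightarrow> real) \<Rightarrow> real" where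
  "scaled_sum r n p a \<sigma> u = ((\<Sum>i\<in>PiE {1..r} (\<lambda>_. {1..n}). kern r a (\<lambda>b\<in>{1..r}. graph_pt \<sigma> u (i b)))
     - fact r * real (n choose r) * (LINT Z|PiM {1..r} (\<lambda>_. point_law p). kern r a Z)) / (fact r * (real n ^ (r - 1) * sqrt (real n)))"

lemma powr_minus_half:
  assumes "0 < n" "1 \<le> r"
  shows "real n powr (real r - 1 / 2) = real n ^ (r - 1) * sqrt (real n)"
proof -
  have "real n powr (real r - 1 / 2) = real n powr (real (r - 1) + 1 / 2)" using assms by (simp add: of_nat_diff)
  also have "\<dots> = real n ^ (r - 1) * sqrt (real n)"
    using assms by (simp only: powr_add powr_half_sqrt powr_realpow of_nat_0_less_iff of_nat_0_le_iff)
  finally show ?thesis .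
qed

text \<open>Numerator and denominator are multiplied by r!, which converts counts of subsets into
  sums over tuples.\<close>

lemma scaled_count_conj:
  assumes n: "0 < n" and r: "1 \<le> r" and \<sigma>: "\<sigma> \<in> Sym n" and u: "inj u"
  shows "scaled_count r n p a (rank_perm n u \<circ> \<sigma> \<circ> inv (rank_perm n u)) = scaled_sum r n p a \<sigma> u"
proof -
  let ?\<tau> = "rank_perm n u \<circ> \<sigma> \<circ> inv (rank_perm n u)" and ?T = "PiE {1..r} (\<lambda>_. {1..n})" and ?N = "real n powr (real r - 1 / 2)"
  have u': "inj_on u {1..n}" using u by (rule inj_on_subset) simp
  have img: "(\<lambda>b\<in>{1..r}. graph_pt \<sigma> u (i b)) ` {1..r} = (\<lambda>b. graph_pt \<sigma> u (i b)) ` {1..r}" for i :: "nat \<Rightarrow> nat" by simp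
  have "(\<Sum>i\<in>?T. kern r a (\<lambda>b\<in>{1..r}. graph_pt \<sigma> u (i b)))
    = (\<Sum>\<pi>\<in>Sym r. a \<pi> * (\<Sum>i\<in>?T. indicator {P. is_Perm r P \<pi>} ((\<lambda>b. graph_pt \<sigma> u (i b)) ` {1..r})))"
    unfolding kern_def img sum_distrib_left by (rule sum.swap)
  also have "\<dots> = (\<Sum>\<pi>\<in>Sym r. a \<pi> * (fact r * real (pattern_count n r \<pi> ?\<tau>)))"
    using pattern_count_conj_rank_tuples[OF u' \<sigma>] by (intro sum.cong refl) simp
  also have "\<dots> = fact r * (\<Sum>\<pi>\<in>Sym r. a \<pi> * real (pattern_count n r \<pi> ?\<tau>))"
    by (simp add: sum_distrib_left mult_ac)
  finally have 1: "(\<Sum>i\<in>?T. kern r a (\<lambda>b\<in>{1..r}. graph_pt \<sigma> u (i b))) = fact r * (\<Sum>\<pi>\<in>Sym r. a \<pi> * real (pattern_count n r \<pi> ?\<tau>))" .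
  have "scaled_count r n p a ?\<tau> = (\<Sum>\<pi>\<in>Sym r. (a \<pi> * real (pattern_count n r \<pi> ?\<tau>) - real (n choose r) * (a \<pi> * \<mu> r p \<pi>)) / ?N)"
    unfolding scaled_count_def by (intro sum.cong refl) (simp add: algebra_simps)
  also have "\<dots> = ((\<Sum>\<pi>\<in>Sym r. a \<pi> * real (pattern_count n r \<pi> ?\<tau>)) - real (n choose r) * (\<Sum>\<pi>\<in>Sym r. a \<pi> * \<mu> r p \<pi>)) / ?N"
    by (simp only: sum_divide_distrib[symmetric] sum_subtractf sum_distrib_left)
  also have "\<dots> = (fact r * ((\<Sum>\<pi>\<in>Sym r. a \<pi> * real (pattern_count n r \<pi> ?\<tau>)) - real (n choose r) * (\<Sum>\<pi>\<in>Sym r. a \<pi> * \<mu> r p \<pi>))) / (fact r * ?N)"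
    by (rule mult_divide_mult_cancel_left[symmetric]) simp
  finally show ?thesis
    unfolding scaled_sum_def 1 sum_\<mu>[symmetric] powr_minus_half[OF n r, symmetric] by (simp only: right_diff_distrib mult.assoc)
qed

text \<open>n^r counts all tuples, r! times the binomial the injective ones.
  \<open>scaled_count\<close> is centred with the latter, the tuple sum naturally with the former;
  the gap is of order n^(r-1), below the scale n^(r - 1/2).\<close>

lemma power_minus_fact_choose:
  "\<bar>real n ^ r - fact r * real (n choose r)\<bar> \<le> (real r)\<^sup>2 * real n ^ (r - 1)"
proof -
  have *: "fact r * real (n choose r) \<le> real n ^ r \<and> real n ^ r - fact r * real (n choose r) \<le> (real r)\<^sup>2 * real n ^ (r - 1)"
  proof (induction r)
    case (Suc r)
    let ?F = "fact r * real (n choose r)"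
    have "Suc r * (n choose Suc r) = (n - r) * (n choose r)" by (simp only: binomial_absorption binomial_absorb_comp)
    \<comment> \<open>Natural subtraction truncates for \<open>r > n\<close>, but then the binomial
      vanishes.\<close>
    then have "real (Suc r) * real (n choose Suc r) = (real n - real r) * real (n choose r)"
      by (cases "r \<le> n") (simp_all only: of_nat_mult[symmetric] of_nat_diff[symmetric] binomial_eq_0 not_le of_nat_0 mult_zero_right)
    then have F: "fact (Suc r) * real (n choose Suc r) = (real n - real r) * ?F"
      by (simp only: fact_Suc of_nat_mult mult.assoc mult.left_commute[of _ "fact r"])
    have F0: "0 \<le> real r * ?F" by simp
    have 1: "real n * ?F \<le> real n * real n ^ r" using Suc by (intro mult_left_mono) auto
    have 2: "real r * ?F \<le> real r * real n ^ r" using Suc by (intro mult_left_mono) auto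
    have "real n * (real n ^ r - ?F) \<le> real n * ((real r)\<^sup>2 * real n ^ (r - 1))" using Suc by (intro mult_left_mono) auto
    also have "\<dots> = (real r)\<^sup>2 * real n ^ r" by (cases r) auto
    finally have 3: "real n * (real n ^ r - ?F) \<le> (real r)\<^sup>2 * real n ^ r" .
    have "(real n - real r) * ?F \<le> real n * ?F" using F0 unfolding left_diff_distrib by linarith
    also note 1
    finally have 4: "(real n - real r) * ?F \<le> real n ^ Suc r" by simp
    have "real n ^ Suc r - (real n - real r) * ?F = real n * (real n ^ r - ?F) + real r * ?F" by (simp add: algebra_simps)
    also have "\<dots> \<le> (real r)\<^sup>2 * real n ^ r + real r * real n ^ r" by (rule add_mono[OF 3 2])
    also have "\<dots> = ((real r)\<^sup>2 + real r) * real n ^ r" by (rule distrib_right[symmetric])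
    also have "\<dots> \<le> (real (Suc r))\<^sup>2 * real n ^ r" by (rule mult_right_mono) (simp_all add: power2_eq_square algebra_simps)
    finally show ?case using 4 unfolding F by simp
  qed simp
  then show ?thesis by simp
qed

section \<open>Bounds for a fixed permutation in terms of its fixed points and 2-cycles\<close>

context
  fixes n r :: nat and \<sigma> :: "nat \<Rightarrow> nat" and a :: "(nat \<Rightarrow> nat) \<Rightarrow> real" and p q s :: real
  assumes n: "0 < n" and r: "1 \<le> r" and \<sigma>: "\<sigma> \<in> Sym n" and p: "p \<in> {0..1}"
    and q: "q = real (card {k \<in> {1..n}. \<sigma> k = k}) / real n"
    and s: "s = real (card {k \<in> {1..n}. \<sigma> k \<noteq> k \<and> \<sigma> (\<sigma> k) = k}) / real n"
begin

interpretation gk: graph_kernel n r \<sigma> "kern r a" "kern_bound r a"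
  by (rule graph_kernel_kern[OF n r \<sigma>])

interpretation P: prob_space unif_seq by (rule prob_space_unif_seq)

lemma fixq_eq: "gk.fixq = q"
  unfolding gk.fixq_def q ..

lemma limvar_eq: "gk.limvar = asymp_var r q s (\<Psi> r a q)"
proof -
  have "{1..r} - {r} = {1..<r}" by auto
  then have g: "gk.g r = \<Psi> r a q"
    unfolding gk.g_def[abs_def] \<Psi>_def[abs_def] gk.\<Lambda>_def fixq_eq by simp
  have c: "gk.c1 = cov1 (\<Psi> r a q)" "gk.c2 = cov2 (\<Psi> r a q)" "gk.c3 = cov3 (\<Psi> r a q)" "gk.c4 = cov4 (\<Psi> r a q)"
    unfolding gk.c1_def gk.c2_def gk.c3_def gk.c4_def cov1_def cov2_def cov3_def cov4_def g by (rule refl)+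
  have t: "real gk.t1 = real n * q" "real gk.t2 = real n * s"
    unfolding gk.t1_def gk.t2_def q s using n by auto
  have f: "(fact r :: real) = real r * fact (r - 1)" using r by (simp add: fact_reduce)
  have "(real n * q * x1 + (real n - real n * q) * x2 + real n * s * x3 + 2 * (real n - real n * q - real n * s) * x4) / real n
    = q * x1 + (1 - q) * x2 + s * x3 + 2 * (1 - q - s) * x4" for x1 x2 x3 x4
    using n by (simp add: field_simps)
  moreover have "(real r)\<^sup>2 / (fact r)\<^sup>2 * y = y / (fact (r - 1))\<^sup>2" for y :: real
    unfolding f using r by (simp add: power_mult_distrib)
  ultimately show ?thesis unfolding gk.limvar_def asymp_var_def c t by simp
qed

text \<open>\<open>\<delta>\<close> collects the errors of centring: 6 r^2 from tuples with an
  internal link, r^2 from tuples against subsets, and 2 r times the deviation of the number of fixed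
  points, from the Lipschitz bound between \<open>q\<close> and \<open>p\<close>.\<close>

lemma scaled_sum_eq:
  "\<exists>\<delta>. (\<forall>u. scaled_sum r n p a \<sigma> u = gk.dn.W u + \<delta>) \<and>
    \<bar>\<delta>\<bar> \<le> (7 * (real r)\<^sup>2 + 2 * real r * \<bar>real n * q - real n * p\<bar>) * kern_bound r a / sqrt (real n)"
proof (intro exI conjI allI)
  let ?M = "\<lambda>p. LINT Z|PiM {1..r} (\<lambda>_. point_law p). kern r a Z"
  let ?N = "fact r * (real n ^ (r - 1) * sqrt (real n))" and ?E = "\<Sum>i\<in>gk.T. LINT u|unif_seq. gk.X i u"
  let ?K = "kern_bound r a"
  let ?\<delta> = "(?E - fact r * real (n choose r) * ?M p) / ?N"
  show "scaled_sum r n p a \<sigma> u = gk.dn.W u + ?\<delta>" for u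
    unfolding scaled_sum_def gk.dn.W_def gk.Z_def gk.X_def[symmetric] gk.T_def[symmetric]
    by (simp only: sum_divide_distrib[symmetric] sum_subtractf add_divide_distrib[symmetric]) simp
  have q01: "q \<in> {0..1}" using gk.fixq unfolding fixq_eq .
  have K: "0 \<le> ?K" by (rule kern_bound_nonneg)
  interpret Q: prob_space "PiM {1..r} (\<lambda>_. point_law p)" by (intro prob_space_PiM prob_space_point_law)
  have M: "\<bar>?M p\<bar> \<le> ?K"
    using Q.norm_integral_le_const[of "kern r a" ?K] bdd_meas_kern[of r a] by (simp add: bdd_meas_def)
  have 1: "\<bar>?E - real n ^ r * ?M q\<bar> \<le> 6 * (real r)\<^sup>2 * ?K * real n ^ (r - 1)"
    using gk.sum_expectation_X unfolding gk.\<Lambda>_def fixq_eq .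
  have "\<bar>?M q - ?M p\<bar> \<le> real (card {1..r}) * (2 * ?K * \<bar>q - p\<bar>)"
    by (rule integral_PiM_point_law_lipschitz[OF q01 p _ bdd_meas_kern]) simp
  then have "real n ^ r * \<bar>?M q - ?M p\<bar> \<le> real n ^ r * (real r * (2 * ?K * \<bar>q - p\<bar>))"
    by (intro mult_left_mono) auto
  also have "\<dots> = 2 * real r * \<bar>real n * q - real n * p\<bar> * ?K * real n ^ (r - 1)"
    using r by (cases r) (auto simp: right_diff_distrib[symmetric] abs_mult)
  finally have 2: "\<bar>real n ^ r * ?M q - real n ^ r * ?M p\<bar> \<le> 2 * real r * \<bar>real n * q - real n * p\<bar> * ?K * real n ^ (r - 1)"
    by (simp add: right_diff_distrib[symmetric] abs_mult)
  have "\<bar>real n ^ r - fact r * real (n choose r)\<bar> * \<bar>?M p\<bar> \<le> ((real r)\<^sup>2 * real n ^ (r - 1)) * ?K"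
    by (intro mult_mono power_minus_fact_choose M) auto
  then have 3: "\<bar>real n ^ r * ?M p - fact r * real (n choose r) * ?M p\<bar> \<le> (real r)\<^sup>2 * ?K * real n ^ (r - 1)"
    unfolding left_diff_distrib[symmetric] abs_mult by (simp only: mult_ac)
  let ?B = "(7 * (real r)\<^sup>2 + 2 * real r * \<bar>real n * q - real n * p\<bar>) * ?K"
  have "\<bar>?E - fact r * real (n choose r) * ?M p\<bar> \<le> 6 * (real r)\<^sup>2 * ?K * real n ^ (r - 1) + 2 * real r * \<bar>real n * q - real n * p\<bar> * ?K * real n ^ (r - 1)
     + (real r)\<^sup>2 * ?K * real n ^ (r - 1)"
    using 1 2 3 by linarith
  also have "\<dots> = ?B * real n ^ (r - 1)" by (simp add: algebra_simps)
  finally have B: "\<bar>?E - fact r * real (n choose r) * ?M p\<bar> \<le> ?B * real n ^ (r - 1)" .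
  have pos: "0 < real n ^ (r - 1)" "0 < sqrt (real n)" "0 \<le> ?B" using n K by auto
  have "\<bar>?\<delta>\<bar> \<le> ?B * real n ^ (r - 1) / ?N"
  proof -
    have "\<bar>?N\<bar> = ?N" using pos(1,2) by simp
    then show ?thesis unfolding abs_divide by (simp only:) (rule divide_right_mono[OF B], use pos(1,2) in simp)
  qed
  also have "\<dots> \<le> ?B * real n ^ (r - 1) / (real n ^ (r - 1) * sqrt (real n))"
  proof (rule divide_left_mono)
    have "1 * (real n ^ (r - 1) * sqrt (real n)) \<le> ?N" using pos(1,2) by (intro mult_right_mono fact_ge_1) auto
    then show "real n ^ (r - 1) * sqrt (real n) \<le> ?N" by simp
    show "0 \<le> ?B * real n ^ (r - 1)" using pos(1) by (intro mult_nonneg_nonneg[OF pos(3)]) simp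
    show "0 < ?N * (real n ^ (r - 1) * sqrt (real n))" using pos(1,2) by simp
  qed
  also have "\<dots> = ?B / sqrt (real n)" using pos(1,2) by simp
  finally show "\<bar>?\<delta>\<bar> \<le> ?B / sqrt (real n)" .
qed

lemma var_nonneg: "0 \<le> gk.dn.var"
  unfolding gk.dn.var_def by (rule Bochner_Integration.integral_nonneg) simp

text \<open>Nonnegativity of the true variance survives the approximation up to its error. In the
  limit this makes the quadratic form nonnegative, without which no Gaussian law exists.\<close>

lemma asymp_var_ge:
  "- (54 * real r ^ 4 * (1 + (real r)\<^sup>2) * (kern_bound r a)\<^sup>2 / ((fact r)\<^sup>2 * real n)) \<le> asymp_var r q s (\<Psi> r a q)"
  using gk.var_limvar var_nonneg unfolding limvar_eq by linarith

lemma scaled_sum_meas [measurable]: "scaled_sum r n p a \<sigma> \<in> borel_measurable unif_seq"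
proof -
  obtain \<delta> where "\<And>u. scaled_sum r n p a \<sigma> u = gk.dn.W u + \<delta>" using scaled_sum_eq by blast
  then have "scaled_sum r n p a \<sigma> = (\<lambda>u. gk.dn.W u + \<delta>)" by (rule ext)
  then show ?thesis by simp
qed

lemma integrable_W: "integrable unif_seq gk.dn.W" "integrable unif_seq (\<lambda>u. (gk.dn.W u)\<^sup>2)"
proof -
  obtain C where C: "\<And>u. \<bar>gk.dn.W u\<bar> \<le> C" using gk.dn.abs_W_le by blast
  show "integrable unif_seq gk.dn.W"
    using C by (intro P.integrable_const_bound[of _ C]) auto
  have "\<bar>gk.dn.W u\<bar>\<^sup>2 \<le> C\<^sup>2" for u using C by (intro power_mono) auto
  then show "integrable unif_seq (\<lambda>u. (gk.dn.W u)\<^sup>2)"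
    by (intro P.integrable_const_bound[of _ "C\<^sup>2"]) auto
qed

text \<open>The square of \<open>W + \<delta>\<close> is at most twice the sum of the squares; the
  bound provides tightness.\<close>

lemma scaled_sum_second_moment:
  "integrable unif_seq (\<lambda>u. (scaled_sum r n p a \<sigma> u)\<^sup>2)" (is ?I)
  "(LINT u|unif_seq. (scaled_sum r n p a \<sigma> u)\<^sup>2) \<le> 2 * (asymp_var r q s (\<Psi> r a q) + 54 * real r ^ 4 * (1 + (real r)\<^sup>2) * (kern_bound r a)\<^sup>2 / ((fact r)\<^sup>2 * real n))
     + 2 * ((7 * (real r)\<^sup>2 + 2 * real r * \<bar>real n * q - real n * p\<bar>) * kern_bound r a / sqrt (real n))\<^sup>2" (is "?L \<le> 2 * ?V + 2 * ?D\<^sup>2")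
proof -
  obtain \<delta> where \<delta>: "\<And>u. scaled_sum r n p a \<sigma> u = gk.dn.W u + \<delta>" "\<bar>\<delta>\<bar> \<le> ?D" using scaled_sum_eq by blast
  have e: "(scaled_sum r n p a \<sigma> u)\<^sup>2 = (gk.dn.W u)\<^sup>2 + 2 * \<delta> * gk.dn.W u + \<delta>\<^sup>2" for u
    unfolding \<delta>(1) by (simp add: power2_eq_square algebra_simps)
  show i: ?I unfolding e using integrable_W by simp
  have "?L \<le> (LINT u|unif_seq. 2 * (gk.dn.W u)\<^sup>2 + 2 * \<delta>\<^sup>2)"
  proof (rule integral_mono[OF i])
    show "integrable unif_seq (\<lambda>u. 2 * (gk.dn.W u)\<^sup>2 + 2 * \<delta>\<^sup>2)" using integrable_W by simp
    show "(scaled_sum r n p a \<sigma> u)\<^sup>2 \<le> 2 * (gk.dn.W u)\<^sup>2 + 2 * \<delta>\<^sup>2" for u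
      using sum_squares_bound[of "gk.dn.W u" \<delta>] unfolding e by (simp add: mult_ac)
  qed
  also have "\<dots> = 2 * gk.dn.var + 2 * \<delta>\<^sup>2" using integrable_W by (simp add: gk.dn.var_def P.prob_space)
  also have "gk.dn.var \<le> ?V" using gk.var_limvar unfolding limvar_eq by linarith
  also have "\<delta>\<^sup>2 \<le> ?D\<^sup>2" using \<delta>(2) abs_le_square_iff[of \<delta> ?D] by linarith
  finally show "?L \<le> 2 * ?V + 2 * ?D\<^sup>2" by linarith
qed

text \<open>Three comparisons: the shift \<open>\<delta>\<close> moves the exponential by at most
  its size, \<open>W\<close> is nearly Gaussian with its own variance, and that variance is near
  \<open>Q\<close>.\<close>

lemma char_scaled_sum:
  assumes Q: "0 \<le> Q"
  shows "cmod ((CLINT u|unif_seq. iexp (scaled_sum r n p a \<sigma> u)) - complex_of_real (exp (- Q / 2)))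
    \<le> (7 * (real r)\<^sup>2 + 2 * real r * \<bar>real n * q - real n * p\<bar>) * kern_bound r a / sqrt (real n)
      + 252 * real r ^ 4 * (kern_bound r a) ^ 3 / (fact r) ^ 3 / sqrt (real n)
      + (\<bar>asymp_var r q s (\<Psi> r a q) - Q\<bar> + 54 * real r ^ 4 * (1 + (real r)\<^sup>2) * (kern_bound r a)\<^sup>2 / ((fact r)\<^sup>2 * real n)) / 2"
    (is "_ \<le> ?D + ?C + (_ + ?V) / 2")
proof -
  obtain \<delta> where \<delta>: "\<And>u. scaled_sum r n p a \<sigma> u = gk.dn.W u + \<delta>" "\<bar>\<delta>\<bar> \<le> ?D" using scaled_sum_eq by blast
  have i: "integrable unif_seq (\<lambda>u. iexp (f u))" if [measurable]: "f \<in> borel_measurable unif_seq" for f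
    by (rule P.integrable_const_bound[of _ 1]) auto
  have 1: "cmod ((CLINT u|unif_seq. iexp (scaled_sum r n p a \<sigma> u)) - (CLINT u|unif_seq. iexp (gk.dn.W u))) \<le> ?D"
  proof (rule P.norm_integral_diff_le)
    fix u
    have "cmod (iexp (gk.dn.W u + \<delta>) - iexp (gk.dn.W u)) \<le> \<bar>gk.dn.W u + \<delta> - gk.dn.W u\<bar>" by (rule cmod_iexp_diff_le)
    then show "cmod (iexp (scaled_sum r n p a \<sigma> u) - iexp (gk.dn.W u)) \<le> ?D"
      using \<delta>(2) unfolding \<delta>(1) by simp
  qed (auto intro!: i)
  \<comment> \<open>On the nonnegative half-line exp(-x/2) is Lipschitz with constant 1/2; the
    ordered case suffices by symmetry.\<close>
  have 2: "\<bar>exp (- x / 2) - exp (- y / 2)\<bar> \<le> \<bar>x - y\<bar> / 2" if "0 \<le> x" "x \<le> y" for x y :: real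
  proof -
    have "1 - exp ((x - y) / 2) \<le> (y - x) / 2" using exp_ge_add_one_self[of "(x - y) / 2"] by argo
    moreover have "0 \<le> 1 - exp ((x - y) / 2)" using that by simp
    ultimately have "exp (- x / 2) * (1 - exp ((x - y) / 2)) \<le> 1 * ((y - x) / 2)"
      using that by (intro mult_mono) simp_all
    moreover have "exp (- x / 2) * (1 - exp ((x - y) / 2)) = exp (- x / 2) - exp (- y / 2)"
      by (simp add: right_diff_distrib exp_add[symmetric] diff_divide_distrib)
    moreover have "exp (- y / 2) \<le> exp (- x / 2)" using that by simp
    ultimately show ?thesis using that by simp
  qed
  have "\<bar>exp (- gk.dn.var / 2) - exp (- Q / 2)\<bar> \<le> \<bar>gk.dn.var - Q\<bar> / 2"
    using 2[of gk.dn.var Q] 2[of Q gk.dn.var] Q var_nonneg by (cases "gk.dn.var \<le> Q") (auto simp: abs_minus_commute)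
  moreover have "\<bar>gk.dn.var - Q\<bar> \<le> \<bar>asymp_var r q s (\<Psi> r a q) - Q\<bar> + ?V"
    using gk.var_limvar unfolding limvar_eq by linarith
  ultimately have "\<bar>exp (- gk.dn.var / 2) - exp (- Q / 2)\<bar> \<le> (\<bar>asymp_var r q s (\<Psi> r a q) - Q\<bar> + ?V) / 2"
    by (rule order_trans[OF _ divide_right_mono]) simp
  then have 3: "cmod (complex_of_real (exp (- gk.dn.var / 2)) - complex_of_real (exp (- Q / 2))) \<le> (\<bar>asymp_var r q s (\<Psi> r a q) - Q\<bar> + ?V) / 2"
    by (simp only: of_real_diff[symmetric] norm_of_real)
  show ?thesis
    by (rule norm_diff_triangle_le[OF norm_diff_triangle_le[OF 1 gk.char_W] 3])
qed

end

section \<open>Randomising the permutation by conjugation\<close>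

text \<open>For injective \<open>u\<close>, conjugation by the ranking permutation permutes the
  class, so the sum over \<open>\<sigma>\<close> is the same constant for almost every
  \<open>u\<close>; integrating that constant gives the identity. The labels thus enter without
  changing the uniform law on the class.\<close>

lemma average_scaled_sum:
  fixes \<phi> :: "real \<Rightarrow> 'b::{banach, second_countable_topology}"
  assumes n: "0 < n" and r: "1 \<le> r" and \<phi>: "\<phi> \<in> borel_measurable borel"
    and int: "\<And>\<sigma>. \<sigma> \<in> cyclic_perms n t \<Longrightarrow> integrable unif_seq (\<lambda>u. \<phi> (scaled_sum r n p a \<sigma> u))"
  shows "(\<Sum>\<tau>\<in>cyclic_perms n t. \<phi> (scaled_count r n p a \<tau>)) = (\<Sum>\<sigma>\<in>cyclic_perms n t. LINT u|unif_seq. \<phi> (scaled_sum r n p a \<sigma> u))"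
proof -
  interpret P: prob_space unif_seq by (rule prob_space_unif_seq)
  let ?S = "\<Sum>\<tau>\<in>cyclic_perms n t. \<phi> (scaled_count r n p a \<tau>)"
  have e: "(\<Sum>\<sigma>\<in>cyclic_perms n t. \<phi> (scaled_sum r n p a \<sigma> u)) = ?S" if "inj u" for u
  proof -
    have "rank_perm n u \<in> Sym n" using that by (intro rank_perm_Sym) (rule inj_on_subset, auto)
    then have "?S = (\<Sum>\<sigma>\<in>cyclic_perms n t. \<phi> (scaled_count r n p a (rank_perm n u \<circ> \<sigma> \<circ> inv (rank_perm n u))))"
      by (rule sum_cyclic_perms_conj[symmetric])
    also have "\<dots> = (\<Sum>\<sigma>\<in>cyclic_perms n t. \<phi> (scaled_sum r n p a \<sigma> u))"
    proof (rule sum.cong[OF refl])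
      fix \<sigma> assume "\<sigma> \<in> cyclic_perms n t"
      then have "\<sigma> \<in> Sym n" by (simp add: cyclic_perms_def)
      then show "\<phi> (scaled_count r n p a (rank_perm n u \<circ> \<sigma> \<circ> inv (rank_perm n u))) = \<phi> (scaled_sum r n p a \<sigma> u)"
        by (simp only: scaled_count_conj[OF n r _ that])
    qed
    finally show ?thesis ..
  qed
  have "(\<Sum>\<sigma>\<in>cyclic_perms n t. LINT u|unif_seq. \<phi> (scaled_sum r n p a \<sigma> u)) = (LINT u|unif_seq. (\<Sum>\<sigma>\<in>cyclic_perms n t. \<phi> (scaled_sum r n p a \<sigma> u)))"
    by (rule Bochner_Integration.integral_sum[OF int, symmetric])
  also have "\<dots> = (LINT u|unif_seq. ?S)"
  proof (rule integral_cong_AE)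
    show "(\<lambda>u. \<Sum>\<sigma>\<in>cyclic_perms n t. \<phi> (scaled_sum r n p a \<sigma> u)) \<in> borel_measurable unif_seq"
      by (intro borel_measurable_sum borel_measurable_integrable int)
    show "AE u in unif_seq. (\<Sum>\<sigma>\<in>cyclic_perms n t. \<phi> (scaled_sum r n p a \<sigma> u)) = ?S"
      using AE_unif_seq_inj by (rule eventually_mono) (rule e)
  qed simp
  finally show ?thesis by (simp add: P.prob_space)
qed

context
  fixes n r :: nat and t :: "nat \<Rightarrow> nat" and p :: real
  assumes ne: "cyclic_perms n t \<noteq> {}"
begin

lemma sets_rescaled_counts_law: "sets (rescaled_counts_law r p n t) = sets (PiM (Sym r) (\<lambda>_. borel))"
  by (simp add: rescaled_counts_law_def)

lemma prob_space_rescaled_counts_law: "prob_space (rescaled_counts_law r p n t)"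
  unfolding rescaled_counts_law_def
  by (rule prob_space.prob_space_distr[OF prob_space_measure_pmf]) (simp add: space_PiM)

lemma
  fixes \<phi> :: "real \<Rightarrow> 'b::{banach, second_countable_topology}"
  assumes \<phi> [measurable]: "\<phi> \<in> borel_measurable borel"
  shows integral_rescaled_counts_law:
      "(LINT x|rescaled_counts_law r p n t. \<phi> (\<Sum>\<pi>\<in>Sym r. a \<pi> * x \<pi>))
        = (1 / real (card (cyclic_perms n t))) *\<^sub>R (\<Sum>\<tau>\<in>cyclic_perms n t. \<phi> (scaled_count r n p a \<tau>))"
    and integrable_rescaled_counts_law: "integrable (rescaled_counts_law r p n t) (\<lambda>x. \<phi> (\<Sum>\<pi>\<in>Sym r. a \<pi> * x \<pi>))"
proof -
  let ?C = "cyclic_perms n t" and ?v = "\<lambda>\<tau>. \<lambda>\<pi>\<in>Sym r. (real (pattern_count n r \<pi> \<tau>) - real (n choose r) * \<mu> r p \<pi>) / real n powr (real r - 1 / 2)"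
  have v: "?v \<in> measurable (measure_pmf (pmf_of_set ?C)) (PiM (Sym r) (\<lambda>_. borel))" by (simp add: space_PiM)
  have m: "(\<lambda>x. \<phi> (\<Sum>\<pi>\<in>Sym r. a \<pi> * x \<pi>)) \<in> borel_measurable (PiM (Sym r) (\<lambda>_. borel))" by measurable
  have s: "(\<Sum>\<pi>\<in>Sym r. a \<pi> * ?v \<tau> \<pi>) = scaled_count r n p a \<tau>" for \<tau>
    unfolding scaled_count_def by (rule sum.cong) auto
  have "(LINT x|rescaled_counts_law r p n t. \<phi> (\<Sum>\<pi>\<in>Sym r. a \<pi> * x \<pi>)) = measure_pmf.expectation (pmf_of_set ?C) (\<lambda>\<tau>. \<phi> (scaled_count r n p a \<tau>))"
    unfolding rescaled_counts_law_def integral_distr[OF v m] s ..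
  also have "\<dots> = (\<Sum>\<tau>\<in>?C. pmf (pmf_of_set ?C) \<tau> *\<^sub>R \<phi> (scaled_count r n p a \<tau>))"
    by (rule integral_measure_pmf) (use ne in auto)
  also have "\<dots> = (\<Sum>\<tau>\<in>?C. (1 / real (card ?C)) *\<^sub>R \<phi> (scaled_count r n p a \<tau>))"
    by (rule sum.cong) (use ne in auto)
  also have "\<dots> = (1 / real (card ?C)) *\<^sub>R (\<Sum>\<tau>\<in>?C. \<phi> (scaled_count r n p a \<tau>))" by (rule scaleR_sum_right[symmetric])
  finally show "(LINT x|rescaled_counts_law r p n t. \<phi> (\<Sum>\<pi>\<in>Sym r. a \<pi> * x \<pi>))
    = (1 / real (card ?C)) *\<^sub>R (\<Sum>\<tau>\<in>?C. \<phi> (scaled_count r n p a \<tau>))" .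
  have "integrable (measure_pmf (pmf_of_set ?C)) (\<lambda>\<tau>. \<phi> (scaled_count r n p a \<tau>))"
    by (rule integrable_measure_pmf_finite) (use ne in auto)
  then show "integrable (rescaled_counts_law r p n t) (\<lambda>x. \<phi> (\<Sum>\<pi>\<in>Sym r. a \<pi> * x \<pi>))"
    unfolding rescaled_counts_law_def integrable_distr_eq[OF v m] s .
qed

lemma integral_rescaled_counts_law_scaled_sum:
  fixes \<phi> :: "real \<Rightarrow> 'b::{banach, second_countable_topology}"
  assumes n: "0 < n" and r: "1 \<le> r" and \<phi>: "\<phi> \<in> borel_measurable borel"
    and int: "\<And>\<sigma>. \<sigma> \<in> cyclic_perms n t \<Longrightarrow> integrable unif_seq (\<lambda>u. \<phi> (scaled_sum r n p a \<sigma> u))"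
  shows "(LINT x|rescaled_counts_law r p n t. \<phi> (\<Sum>\<pi>\<in>Sym r. a \<pi> * x \<pi>))
    = (1 / real (card (cyclic_perms n t))) *\<^sub>R (\<Sum>\<sigma>\<in>cyclic_perms n t. LINT u|unif_seq. \<phi> (scaled_sum r n p a \<sigma> u))"
  by (simp only: integral_rescaled_counts_law[OF \<phi>] average_scaled_sum[OF n r \<phi> int])

end

lemma average_diff_le:
  fixes f :: "'i \<Rightarrow> complex"
  assumes "finite A" "A \<noteq> {}" "\<And>i. i \<in> A \<Longrightarrow> cmod (f i - c) \<le> e"
  shows "cmod ((1 / real (card A)) *\<^sub>R (\<Sum>i\<in>A. f i) - c) \<le> e"
proof -
  have c: "0 < real (card A)" using assms by (simp add: card_gt_0_iff)
  have "(1 / real (card A)) *\<^sub>R (\<Sum>i\<in>A. f i) - c = (1 / real (card A)) *\<^sub>R (\<Sum>i\<in>A. f i - c)"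
    using c by (simp add: sum_subtractf scaleR_diff_right) (simp add: scaleR_conv_of_real)
  then have "cmod ((1 / real (card A)) *\<^sub>R (\<Sum>i\<in>A. f i) - c) = (1 / real (card A)) * cmod (\<Sum>i\<in>A. f i - c)"
    by simp
  also have "\<dots> \<le> (1 / real (card A)) * (real (card A) * e)"
    by (intro mult_left_mono order_trans[OF norm_sum] sum_bounded_above assms) auto
  also have "\<dots> = e" using c by simp
  finally show ?thesis .
qed

text \<open>The covariances are Lipschitz in the function, \<open>\<Psi>\<close> is Lipschitz in its
  parameter, and the coefficients converge.\<close>

lemma asymp_var_tendsto:
  assumes r: "1 \<le> r" and q: "\<And>n. q n \<in> {0..1}" "q \<longlonglongrightarrow> p1" and p1: "p1 \<in> {0..1}" and s: "s \<longlonglongrightarrow> p2"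
  shows "(\<lambda>n. asymp_var r (q n) (s n) (\<Psi> r a (q n))) \<longlonglongrightarrow> asymp_var r p1 p2 (\<Psi> r a p1)"
proof -
  let ?K = "kern_bound r a"
  have l: "(\<lambda>n. 4 * ?K * (2 * real r * ?K * \<bar>q n - p1\<bar>)) \<longlonglongrightarrow> 0"
  proof -
    have "(\<lambda>n. 4 * ?K * (2 * real r * ?K * \<bar>q n - p1\<bar>)) \<longlonglongrightarrow> 4 * ?K * (2 * real r * ?K * \<bar>p1 - p1\<bar>)"
      by (intro tendsto_intros q(2))
    then show ?thesis by simp
  qed
  have c: "(\<lambda>n. F (\<Psi> r a (q n))) \<longlonglongrightarrow> F (\<Psi> r a p1)"
    if "\<And>n. \<bar>F (\<Psi> r a (q n)) - F (\<Psi> r a p1)\<bar> \<le> 4 * ?K * (2 * real r * ?K * \<bar>q n - p1\<bar>)" for F :: "(real \<times> real \<Rightarrow> real) \<Rightarrow> real"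
    by (rule Lim_transform[OF tendsto_const], rule tendsto_norm_zero_cancel, rule tendsto_sandwich[OF _ _ tendsto_const l])
       (use that in \<open>auto simp: abs_minus_commute\<close>)
  note d = covs_diff_le[OF \<Psi>_meas[OF r] \<Psi>_meas[OF r] \<Psi>_bound \<Psi>_bound \<Psi>_lipschitz[OF r q(1) p1]]
  show ?thesis unfolding asymp_var_def
    by (intro tendsto_intros q(2) s c d) simp
qed

section \<open>Limits along the sequence of cycle types\<close>

context
  fixes t :: "nat \<Rightarrow> nat \<Rightarrow> nat" and p1 p2 :: real and r :: nat
  assumes t: "\<And>n. is_cycle_type n (t n)" and p1: "p1 \<in> {0..1}"
    and t1: "(\<lambda>n. real (t n 1) - real n * p1) \<in> o(\<lambda>n. sqrt (real n))"
    and t2: "(\<lambda>n. 2 * real (t n 2) - real n * p2) \<in> o(\<lambda>n. real n)"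
    and r: "1 \<le> r"
begin

definition "fix_frac n = real (t n 1) / real n"
definition "two_frac n = 2 * real (t n 2) / real n"
definition "var_err a n = 54 * real r ^ 4 * (1 + (real r)\<^sup>2) * (kern_bound r a)\<^sup>2 / ((fact r)\<^sup>2 * real n)"
definition "mean_err a n = (7 * (real r)\<^sup>2 + 2 * real r * \<bar>real n * fix_frac n - real n * p1\<bar>) * kern_bound r a / sqrt (real n)"
definition "char_err a n = 252 * real r ^ 4 * (kern_bound r a) ^ 3 / (fact r) ^ 3 / sqrt (real n)"
definition "lim_var a = asymp_var r p1 p2 (\<Psi> r a p1)"
definition "fin_var a n = asymp_var r (fix_frac n) (two_frac n) (\<Psi> r a (fix_frac n))"

lemma ne: "cyclic_perms n (t n) \<noteq> {}"
  by (rule cyclic_perms_nonempty[OF t])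

text \<open>\<open>cyclic_perms\<close> prescribes cycle counts for lengths up to \<open>n\<close>
  only, so \<open>t n 2\<close> says something about \<open>\<sigma>\<close> from n = 2 on.\<close>

lemma member:
  assumes "\<sigma> \<in> cyclic_perms n (t n)" "2 \<le> n"
  shows "\<sigma> \<in> Sym n" "fix_frac n = real (card {k \<in> {1..n}. \<sigma> k = k}) / real n"
    "two_frac n = real (card {k \<in> {1..n}. \<sigma> k \<noteq> k \<and> \<sigma> (\<sigma> k) = k}) / real n"
proof -
  show \<sigma>: "\<sigma> \<in> Sym n" using assms by (simp add: cyclic_perms_def)
  have "num_cycles n \<sigma> 1 = t n 1" "num_cycles n \<sigma> 2 = t n 2" using assms by (auto simp: cyclic_perms_def)
  then show "fix_frac n = real (card {k \<in> {1..n}. \<sigma> k = k}) / real n"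
    "two_frac n = real (card {k \<in> {1..n}. \<sigma> k \<noteq> k \<and> \<sigma> (\<sigma> k) = k}) / real n"
    unfolding fix_frac_def two_frac_def card_fixed_points[OF \<sigma>] card_two_cycle_points[OF \<sigma>] by simp_all
qed

lemma fix_frac_bounds: "2 \<le> n \<Longrightarrow> fix_frac n \<in> {0..1}"
proof -
  assume n: "2 \<le> n"
  obtain \<sigma> where \<sigma>: "\<sigma> \<in> cyclic_perms n (t n)" using ne by blast
  have "card {k \<in> {1..n}. \<sigma> k = k} \<le> card {1..n}" by (rule card_mono) auto
  then show ?thesis unfolding member(2)[OF \<sigma> n] using n by simp
qed

text \<open>The rate o(sqrt n) is what makes \<open>mean_err\<close> vanish, where the deviation of
  \<open>t n 1\<close> from \<open>n * p1\<close> is divided by sqrt n.\<close>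

lemma fix_frac_tendsto: "fix_frac \<longlonglongrightarrow> p1" and two_frac_tendsto: "two_frac \<longlonglongrightarrow> p2" and
  mean_err_tendsto: "mean_err a \<longlonglongrightarrow> 0"
proof -
  have 1: "(\<lambda>n. (real (t n 1) - real n * p1) / sqrt (real n)) \<longlonglongrightarrow> 0" by (rule smalloD_tendsto[OF t1])
  have 2: "(\<lambda>n. (2 * real (t n 2) - real n * p2) / real n) \<longlonglongrightarrow> 0" by (rule smalloD_tendsto[OF t2])
  have inv_sqrt: "(\<lambda>n. 1 / sqrt (real n)) \<longlonglongrightarrow> 0" by real_asymp
  have ev: "\<forall>\<^sub>F n in sequentially. 0 < n" by (rule eventually_gt_at_top)
  have "(\<lambda>n. p2 + (2 * real (t n 2) - real n * p2) / real n) \<longlonglongrightarrow> p2 + 0" by (intro tendsto_intros 2)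
  then have "(\<lambda>n. p2 + (2 * real (t n 2) - real n * p2) / real n) \<longlonglongrightarrow> p2" by simp
  then show "two_frac \<longlonglongrightarrow> p2"
    by (rule Lim_transform_eventually) (use ev in \<open>eventually_elim, simp add: two_frac_def field_simps\<close>)
  have "(\<lambda>n. p1 + (real (t n 1) - real n * p1) / sqrt (real n) * (1 / sqrt (real n))) \<longlonglongrightarrow> p1 + 0 * 0" by (intro tendsto_intros 1 inv_sqrt)
  then have "(\<lambda>n. p1 + (real (t n 1) - real n * p1) / sqrt (real n) * (1 / sqrt (real n))) \<longlonglongrightarrow> p1" by simp
  then show "fix_frac \<longlonglongrightarrow> p1"
    by (rule Lim_transform_eventually) (use ev in \<open>eventually_elim, simp add: fix_frac_def field_simps\<close>)
  have "(\<lambda>n. (7 * (real r)\<^sup>2 * (1 / sqrt (real n)) + 2 * real r * \<bar>(real (t n 1) - real n * p1) / sqrt (real n)\<bar>) * kern_bound r a) \<longlonglongrightarrow> (7 * (real r)\<^sup>2 * 0 + 2 * real r * \<bar>0\<bar>) * kern_bound r a"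
    by (intro tendsto_intros 1 inv_sqrt)
  then have "(\<lambda>n. (7 * (real r)\<^sup>2 * (1 / sqrt (real n)) + 2 * real r * \<bar>(real (t n 1) - real n * p1) / sqrt (real n)\<bar>) * kern_bound r a) \<longlonglongrightarrow> 0" by simp
  then show "mean_err a \<longlonglongrightarrow> 0"
    by (rule Lim_transform_eventually) (use ev in \<open>eventually_elim, simp add: mean_err_def fix_frac_def add_divide_distrib distrib_right\<close>)
qed

lemma var_err_tendsto: "var_err a \<longlonglongrightarrow> 0"
proof -
  have "(\<lambda>n. c / (d * real n)) \<longlonglongrightarrow> 0" for c d
    using tendsto_mult[OF tendsto_const lim_inverse_n', of "c / d"] by simp
  then show ?thesis unfolding var_err_def[abs_def] .
qed

lemma char_err_tendsto: "char_err a \<longlonglongrightarrow> 0"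
proof -
  have inv_sqrt: "(\<lambda>n. 1 / sqrt (real n)) \<longlonglongrightarrow> 0" by real_asymp
  have "(\<lambda>n. c / sqrt (real n)) \<longlonglongrightarrow> 0" for c
    using tendsto_mult[OF tendsto_const inv_sqrt, of c] by simp
  then show ?thesis unfolding char_err_def[abs_def] .
qed

lemma fin_var_tendsto: "fin_var a \<longlonglongrightarrow> lim_var a"
proof (rule Lim_transform_eventually)
  \<comment> \<open>\<open>asymp_var_tendsto\<close> asks for values in [0, 1] at every index, hence
    the value \<open>p1\<close> below n = 2.\<close>
  let ?q = "\<lambda>n. if 2 \<le> n then fix_frac n else p1"
  have ev: "\<forall>\<^sub>F n in sequentially. 2 \<le> n" by (rule eventually_ge_at_top)
  have "?q \<longlonglongrightarrow> p1"
    by (rule Lim_transform_eventually[OF fix_frac_tendsto]) (use ev in eventually_elim, simp)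
  then show "(\<lambda>n. asymp_var r (?q n) (two_frac n) (\<Psi> r a (?q n))) \<longlonglongrightarrow> lim_var a"
    unfolding lim_var_def using p1 fix_frac_bounds by (intro asymp_var_tendsto r two_frac_tendsto) auto
  show "\<forall>\<^sub>F n in sequentially. asymp_var r (?q n) (two_frac n) (\<Psi> r a (?q n)) = fin_var a n"
    using ev by eventually_elim (simp add: fin_var_def)
qed

text \<open>\<open>fin_var\<close> is within the vanishing \<open>var_err\<close> of an actual
  variance, so its limit cannot be negative.\<close>

lemma lim_var_nonneg: "0 \<le> lim_var a"
proof (rule tendsto_lowerbound[OF _ _ sequentially_bot])
  have "(\<lambda>n. fin_var a n + var_err a n) \<longlonglongrightarrow> lim_var a + 0" by (intro tendsto_intros fin_var_tendsto var_err_tendsto)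
  then show "(\<lambda>n. fin_var a n + var_err a n) \<longlonglongrightarrow> lim_var a" by simp
  show "\<forall>\<^sub>F n in sequentially. 0 \<le> fin_var a n + var_err a n"
    using eventually_ge_at_top[of 2]
  proof eventually_elim
    case (elim n)
    obtain \<sigma> where \<sigma>: "\<sigma> \<in> cyclic_perms n (t n)" using ne by blast
    have "0 < n" using elim by simp
    from asymp_var_ge[OF this r member(1)[OF \<sigma> elim] p1 member(2,3)[OF \<sigma> elim], of a]
    show ?case unfolding fin_var_def var_err_def by linarith
  qed
qed

text \<open>The bound of \<open>char_scaled_sum\<close> is the same for every
  \<open>\<sigma>\<close> in the class, so it passes to the average over the class.\<close>

lemma char_tendsto:
  "(\<lambda>n. CLINT x|rescaled_counts_law r p1 n (t n). iexp (\<Sum>\<pi>\<in>Sym r. a \<pi> * x \<pi>)) \<longlonglongrightarrow> complex_of_real (exp (- lim_var a / 2))"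
proof (rule LIM_zero_cancel, rule tendsto_norm_zero_cancel, rule tendsto_sandwich[OF _ _ tendsto_const])
  let ?e = "\<lambda>n. mean_err a n + char_err a n + (\<bar>fin_var a n - lim_var a\<bar> + var_err a n) / 2"
  have "?e \<longlonglongrightarrow> 0 + 0 + (\<bar>lim_var a - lim_var a\<bar> + 0) / 2"
    by (intro tendsto_intros mean_err_tendsto char_err_tendsto var_err_tendsto fin_var_tendsto) simp
  then show "?e \<longlonglongrightarrow> 0" by simp
  show "\<forall>\<^sub>F n in sequentially. cmod ((CLINT x|rescaled_counts_law r p1 n (t n). iexp (\<Sum>\<pi>\<in>Sym r. a \<pi> * x \<pi>)) - complex_of_real (exp (- lim_var a / 2))) \<le> ?e n"
    using eventually_ge_at_top[of 2]
  proof eventually_elim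
    case (elim n)
    have n: "0 < n" using elim by simp
    interpret P: prob_space unif_seq by (rule prob_space_unif_seq)
    have m: "(\<lambda>x. iexp x) \<in> borel_measurable borel" by measurable
    have i: "integrable unif_seq (\<lambda>u. iexp (scaled_sum r n p1 a \<sigma> u))" if \<sigma>: "\<sigma> \<in> cyclic_perms n (t n)" for \<sigma>
      using scaled_sum_meas[OF n r member(1)[OF \<sigma> elim] p1 member(2,3)[OF \<sigma> elim], of a]
      by (intro P.integrable_const_bound[of _ 1]) (auto intro: measurable_compose[OF _ m])
    have avg: "(CLINT x|rescaled_counts_law r p1 n (t n). iexp (\<Sum>\<pi>\<in>Sym r. a \<pi> * x \<pi>))
      = (1 / real (card (cyclic_perms n (t n)))) *\<^sub>R (\<Sum>\<sigma>\<in>cyclic_perms n (t n). CLINT u|unif_seq. iexp (scaled_sum r n p1 a \<sigma> u))"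
      by (rule integral_rescaled_counts_law_scaled_sum[where \<phi> = "\<lambda>x. iexp x", OF ne n r m i])
    show ?case
      unfolding avg
    proof (rule average_diff_le[OF finite_cyclic_perms ne])
      fix \<sigma> assume \<sigma>: "\<sigma> \<in> cyclic_perms n (t n)"
      show "cmod ((CLINT u|unif_seq. iexp (scaled_sum r n p1 a \<sigma> u)) - complex_of_real (exp (- lim_var a / 2))) \<le> ?e n"
        unfolding mean_err_def char_err_def var_err_def fin_var_def
        by (rule char_scaled_sum[OF n r member(1)[OF \<sigma> elim] p1 member(2,3)[OF \<sigma> elim] lim_var_nonneg])
    qed
  qed
qed simp

text \<open>A coordinate is the linear combination with a unit coefficient vector, so the second
  moment bound for \<open>scaled_sum\<close> applies.\<close>

lemma second_moment_bounded:
  assumes \<pi>: "\<pi> \<in> Sym r"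
  shows "\<exists>C. \<forall>\<^sub>F n in sequentially. integrable (rescaled_counts_law r p1 n (t n)) (\<lambda>x. (x \<pi>)\<^sup>2) \<and>
    (LINT x|rescaled_counts_law r p1 n (t n). (x \<pi>)\<^sup>2) \<le> C"
proof -
  define a :: "(nat \<Rightarrow> nat) \<Rightarrow> real" where "a \<rho> = (if \<rho> = \<pi> then 1 else 0)" for \<rho>
  have a: "(\<Sum>\<rho>\<in>Sym r. a \<rho> * x \<rho>) = x \<pi>" for x :: "(nat \<Rightarrow> nat) \<Rightarrow> real"
  proof -
    have "(\<Sum>\<rho>\<in>Sym r. a \<rho> * x \<rho>) = (\<Sum>\<rho>\<in>Sym r. if \<rho> = \<pi> then x \<rho> else 0)" by (rule sum.cong) (simp_all add: a_def)
    also have "\<dots> = x \<pi>" using \<pi> by (simp only: sum.delta[OF Sym_finite] if_True)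
    finally show ?thesis .
  qed
  have m: "(\<lambda>x :: real. x\<^sup>2) \<in> borel_measurable borel" by measurable
  let ?e = "\<lambda>n. 2 * (fin_var a n + var_err a n) + 2 * (mean_err a n)\<^sup>2"
  have "?e \<longlonglongrightarrow> 2 * (lim_var a + 0) + 2 * 0\<^sup>2"
    by (intro tendsto_intros mean_err_tendsto var_err_tendsto fin_var_tendsto)
  then have "\<forall>\<^sub>F n in sequentially. ?e n < 2 * lim_var a + 1" by (intro order_tendstoD(2)) auto
  then have "\<forall>\<^sub>F n in sequentially. integrable (rescaled_counts_law r p1 n (t n)) (\<lambda>x. (x \<pi>)\<^sup>2) \<and>
    (LINT x|rescaled_counts_law r p1 n (t n). (x \<pi>)\<^sup>2) \<le> 2 * lim_var a + 1"
    using eventually_ge_at_top[of 2]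
  proof eventually_elim
    case (elim n)
    have n: "0 < n" using elim by simp
    let ?C = "cyclic_perms n (t n)"
    have i: "integrable unif_seq (\<lambda>u. (scaled_sum r n p1 a \<sigma> u)\<^sup>2)" if \<sigma>: "\<sigma> \<in> ?C" for \<sigma>
      by (rule scaled_sum_second_moment(1)[OF n r member(1)[OF \<sigma> elim(2)] p1 member(2,3)[OF \<sigma> elim(2)]])
    have avg: "(LINT x|rescaled_counts_law r p1 n (t n). (\<Sum>\<rho>\<in>Sym r. a \<rho> * x \<rho>)\<^sup>2)
      = (1 / real (card ?C)) *\<^sub>R (\<Sum>\<sigma>\<in>?C. LINT u|unif_seq. (scaled_sum r n p1 a \<sigma> u)\<^sup>2)"
      by (rule integral_rescaled_counts_law_scaled_sum[where \<phi> = "\<lambda>x. x\<^sup>2", OF ne n r m i])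
    have c: "0 < real (card ?C)" using ne by (simp add: card_gt_0_iff)
    have "(\<Sum>\<sigma>\<in>?C. LINT u|unif_seq. (scaled_sum r n p1 a \<sigma> u)\<^sup>2) \<le> real (card ?C) * ?e n"
    proof (rule sum_bounded_above)
      fix \<sigma> assume \<sigma>: "\<sigma> \<in> ?C"
      show "(LINT u|unif_seq. (scaled_sum r n p1 a \<sigma> u)\<^sup>2) \<le> ?e n"
        unfolding mean_err_def var_err_def fin_var_def
        by (rule scaled_sum_second_moment(2)[OF n r member(1)[OF \<sigma> elim(2)] p1 member(2,3)[OF \<sigma> elim(2)]])
    qed
    then have "(1 / real (card ?C)) *\<^sub>R (\<Sum>\<sigma>\<in>?C. LINT u|unif_seq. (scaled_sum r n p1 a \<sigma> u)\<^sup>2) \<le> (1 / real (card ?C)) * (real (card ?C) * ?e n)"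
      unfolding real_scaleR_def by (intro mult_left_mono) auto
    also have "\<dots> = ?e n" using c by (simp add: ne)
    finally have "(LINT x|rescaled_counts_law r p1 n (t n). (\<Sum>\<rho>\<in>Sym r. a \<rho> * x \<rho>)\<^sup>2) \<le> ?e n"
      unfolding avg .
    then have "(LINT x|rescaled_counts_law r p1 n (t n). (x \<pi>)\<^sup>2) \<le> 2 * lim_var a + 1" using elim(1) unfolding a by linarith
    moreover have "integrable (rescaled_counts_law r p1 n (t n)) (\<lambda>x. (\<Sum>\<rho>\<in>Sym r. a \<rho> * x \<rho>)\<^sup>2)"
      by (rule integrable_rescaled_counts_law[OF ne m])
    ultimately show ?case unfolding a by (intro conjI)
  qed
  then show ?thesis ..
qed

text \<open>\<open>lim_var\<close> is at once the quadratic form of \<open>cov_mat\<close> and the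
  quantity in the limiting characteristic functions; its nonnegativity produces the Gaussian law,
  and the continuity theorem the convergence.\<close>

lemma gaussian_limit:
  "\<exists>N. is_centered_gaussian (Sym r) (cov_mat r p1 p2) N \<and>
    converges_weakly (product_topology (\<lambda>_. euclideanreal) (Sym r)) (\<lambda>n. rescaled_counts_law r p1 n (t n)) N"
proof -
  have Q: "(\<Sum>\<pi>\<in>Sym r. \<Sum>\<rho>\<in>Sym r. a \<pi> * cov_mat r p1 p2 \<pi> \<rho> * a \<rho>) = lim_var a" for a
    unfolding lim_var_def by (rule quadratic_form_cov_mat[OF r])
  obtain N where N: "is_centered_gaussian (Sym r) (cov_mat r p1 p2) N"
    using centered_gaussian_exists[of "Sym r" "cov_mat r p1 p2"] Q lim_var_nonneg by auto
  have "\<forall>\<pi>\<in>Sym r. \<exists>C. \<forall>\<^sub>F n in sequentially. integrable (rescaled_counts_law r p1 n (t n)) (\<lambda>x. (x \<pi>)\<^sup>2) \<and>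
    (LINT x|rescaled_counts_law r p1 n (t n). (x \<pi>)\<^sup>2) \<le> C"
    by (rule ballI) (rule second_moment_bounded)
  from bchoice[OF this] obtain C where C: "\<forall>\<pi>\<in>Sym r. \<forall>\<^sub>F n in sequentially. integrable (rescaled_counts_law r p1 n (t n)) (\<lambda>x. (x \<pi>)\<^sup>2) \<and>
    (LINT x|rescaled_counts_law r p1 n (t n). (x \<pi>)\<^sup>2) \<le> C \<pi>" ..
  have "converges_weakly (product_topology (\<lambda>_. euclideanreal) (Sym r)) (\<lambda>n. rescaled_counts_law r p1 n (t n)) N"
  proof (rule converges_weakly_charI[OF Sym_finite prob_space_rescaled_counts_law[OF ne] sets_rescaled_counts_law[OF ne]])
    show "prob_space N" "sets N = sets (PiM (Sym r) (\<lambda>_. borel))" using N by (auto simp: is_centered_gaussian_def)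
    have "(CLINT x|N. iexp (\<Sum>i\<in>Sym r. a i * x i)) = complex_of_real (exp (- lim_var a / 2))" for a
      using N unfolding is_centered_gaussian_def Q by blast
    then show "(\<lambda>n. CLINT x|rescaled_counts_law r p1 n (t n). iexp (\<Sum>i\<in>Sym r. a i * x i)) \<longlonglongrightarrow> (CLINT x|N. iexp (\<Sum>i\<in>Sym r. a i * x i))" for a
      using char_tendsto[of a] by simp
    have "\<forall>\<^sub>F n in sequentially. \<forall>\<pi>\<in>Sym r. integrable (rescaled_counts_law r p1 n (t n)) (\<lambda>x. (x \<pi>)\<^sup>2) \<and>
      (LINT x|rescaled_counts_law r p1 n (t n). (x \<pi>)\<^sup>2) \<le> C \<pi>"
      by (rule eventually_ball_finite[OF Sym_finite C])
    then show "\<forall>\<^sub>F n in sequentially. \<forall>\<pi>\<in>Sym r. integrable (rescaled_counts_law r p1 n (t n)) (\<lambda>x. (x \<pi>)\<^sup>2) \<and>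
      (LINT x|rescaled_counts_law r p1 n (t n). (x \<pi>)\<^sup>2) \<le> Max (C ` Sym r)"
    proof eventually_elim
      case (elim n)
      have "C \<pi> \<le> Max (C ` Sym r)" if "\<pi> \<in> Sym r" for \<pi> using that by (intro Max_ge) auto
      then show ?case using elim by (blast intro: order_trans)
    qed
  qed
  with N show ?thesis by blast
qed

end

theorem theorem2p15:
  fixes t :: "nat \<Rightarrow> nat \<Rightarrow> nat" and p1 p2 :: real and r :: nat
  assumes "\<And>n. is_cycle_type n (t n)"
    and "p1 \<in> {0..1}" and "p2 \<in> {0..1}"
    and "(\<lambda>n. real (t n 1) - real n * p1) \<in> o(\<lambda>n. sqrt (real n))"
    and "(\<lambda>n. 2 * real (t n 2) - real n * p2) \<in> o(\<lambda>n. real n)"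
    and "r \<ge> 1"
  shows "\<exists>N. is_centered_gaussian (Sym r) (cov_mat r p1 p2) N \<and>
    converges_weakly (product_topology (\<lambda>_. euclideanreal) (Sym r))
      (\<lambda>n. rescaled_counts_law r p1 n (t n)) N"
  by (rule gaussian_limit[OF assms(1,2,4,5,6)])

end
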